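(* With notation as in the context: (1) For $G=T$: $\det M_0(t)=(1-t)^3\,\Delta^-_{2,3,3}(t)$ and $\det M(t)=(1-t)^4\,\Delta_{2,2,3,3}(t)$. (2) For $G=O$: $\det M_0(t)=(1-t)^3(1-t^2)\,\Delta^-_{2,3,4}(t)$ and $\det M(t)=(1-t)^4(1-t^2)\,\Delta_{2,2,3,4}(t)$. (3) For $G=I$: $\det M_0(t)=(1-t)^4\,\Delta^-_{2,3,5}(t)$ and $\det M(t)=(1-t)^5\,\Delta_{2,2,3,5}(t)$.
   Context: For a finite group $G\subset\mathrm{SL}_3(\mathbb{C})$: let $\gamma$ be its natural 3-dimensional representation, $\gamma^*$ the contragredient representation, $\gamma_0,\dots,\gamma_l$ the irreducible complex representations of $G$ with $\gamma_0$ trivial. Define $(l+1)\times(l+1)$ integer matrices $B=(b_{ij})$, $B^*=(b^*_{ij})$ by $\gamma_j\otimes\gamma=\bigoplus_i b_{ij}\gamma_i$, $\gamma_j\otimes\gamma^*=\bigoplus_i b^*_{ij}\gamma_i$. Let $M(t)=(1-t^3)I-tB+t^2B^*$ and let $M_0(t)$ be obtained from $M(t)$ by replacing the column indexed by $\gamma_0$ with $(1,0,\dots,0)^t$ ($\gamma_0$ first). (These determinants do not depend on the ordering of the irreducibles other than $\gamma_0$, nor on replacing $G$ by a conjugate.) For positive integers $\alpha_1,\dots,\alpha_m$ write $[\alpha]_t=(1-t^\alpha)/(1-t)=1+t+\dots+t^{\alpha-1}$ and define $\Delta^-_{\alpha_1,\dots,\alpha_m}(t)=(1+t)\prod_{i=1}^m[\alpha_i]_t-t\sum_{i=1}^m[\alpha_i-1]_t\prod_{j\ne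 i}[\alpha_j]_t$, $\Delta_{\alpha_1,\dots,\alpha_m}(t)=(1-t)^{2-m}\prod_{i=1}^m(1-t^{\alpha_i})$, $\Delta^+_{\alpha_1,\dots,\alpha_m}(t)=(1-2t-2t^2+t^3)\prod_{i=1}^m[\alpha_i]_t+t^2\sum_{i=1}^m[\alpha_i-1]_t\prod_{j\ne i}[\alpha_j]_t$. (These are the characteristic polynomials of Coxeter elements for the graphs $T^-$, $T$, $T^+$ with arms of lengths $\alpha_i$.) Groups: $T\subset\mathrm{SL}_3(\mathbb{C})$ is the tetrahedral group of order 12, i.e. the image of the irreducible 3-dimensional representation of $A_4$ (equivalently the group $\Delta(12)$ generated by the diagonal matrices $\mathrm{diag}(\pm1,\pm1,\pm1)$ of determinant 1 and the cyclic permutation matrix). $O$ is the octahedral group of order 24, the rotation group of the cube (image of $S_4$ in $\mathrm{SO}(3)$). $I$ is the icosahedral group of order 60, the image of an irreducible 3-dimensional representation of $A_5$ (rotation group of the icosahedron). *)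

theory Defs
  imports "Jordan_Normal_Form.Determinant" "HOL-Computational_Algebra.Polynomial"
begin

definition mat_gen_group :: "complex mat set \<Rightarrow> complex mat set" where
  "mat_gen_group S = \<Inter>{H. 1\<^sub>m 3 \<in> H \<and> S \<subseteq> H \<and> (\<forall>a\<in>H. \<forall>b\<in>H. a * b \<in> H)}"

definition diag3 :: "complex \<Rightarrow> complex \<Rightarrow> complex \<Rightarrow> complex mat" where
  "diag3 a b c = mat 3 3 (\<lambda>(i,j). if i = j then (if i = 0 then a else if i = 1 then b else c) else 0)"

definition cyc3 :: "complex mat" where
  "cyc3 = mat 3 3 (\<lambda>(i,j). if i = (j + 1) mod 3 then 1 else 0)"

definition tetra_group :: "complex mat set" where
  "tetra_group = mat_gen_group {diag3 1 (-1) (-1), diag3 (-1) 1 (-1), diag3 (-1) (-1) 1, cyc3}"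

definition rotation_group :: "complex vec set \<Rightarrow> complex mat set" where
  "rotation_group V = {g \<in> carrier_mat 3 3.
      (\<forall>i<3. \<forall>j<3. g $$ (i,j) \<in> \<real>) \<and> g * transpose_mat g = 1\<^sub>m 3 \<and> det g = 1 \<and>
      (\<forall>v\<in>V. g *\<^sub>v v \<in> V)}"

definition cube_vertices :: "complex vec set" where
  "cube_vertices = {vec_of_list [a, b, c] | a b c. a \<in> {1, -1} \<and> b \<in> {1, -1} \<and> c \<in> {1, -1}}"

definition golden :: complex where "golden = (1 + sqrt 5) / 2"

definition icosa_vertices :: "complex vec set" where
  "icosa_vertices = {vec_of_list [0, a, b * golden] | a b. a \<in> {1, -1} \<and> b \<in> {1, -1}}
     \<union> {vec_of_list [a, b * golden, 0] | a b. a \<in> {1, -1} \<and> b \<in> {1, -1}}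
     \<union> {vec_of_list [b * golden, 0, a] | a b. a \<in> {1, -1} \<and> b \<in> {1, -1}}"

definition octa_group :: "complex mat set" where
  "octa_group = rotation_group cube_vertices"

definition icosa_group :: "complex mat set" where
  "icosa_group = rotation_group icosa_vertices"

text \<open>Representations of a matrix group G of degree n (values off G are irrelevant)\<close>
definition is_rep :: "complex mat set \<Rightarrow> nat \<Rightarrow> (complex mat \<Rightarrow> complex mat) \<Rightarrow> bool" where
  "is_rep G n \<rho> \<longleftrightarrow> (\<forall>g\<in>G. \<rho> g \<in> carrier_mat n n) \<and> \<rho> (1\<^sub>m 3) = 1\<^sub>m n \<and>
     (\<forall>g\<in>G. \<forall>h\<in>G. \<rho> (g * h) = \<rho> g * \<rho> h)"

definition is_subspace :: "nat \<Rightarrow> complex vec set \<Rightarrow> bool" where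
  "is_subspace n W \<longleftrightarrow> W \<subseteq> carrier_vec n \<and> 0\<^sub>v n \<in> W \<and>
     (\<forall>v\<in>W. \<forall>w\<in>W. v + w \<in> W) \<and> (\<forall>c. \<forall>v\<in>W. c \<cdot>\<^sub>v v \<in> W)"

definition irreducible_rep :: "complex mat set \<Rightarrow> nat \<Rightarrow> (complex mat \<Rightarrow> complex mat) \<Rightarrow> bool" where
  "irreducible_rep G n \<rho> \<longleftrightarrow> is_rep G n \<rho> \<and> n > 0 \<and>
     (\<forall>W. is_subspace n W \<and> (\<forall>g\<in>G. \<forall>w\<in>W. \<rho> g *\<^sub>v w \<in> W) \<longrightarrow> W = {0\<^sub>v n} \<or> W = carrier_vec n)"

definition iso_rep :: "complex mat set \<Rightarrow> nat \<Rightarrow> (complex mat \<Rightarrow> complex mat) \<Rightarrow> nat \<Rightarrow> (complex mat \<Rightarrow> complex mat) \<Rightarrow> bool" where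
  "iso_rep G n \<rho> m \<sigma> \<longleftrightarrow> n = m \<and>
     (\<exists>A \<in> carrier_mat n n. invertible_mat A \<and> (\<forall>g\<in>G. A * \<rho> g = \<sigma> g * A))"

definition hom_space :: "complex mat set \<Rightarrow> nat \<Rightarrow> (complex mat \<Rightarrow> complex mat) \<Rightarrow> nat \<Rightarrow> (complex mat \<Rightarrow> complex mat) \<Rightarrow> complex mat set" where
  "hom_space G n \<rho> m \<sigma> = {A \<in> carrier_mat m n. \<forall>g\<in>G. A * \<rho> g = \<sigma> g * A}"

definition mats_lin_indep :: "nat \<Rightarrow> nat \<Rightarrow> complex mat list \<Rightarrow> bool" where
  "mats_lin_indep m n As \<longleftrightarrow> (\<forall>c :: nat \<Rightarrow> complex.
     (\<forall>i<m. \<forall>j<n. (\<Sum>k<length As. c k * As ! k $$ (i,j)) = 0) \<longrightarrow> (\<forall>k<length As. c k = 0))"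

definition hom_dim :: "complex mat set \<Rightarrow> nat \<Rightarrow> (complex mat \<Rightarrow> complex mat) \<Rightarrow> nat \<Rightarrow> (complex mat \<Rightarrow> complex mat) \<Rightarrow> nat" where
  "hom_dim G n \<rho> m \<sigma> = (GREATEST k. \<exists>As. length As = k \<and> set As \<subseteq> hom_space G n \<rho> m \<sigma> \<and> mats_lin_indep m n As)"

definition multiplicity :: "complex mat set \<Rightarrow> nat \<Rightarrow> (complex mat \<Rightarrow> complex mat) \<Rightarrow> nat \<Rightarrow> (complex mat \<Rightarrow> complex mat) \<Rightarrow> nat" where
  "multiplicity G n \<rho> m \<sigma> = hom_dim G n \<rho> m \<sigma>"

definition kron :: "complex mat \<Rightarrow> complex mat \<Rightarrow> complex mat" where
  "kron A B = mat (dim_row A * dim_row B) (dim_col A * dim_col B)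
     (\<lambda>(i,j). A $$ (i div dim_row B, j div dim_col B) * B $$ (i mod dim_row B, j mod dim_col B))"

definition inv3 :: "complex mat \<Rightarrow> complex mat" where
  "inv3 g = (THE h. h \<in> carrier_mat 3 3 \<and> g * h = 1\<^sub>m 3)"

definition nat_rep :: "complex mat \<Rightarrow> complex mat" where "nat_rep g = g"
definition dual_nat_rep :: "complex mat \<Rightarrow> complex mat" where
  "dual_nat_rep g = transpose_mat (inv3 g)"

definition complete_irreps :: "complex mat set \<Rightarrow> (nat \<times> (complex mat \<Rightarrow> complex mat)) list \<Rightarrow> bool" where
  "complete_irreps G Rs \<longleftrightarrow> Rs \<noteq> [] \<and>
     (\<forall>r\<in>set Rs. irreducible_rep G (fst r) (snd r)) \<and>
     (\<forall>i<length Rs. \<forall>j<length Rs. i \<noteq> j \<longrightarrow>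
        \<not> iso_rep G (fst (Rs!i)) (snd (Rs!i)) (fst (Rs!j)) (snd (Rs!j))) \<and>
     (\<forall>n \<rho>. irreducible_rep G n \<rho> \<longrightarrow> (\<exists>r\<in>set Rs. iso_rep G n \<rho> (fst r) (snd r))) \<and>
     fst (Rs!0) = 1 \<and> (\<forall>g\<in>G. snd (Rs!0) g = 1\<^sub>m 1)"

definition McKayB :: "complex mat set \<Rightarrow> (nat \<times> (complex mat \<Rightarrow> complex mat)) list \<Rightarrow> nat \<Rightarrow> nat \<Rightarrow> nat" where
  "McKayB G Rs i j = multiplicity G (fst (Rs!i)) (snd (Rs!i))
      (fst (Rs!j) * 3) (\<lambda>g. kron (snd (Rs!j) g) (nat_rep g))"

definition McKayBstar :: "complex mat set \<Rightarrow> (nat \<times> (complex mat \<Rightarrow> complex mat)) list \<Rightarrow> nat \<Rightarrow> nat \<Rightarrow> nat" where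
  "McKayBstar G Rs i j = multiplicity G (fst (Rs!i)) (snd (Rs!i))
      (fst (Rs!j) * 3) (\<lambda>g. kron (snd (Rs!j) g) (dual_nat_rep g))"

definition Mt :: "complex mat set \<Rightarrow> (nat \<times> (complex mat \<Rightarrow> complex mat)) list \<Rightarrow> int poly mat" where
  "Mt G Rs = mat (length Rs) (length Rs) (\<lambda>(i,j).
     (if i = j then 1 - monom 1 3 else 0) - monom (int (McKayB G Rs i j)) 1
       + monom (int (McKayBstar G Rs i j)) 2)"

definition M0t :: "complex mat set \<Rightarrow> (nat \<times> (complex mat \<Rightarrow> complex mat)) list \<Rightarrow> int poly mat" where
  "M0t G Rs = mat (length Rs) (length Rs) (\<lambda>(i,j).
     if j = 0 then (if i = 0 then 1 else 0) else Mt G Rs $$ (i,j))"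

definition qint :: "nat \<Rightarrow> int poly" where
  "qint a = (\<Sum>k<a. monom 1 k)"

definition Delta_minus :: "nat list \<Rightarrow> int poly" where
  "Delta_minus as = [:1, 1:] * (\<Prod>i<length as. qint (as!i))
     - [:0, 1:] * (\<Sum>i<length as. qint (as!i - 1) * (\<Prod>j\<in>{..<length as} - {i}. qint (as!j)))"

text \<open>(1-t)^(2-m) * prod (1 - t^a_i) written as (1-t)^2 * prod [a_i]_t\<close>
definition Delta :: "nat list \<Rightarrow> int poly" where
  "Delta as = [:1, -1:]^2 * (\<Prod>i<length as. qint (as!i))"

definition Delta_plus :: "nat list \<Rightarrow> int poly" where
  "Delta_plus as = [:1, -2, -2, 1:] * (\<Prod>i<length as. qint (as!i))
     + [:0, 0, 1:] * (\<Sum>i<length as. qint (as!i - 1) * (\<Prod>j\<in>{..<length as} - {i}. qint (as!j)))"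

end

theory Submission
  imports Defs "Jordan_Normal_Form.Spectral_Radius"
begin

text \<open>The character table \<open>X\<close> of \<open>G\<close> (rows: conjugacy classes, columns: irreducibles) diagonalizes tensoring
  with the natural representation, so \<open>X M(t) = D X\<close> with \<open>D = diag (P\<^sub>a(t))\<close> and
  \<open>P\<^sub>a(t) = det (1 - t g\<^sub>a) = 1 - \<chi>(g\<^sub>a) t + \<chi>(g\<^sub>a) t\<^sup>2 - t\<^sup>3\<close>; here the natural
  representation is its own dual because the three groups are real orthogonal. Hence \<open>det M(t)\<close> is the product of the \<open>P\<^sub>a\<close> over the classes, and
  Cramer's rule turns \<open>det M\<^sub>0(t) / det M(t)\<close> into the Molien series \<open>(1/|G|) \<Sum>\<^sub>g 1 / det (1 - t g)\<close>.
  Only class sizes and traces are needed, never the irreducible representations themselves.\<close>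

section \<open>Finite-dimensional linear algebra\<close>

text \<open>Three obstacles shape the proof. The list of irreducibles is abstract: it is
  irreducible, pairwise non-isomorphic and exhaustive, but nothing says how long it is. That the
  character table is square and invertible is therefore part of the work, and it rests on the fact
  that irreducible characters span the class functions. This fact is obtained without complete
  reducibility: a nonzero class operator on the regular representation would have an irreducible
  piece in its range, and adjointness rules that out. The McKay numbers are defined as the greatest
  length of an independent list of intertwiners, so every multiplicity is turned into a character
  sum by reading a dimension as the trace of an averaging projection; no tensor product is ever
  decomposed. The octahedral and icosahedral groups are given by what they preserve, so an
  enumeration has to be proved exhaustive. A rotation is determined by the images of three vertices,
  which leaves a finite search. The search runs exactly over pairs of integers, and irrationality of
  sqrt 5 makes inequalities as reliable as equalities there.\<close>

lemma underdetermined_system: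
  fixes a :: "nat \<Rightarrow> nat \<Rightarrow> complex"
  assumes "k < m"
  shows "\<exists>d. (\<exists>j<m. d j \<noteq> 0) \<and> (\<forall>i<k. (\<Sum>j<m. a i j * d j) = 0)"
proof -
  \<comment> \<open>The system is padded with zero rows to a square one. Row \<open>k\<close>
    vanishes because \<open>k < m\<close>, so a unit vector lies in the kernel of the transpose and
    the matrix is singular.\<close>
  define M where "M = mat m m (\<lambda>(i,j). if i < k then a i j else 0)"
  have M: "M \<in> carrier_mat m m" by (simp add: M_def)
  have "transpose_mat M *\<^sub>v unit_vec m k = 0\<^sub>v m"
    using assms by (intro eq_vecI) (auto simp: M_def)
  moreover have "unit_vec m k \<noteq> (0\<^sub>v m :: complex vec)"
    using assms by (metis index_unit_vec(2) index_zero_vec(1) zero_neq_one)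
  ultimately have "det (transpose_mat M) = 0"
    using det_0_iff_vec_prod_zero[of "transpose_mat M" m] M by (metis transpose_carrier_mat unit_vec_carrier)
  then have "det M = 0" using det_transpose[OF M] by simp
  then obtain v where v: "v \<in> carrier_vec m" "v \<noteq> 0\<^sub>v m" "M *\<^sub>v v = 0\<^sub>v m"
    using det_0_iff_vec_prod_zero[OF M] by blast
  show ?thesis
  proof (rule exI[of _ "\<lambda>j. v $ j"], intro conjI allI impI)
    show "\<exists>j<m. v $ j \<noteq> 0"
    proof (rule ccontr)
      assume "\<not> ?thesis"
      then have "v = 0\<^sub>v m" using v(1) by (intro eq_vecI) auto
      then show False using v(2) by simp
    qed
    fix i assume i: "i < k"
    then have "(M *\<^sub>v v) $ i = 0" using v(3) assms by simp
    then show "(\<Sum>j<m. a i j * v $ j) = 0"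
      using i assms v(1) by (simp add: M_def scalar_prod_def atLeast0LessThan)
  qed
qed

text \<open>Subspaces of functions are encoded as nonempty sets closed under
  \<open>u + a * v\<close>; the zero function, needed for the empty sum, is
  \<open>u + (-1) * u\<close>.\<close>

lemma subspace_sum_mem:
  fixes W :: "('a \<Rightarrow> complex) set"
  assumes "W \<noteq> {}" "\<And>u v a. u \<in> W \<Longrightarrow> v \<in> W \<Longrightarrow> (\<lambda>x. u x + a * v x) \<in> W"
    and "\<And>l. l < k \<Longrightarrow> b l \<in> W"
  shows "(\<lambda>x. \<Sum>l<(k::nat). a l * b l x) \<in> W"
  using assms(3)
proof (induction k)
  case 0
  obtain u where "u \<in> W" using assms(1) by auto
  then show ?case using assms(2)[of u u "-1"] by simp
next
  case (Suc k)
  then show ?case using assms(2)[of "\<lambda>x. \<Sum>l<k. a l * b l x" "b k" "a k"] by simp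
qed

text \<open>With more than \<open>card I\<close> functions on \<open>I\<close> there is a linear
  relation between the \<open>b j\<close>, and pairing it with \<open>c l\<close> isolates the
  coefficient \<open>d l\<close>. This bound makes a maximal biorthogonal system exist.\<close>

lemma biorthogonal_card_le:
  fixes b c :: "nat \<Rightarrow> 'a \<Rightarrow> complex"
  assumes "finite I"
    and "\<And>l m. l < k \<Longrightarrow> m < k \<Longrightarrow> (\<Sum>x\<in>I. c l x * b m x) = (if l = m then 1 else 0)"
  shows "k \<le> card I"
proof (rule ccontr)
  assume "\<not> k \<le> card I"
  then have lt: "card I < k" by simp
  obtain e where e: "bij_betw e {..<card I} I"
    using ex_bij_betw_nat_finite[OF assms(1)] by (auto simp: atLeast0LessThan)
  obtain d where d: "\<exists>j<k. d j \<noteq> 0" "\<forall>i<card I. (\<Sum>j<k. b j (e i) * d j) = 0"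
    using underdetermined_system[OF lt, of "\<lambda>i j. b j (e i)"] by auto
  have z: "(\<Sum>j<k. b j x * d j) = 0" if "x \<in> I" for x
  proof -
    have "x \<in> e ` {..<card I}" using e that by (simp add: bij_betw_def)
    then obtain i where "i < card I" "x = e i" by auto
    then show ?thesis using d(2) by simp
  qed
  have "d l = 0" if l: "l < k" for l
  proof -
    have "d l = (\<Sum>j<k. (if l = j then 1 else 0) * d j)"
      using l by (simp add: if_distrib[of "\<lambda>z. z * _"] cong: if_cong)
    also have "\<dots> = (\<Sum>j<k. (\<Sum>x\<in>I. c l x * b j x) * d j)"
      using assms(2) l by (intro sum.cong) auto
    also have "\<dots> = (\<Sum>x\<in>I. c l x * (\<Sum>j<k. b j x * d j))"
      by (simp only: sum_distrib_left sum_distrib_right mult.assoc) (rule sum.swap)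
    also have "\<dots> = 0" using z by simp
    finally show ?thesis .
  qed
  then show False using d(1) by auto
qed

text \<open>Existence of a maximal biorthogonal system whose first half lies in \<open>W\<close>; maximality makes it
  a basis, since a vector \<open>u \<noteq> 0\<close> annihilated by all \<open>c l\<close> could be adjoined, paired with a
  coordinate functional corrected by the projection.\<close>

lemma dual_basis:
  fixes W :: "('a \<Rightarrow> complex) set"
  assumes fin: "finite I" and ne: "W \<noteq> {}"
    and cl: "\<And>u v a. u \<in> W \<Longrightarrow> v \<in> W \<Longrightarrow> (\<lambda>x. u x + a * v x) \<in> W"
  shows "\<exists>k b c. (k::nat) \<le> card I \<and> (\<forall>l<k. b l \<in> W) \<and>
    (\<forall>l<k. \<forall>m<k. (\<Sum>x\<in>I. c l x * b m x) = (if l = m then 1 else 0)) \<and>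
    (\<forall>w\<in>W. \<forall>x\<in>I. w x = (\<Sum>l<k. b l x * (\<Sum>y\<in>I. c l y * w y)))"
proof -
  define Q where "Q k \<longleftrightarrow> (\<exists>b c. (\<forall>l<k. b l \<in> W) \<and>
    (\<forall>l<k. \<forall>m<k. (\<Sum>x\<in>I. c l x * b m x) = (if l = m then 1 else (0::complex))))" for k :: nat
  have Q0: "Q 0" by (simp add: Q_def)
  have Qb: "k \<le> card I" if "Q k" for k
    using that biorthogonal_card_le[OF fin] unfolding Q_def by blast
  define k where "k = (GREATEST k. Q k)"
  have Qk: "Q k" unfolding k_def using GreatestI_nat[of Q 0 "card I"] Q0 Qb by blast
  have nQ: "\<not> Q (Suc k)"
    using Greatest_le_nat[of Q "Suc k" "card I"] Qb unfolding k_def by fastforce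
  obtain b c where b: "\<And>l. l < k \<Longrightarrow> b l \<in> W" and
    c: "\<And>l m. l < k \<Longrightarrow> m < k \<Longrightarrow> (\<Sum>x\<in>I. c l x * b m x) = (if l = m then 1 else 0)"
    using Qk unfolding Q_def by blast
  have span: "w x = (\<Sum>l<k. b l x * (\<Sum>y\<in>I. c l y * w y))" if w: "w \<in> W" and x: "x \<in> I" for w x
  proof (rule ccontr)
    assume neq: "\<not> ?thesis"
    define p where "p l = (\<Sum>y\<in>I. c l y * w y)" for l
    define u where "u z = w z - (\<Sum>l<k. b l z * p l)" for z
    have ux: "u x \<noteq> 0" using neq by (simp add: u_def p_def)
    have "(\<lambda>z. \<Sum>l<k. p l * b l z) \<in> W"
      by (rule subspace_sum_mem[OF ne]) (simp_all add: cl b)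
    from cl[OF w this, of "- 1"] have "(\<lambda>z. w z + (- 1) * (\<Sum>l<k. p l * b l z)) \<in> W" .
    then have uW: "u \<in> W" by (simp add: u_def[abs_def] mult.commute)
    have cu: "(\<Sum>z\<in>I. c l z * u z) = 0" if l: "l < k" for l
    proof -
      have "(\<Sum>z\<in>I. c l z * u z) = p l - (\<Sum>z\<in>I. c l z * (\<Sum>m<k. b m z * p m))"
        unfolding u_def right_diff_distrib sum_subtractf p_def[of l] by (rule refl)
      also have "(\<Sum>z\<in>I. c l z * (\<Sum>m<k. b m z * p m)) = (\<Sum>m<k. (\<Sum>z\<in>I. c l z * b m z) * p m)"
        unfolding sum_distrib_left sum_distrib_right
        by (subst sum.swap) (simp add: mult.assoc)
      also have "\<dots> = (\<Sum>m<k. (if l = m then 1 else 0) * p m)"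
        using c l by (intro sum.cong) auto
      also have "\<dots> = p l" using l by (simp add: if_distrib[of "\<lambda>z. z * _"] cong: if_cong)
      finally show ?thesis by simp
    qed
    define b' where "b' l = (if l = k then u else b l)" for l
    define y where "y z = (if z = x then 1 / u x else 0)" for z
    define c' where "c' l = (if l = k then (\<lambda>z. y z - (\<Sum>m<k. b m x / u x * c m z)) else c l)" for l
    have y_sum: "(\<Sum>z\<in>I. y z * v z) = v x / u x" for v
      unfolding y_def using x fin by (simp add: if_distrib[of "\<lambda>z. z * _"] cong: if_cong)
    have ck: "(\<Sum>z\<in>I. c' k z * v z) = v x / u x - (\<Sum>m<k. b m x / u x * (\<Sum>z\<in>I. c m z * v z))" for v
    proof -
      have "(\<Sum>z\<in>I. c' k z * v z) = (\<Sum>z\<in>I. y z * v z) - (\<Sum>z\<in>I. (\<Sum>m<k. b m x / u x * c m z) * v z)"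
        by (simp add: c'_def left_diff_distrib sum_subtractf)
      also have "(\<Sum>z\<in>I. (\<Sum>m<k. b m x / u x * c m z) * v z) = (\<Sum>m<k. b m x / u x * (\<Sum>z\<in>I. c m z * v z))"
        unfolding sum_distrib_left sum_distrib_right
        by (subst sum.swap) (simp add: mult.assoc)
      finally show ?thesis by (simp add: y_sum)
    qed
    have "Q (Suc k)" unfolding Q_def
    proof (intro exI conjI allI impI)
      fix l assume "l < Suc k" then show "b' l \<in> W" using b uW by (auto simp: b'_def less_Suc_eq)
    next
      fix l m assume lm: "l < Suc k" "m < Suc k"
      consider "l < k" "m < k" | "l < k" "m = k" | "l = k" "m < k" | "l = k" "m = k"
        using lm by linarith
      then show "(\<Sum>x\<in>I. c' l x * b' m x) = (if l = m then 1 else 0)"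
      proof cases
        case 1 then show ?thesis using c by (simp add: b'_def c'_def)
      next
        case 2 then show ?thesis using cu by (simp add: b'_def c'_def)
      next
        case 3
        have "(\<Sum>n<k. b n x / u x * (\<Sum>z\<in>I. c n z * b m z)) = (\<Sum>n<k. b n x / u x * (if n = m then 1 else 0))"
          using c 3 by (intro sum.cong) auto
        also have "\<dots> = b m x / u x" using 3 by (simp add: if_distrib[of "\<lambda>z. _ * z"] cong: if_cong)
        finally show ?thesis using 3 ck[of "b m"] by (simp add: b'_def)
      next
        case 4 then show ?thesis using ck[of u] cu ux by (simp add: b'_def)
      qed
    qed
    then show False using nQ by blast
  qed
  show ?thesis
    by (rule exI[of _ k], rule exI[of _ b], rule exI[of _ c], intro conjI ballI allI impI)
      (fact Qb[OF Qk], erule b, erule (1) c, erule (1) span)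
qed

text \<open>\<open>P\<close> is the kernel of a projection onto \<open>W\<close>: its columns lie in
  \<open>W\<close> and it fixes \<open>W\<close>. Expanding the columns gives
  \<open>P = b c P\<close>, and cyclicity of the trace turns this into
  \<open>tr (c P b) = tr (c b) = k\<close>.\<close>

lemma trace_projection:
  fixes W :: "('a \<Rightarrow> complex) set"
  assumes fin: "finite I"
    and b: "\<And>l. l < (k::nat) \<Longrightarrow> b l \<in> W"
    and c: "\<And>l m. l < k \<Longrightarrow> m < k \<Longrightarrow> (\<Sum>x\<in>I. c l x * b m x) = (if l = m then 1 else 0)"
    and span: "\<And>w x. w \<in> W \<Longrightarrow> x \<in> I \<Longrightarrow> w x = (\<Sum>l<k. b l x * (\<Sum>y\<in>I. c l y * w y))"
    and P: "\<And>y. y \<in> I \<Longrightarrow> (\<lambda>x. P x y) \<in> W"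
    and PW: "\<And>w x. w \<in> W \<Longrightarrow> x \<in> I \<Longrightarrow> (\<Sum>y\<in>I. P x y * w y) = w x"
  shows "(\<Sum>x\<in>I. P x x) = of_nat k"
proof -
  have "(\<Sum>x\<in>I. P x x) = (\<Sum>x\<in>I. \<Sum>l<k. b l x * (\<Sum>y\<in>I. c l y * P y x))"
    by (intro sum.cong refl span P)
  also have "\<dots> = (\<Sum>l<k. \<Sum>x\<in>I. \<Sum>y\<in>I. c l y * (P y x * b l x))"
    by (subst sum.swap) (simp add: sum_distrib_left ac_simps)
  also have "\<dots> = (\<Sum>l<k. \<Sum>y\<in>I. c l y * (\<Sum>x\<in>I. P y x * b l x))"
    by (simp only: sum_distrib_left) (intro sum.cong refl sum.swap)
  also have "\<dots> = (\<Sum>l<k. \<Sum>y\<in>I. c l y * b l y)"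
    by (intro sum.cong refl) (simp add: PW b)
  also have "\<dots> = (\<Sum>l<k. 1)" by (intro sum.cong refl) (simp add: c)
  also have "\<dots> = of_nat k" by simp
  finally show ?thesis .
qed

section \<open>Traces, sums of matrices and invertibility\<close>

definition mtr :: "complex mat \<Rightarrow> complex" where
  "mtr A = (\<Sum>i<dim_row A. A $$ (i,i))"

text \<open>The size of a matrix is part of its value, so a sum over a set, which may be empty,
  takes its dimensions as arguments.\<close>

definition msum :: "'b set \<Rightarrow> nat \<Rightarrow> nat \<Rightarrow> ('b \<Rightarrow> complex mat) \<Rightarrow> complex mat" where
  "msum S n m F = mat n m (\<lambda>(i,j). \<Sum>g\<in>S. F g $$ (i,j))"

lemma msum_carrier [simp]: "msum S n m F \<in> carrier_mat n m"
  by (simp add: msum_def)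

lemma msum_index: "i < n \<Longrightarrow> j < m \<Longrightarrow> msum S n m F $$ (i,j) = (\<Sum>g\<in>S. F g $$ (i,j))"
  by (simp add: msum_def)

lemma msum_cong: "(\<And>g. g \<in> S \<Longrightarrow> F g = F' g) \<Longrightarrow> msum S n m F = msum S n m F'"
  by (simp add: msum_def cong: sum.cong)

lemma mult_entry:
  assumes "A \<in> carrier_mat n m" "B \<in> carrier_mat m k" "i < n" "j < k"
  shows "(A * B) $$ (i,j) = (\<Sum>l<m. A $$ (i,l) * B $$ (l,j))"
  using assms by (simp add: scalar_prod_def atLeast0LessThan)

lemma mult_vec_entry:
  assumes "A \<in> carrier_mat n m" "v \<in> carrier_vec m" "i < n"
  shows "(A *\<^sub>v v) $ i = (\<Sum>l<m. A $$ (i,l) * v $ l)"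
  using assms by (simp add: scalar_prod_def atLeast0LessThan)

lemma mult_msum:
  assumes A: "A \<in> carrier_mat p n" and F: "\<And>g. g \<in> S \<Longrightarrow> F g \<in> carrier_mat n m"
  shows "A * msum S n m F = msum S p m (\<lambda>g. A * F g)"
proof (rule eq_matI)
  fix i j assume "i < dim_row (msum S p m (\<lambda>g. A * F g))" "j < dim_col (msum S p m (\<lambda>g. A * F g))"
  then have ij: "i < p" "j < m" by (simp_all add: msum_def)
  have "(A * msum S n m F) $$ (i,j) = (\<Sum>l<n. \<Sum>g\<in>S. A $$ (i,l) * F g $$ (l,j))"
    using ij by (simp add: mult_entry[OF A msum_carrier] msum_index sum_distrib_left)
  also have "\<dots> = (\<Sum>g\<in>S. \<Sum>l<n. A $$ (i,l) * F g $$ (l,j))" by (rule sum.swap)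
  also have "\<dots> = msum S p m (\<lambda>g. A * F g) $$ (i,j)"
    using ij by (simp add: msum_index mult_entry[OF A F] cong: sum.cong)
  finally show "(A * msum S n m F) $$ (i,j) = msum S p m (\<lambda>g. A * F g) $$ (i,j)" .
qed (use A in \<open>auto simp: msum_def\<close>)

lemma msum_mult:
  assumes A: "A \<in> carrier_mat m p" and F: "\<And>g. g \<in> S \<Longrightarrow> F g \<in> carrier_mat n m"
  shows "msum S n m F * A = msum S n p (\<lambda>g. F g * A)"
proof (rule eq_matI)
  fix i j assume "i < dim_row (msum S n p (\<lambda>g. F g * A))" "j < dim_col (msum S n p (\<lambda>g. F g * A))"
  then have ij: "i < n" "j < p" by (simp_all add: msum_def)
  have "(msum S n m F * A) $$ (i,j) = (\<Sum>l<m. \<Sum>g\<in>S. F g $$ (i,l) * A $$ (l,j))"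
    using ij by (simp add: mult_entry[OF msum_carrier A] msum_index sum_distrib_right)
  also have "\<dots> = (\<Sum>g\<in>S. \<Sum>l<m. F g $$ (i,l) * A $$ (l,j))" by (rule sum.swap)
  also have "\<dots> = msum S n p (\<lambda>g. F g * A) $$ (i,j)"
    using ij by (simp add: msum_index mult_entry[OF F A] cong: sum.cong)
  finally show "(msum S n m F * A) $$ (i,j) = msum S n p (\<lambda>g. F g * A) $$ (i,j)" .
qed (use A in \<open>auto simp: msum_def\<close>)

text \<open>Rectangular factors are allowed on purpose: from \<open>A * B = 1\<close> and
  \<open>B * A = 1\<close> it yields equality of the two sizes, both in
  \<open>square_if_bijective\<close> and for the number of irreducibles against the number of
  classes.\<close>

lemma mtr_comm:
  assumes "A \<in> carrier_mat n m" "B \<in> carrier_mat m n"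
  shows "mtr (A * B) = mtr (B * A)"
proof -
  have "mtr (A * B) = (\<Sum>i<n. \<Sum>l<m. A $$ (i,l) * B $$ (l,i))"
    using assms(1) unfolding mtr_def
    by (intro sum.cong) (auto simp: mult_entry[OF assms] simp del: index_mult_mat(1))
  also have "\<dots> = (\<Sum>l<m. \<Sum>i<n. B $$ (l,i) * A $$ (i,l))"
    by (subst sum.swap) (simp add: mult.commute)
  also have "\<dots> = mtr (B * A)"
    using assms(2) unfolding mtr_def
    by (intro sum.cong) (auto simp: mult_entry[OF assms(2,1)] simp del: index_mult_mat(1))
  finally show ?thesis .
qed

lemma mtr_one: "mtr (1\<^sub>m n) = of_nat n"
  by (simp add: mtr_def)

lemma mat_eq_0_iff_mult_vec:
  assumes A: "(A :: complex mat) \<in> carrier_mat m n" and "\<And>v. v \<in> carrier_vec n \<Longrightarrow> A *\<^sub>v v = 0\<^sub>v m"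
  shows "A = 0\<^sub>m m n"
proof (rule eq_matI)
  fix i j assume ij: "i < dim_row (0\<^sub>m m n :: complex mat)" "j < dim_col (0\<^sub>m m n :: complex mat)"
  then have "(A *\<^sub>v unit_vec n j) $ i = 0" using assms(2)[of "unit_vec n j"] by simp
  then show "A $$ (i,j) = 0\<^sub>m m n $$ (i,j)" using ij A by simp
qed (use A in auto)

text \<open>Preimages of the unit vectors form a right inverse \<open>W\<close>. Since
  \<open>A * (W * A - 1) = 0\<close>, injectivity makes it a left inverse too, and comparing the
  traces of \<open>A * W\<close> and \<open>W * A\<close> gives \<open>m = n\<close>.\<close>

lemma square_if_bijective:
  assumes A: "(A :: complex mat) \<in> carrier_mat m n"
    and inj: "\<And>v. v \<in> carrier_vec n \<Longrightarrow> A *\<^sub>v v = 0\<^sub>v m \<Longrightarrow> v = 0\<^sub>v n"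
    and surj: "\<And>w. w \<in> carrier_vec m \<Longrightarrow> \<exists>v\<in>carrier_vec n. A *\<^sub>v v = w"
  shows "m = n \<and> invertible_mat A"
proof -
  obtain w where w: "\<And>j. j < m \<Longrightarrow> w j \<in> carrier_vec n \<and> A *\<^sub>v w j = unit_vec m j"
    using surj[OF unit_vec_carrier] by metis
  define W where "W = mat n m (\<lambda>(i,j). w j $ i)"
  have W: "W \<in> carrier_mat n m" by (simp add: W_def)
  have AW: "A * W = 1\<^sub>m m"
  proof (rule eq_matI)
    fix i j assume "i < dim_row (1\<^sub>m m :: complex mat)" "j < dim_col (1\<^sub>m m :: complex mat)"
    then have ij: "i < m" "j < m" by auto
    have "(A * W) $$ (i,j) = (\<Sum>l<n. A $$ (i,l) * w j $ l)"
      using ij by (simp add: mult_entry[OF A W ij] W_def[symmetric] del: index_mult_mat(1)) (simp add: W_def)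
    also have "\<dots> = (A *\<^sub>v w j) $ i" using w[OF ij(2)] mult_vec_entry[OF A _ ij(1), of "w j"] by simp
    also have "\<dots> = 1\<^sub>m m $$ (i,j)" using w[OF ij(2)] ij by simp
    finally show "(A * W) $$ (i,j) = 1\<^sub>m m $$ (i,j)" .
  qed (use A W in auto)
  have "W * A - 1\<^sub>m n = 0\<^sub>m n n"
  proof (rule mat_eq_0_iff_mult_vec)
    fix v :: "complex vec" assume v: "v \<in> carrier_vec n"
    have "A *\<^sub>v ((W * A - 1\<^sub>m n) *\<^sub>v v) = (A * (W * A - 1\<^sub>m n)) *\<^sub>v v"
      by (rule assoc_mult_mat_vec[symmetric, OF A _ v]) (use W A in auto)
    also have "A * (W * A - 1\<^sub>m n) = A * (W * A) - A"
      using A W by (subst mult_minus_distrib_mat[OF A]) auto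
    also have "A * (W * A) = A" using AW A W by (subst assoc_mult_mat[symmetric, OF A W A]) auto
    also have "(A - A) *\<^sub>v v = 0\<^sub>v m" using A v by (auto simp: minus_r_inv_mat)
    finally show "(W * A - 1\<^sub>m n) *\<^sub>v v = 0\<^sub>v n"
      using inj[of "(W * A - 1\<^sub>m n) *\<^sub>v v"] W A v by (metis minus_carrier_mat mult_mat_vec_carrier one_carrier_mat)
  qed (use W A in auto)
  then have WA0: "(W * A - 1\<^sub>m n) $$ (i,j) = 0" if "i < n" "j < n" for i j using that by simp
  have WA: "W * A = 1\<^sub>m n"
  proof (rule eq_matI)
    fix i j assume "i < dim_row (1\<^sub>m n :: complex mat)" "j < dim_col (1\<^sub>m n :: complex mat)"
    then show "(W * A) $$ (i,j) = 1\<^sub>m n $$ (i,j)" using WA0[of i j] W A by simp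
  qed (use W A in auto)
  have "complex_of_nat m = of_nat n"
    using mtr_comm[OF A W] unfolding AW WA mtr_one .
  then have "m = n" by simp
  then show ?thesis
    using AW WA A W unfolding invertible_mat_def inverts_mat_def by auto
qed

lemma invertible_mat_obtain_inverse:
  assumes "A \<in> carrier_mat n n" "invertible_mat A"
  obtains B where "B \<in> carrier_mat n n" "A * B = 1\<^sub>m n" "B * A = 1\<^sub>m n"
proof -
  obtain B where B: "A * B = 1\<^sub>m n" "B * A = 1\<^sub>m (dim_row B)"
    using assms unfolding invertible_mat_def inverts_mat_def by auto
  have "dim_col B = n" using arg_cong[OF B(1), of dim_col] by simp
  moreover have "dim_row B = n" using arg_cong[OF B(2), of dim_col] assms(1) by simp
  ultimately show ?thesis using that[of B] B by auto
qed

section \<open>Spaces of intertwiners and their dimension\<close>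

lemma hom_space_iff:
  assumes "\<And>g. g \<in> G \<Longrightarrow> \<rho> g \<in> carrier_mat n n" "\<And>g. g \<in> G \<Longrightarrow> \<sigma> g \<in> carrier_mat m m"
    and A: "A \<in> carrier_mat m n"
  shows "A \<in> hom_space G n \<rho> m \<sigma> \<longleftrightarrow> (\<forall>g\<in>G. \<forall>i<m. \<forall>j<n.
    (\<Sum>l<n. A $$ (i,l) * \<rho> g $$ (l,j)) = (\<Sum>l<m. \<sigma> g $$ (i,l) * A $$ (l,j)))"
proof -
  have "A * \<rho> g = \<sigma> g * A \<longleftrightarrow> (\<forall>i<m. \<forall>j<n.
    (\<Sum>l<n. A $$ (i,l) * \<rho> g $$ (l,j)) = (\<Sum>l<m. \<sigma> g $$ (i,l) * A $$ (l,j)))" if g: "g \<in> G" for g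
  proof -
    note r = assms(1)[OF g] and s = assms(2)[OF g]
    have "A * \<rho> g = \<sigma> g * A \<longleftrightarrow> (\<forall>i<m. \<forall>j<n. (A * \<rho> g) $$ (i,j) = (\<sigma> g * A) $$ (i,j))"
    proof
      assume *: "\<forall>i<m. \<forall>j<n. (A * \<rho> g) $$ (i,j) = (\<sigma> g * A) $$ (i,j)"
      show "A * \<rho> g = \<sigma> g * A"
        by (rule eq_matI) (use A r s * in \<open>auto simp del: index_mult_mat(1)\<close>)
    qed simp
    then show ?thesis by (simp add: mult_entry[OF A r] mult_entry[OF s A] del: index_mult_mat(1))
  qed
  then show ?thesis using A unfolding hom_space_def by blast
qed

text \<open>Bridge from the \<open>GREATEST\<close> in \<open>hom_dim\<close> to biorthogonal
  systems: the functions \<open>b l\<close>, read as matrices, form an independent list, while any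
  longer list has a linear relation among its coordinate vectors.\<close>

lemma hom_dim_eq_card_basis:
  fixes b c :: "nat \<Rightarrow> nat \<times> nat \<Rightarrow> complex" and m n :: nat
  defines "I \<equiv> {..<m} \<times> {..<n}"
  assumes b: "\<And>l. l < k \<Longrightarrow> mat m n (b l) \<in> hom_space G n \<rho> m \<sigma>"
    and c: "\<And>l q. l < k \<Longrightarrow> q < k \<Longrightarrow> (\<Sum>x\<in>I. c l x * b q x) = (if l = q then 1 else 0)"
    and span: "\<And>A x. A \<in> hom_space G n \<rho> m \<sigma> \<Longrightarrow> x \<in> I \<Longrightarrow>
      A $$ x = (\<Sum>l<k. b l x * (\<Sum>y\<in>I. c l y * A $$ y))"
  shows "hom_dim G n \<rho> m \<sigma> = k"
  unfolding hom_dim_def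
proof (rule Greatest_equality)
  define As where "As = map (\<lambda>l. mat m n (b l)) [0..<k]"
  have "mats_lin_indep m n As" unfolding mats_lin_indep_def
  proof (intro allI impI)
    fix d l assume z: "\<forall>i<m. \<forall>j<n. (\<Sum>q<length As. d q * As ! q $$ (i,j)) = 0" and l: "l < length As"
    have z': "(\<Sum>q<k. d q * b q x) = 0" if "x \<in> I" for x
      using z that by (auto simp: As_def I_def)
    have "d l = (\<Sum>q<k. d q * (if l = q then 1 else 0))"
      using l by (simp add: As_def if_distrib[of "\<lambda>z. _ * z"] cong: if_cong)
    also have "\<dots> = (\<Sum>q<k. d q * (\<Sum>x\<in>I. c l x * b q x))"
      using l by (intro sum.cong) (auto simp: c As_def)
    also have "\<dots> = (\<Sum>x\<in>I. c l x * (\<Sum>q<k. d q * b q x))"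
      unfolding sum_distrib_left by (subst sum.swap) (simp only: mult.left_commute)
    also have "\<dots> = 0" using z' by simp
    finally show "d l = 0" .
  qed
  moreover have "set As \<subseteq> hom_space G n \<rho> m \<sigma>" using b by (auto simp: As_def)
  moreover have "length As = k" by (simp add: As_def)
  ultimately show "\<exists>As. length As = k \<and> set As \<subseteq> hom_space G n \<rho> m \<sigma> \<and> mats_lin_indep m n As" by blast
next
  fix k' assume "\<exists>As. length As = k' \<and> set As \<subseteq> hom_space G n \<rho> m \<sigma> \<and> mats_lin_indep m n As"
  then obtain As where As: "length As = k'" "set As \<subseteq> hom_space G n \<rho> m \<sigma>" "mats_lin_indep m n As" by blast
  show "k' \<le> k"
  proof (rule ccontr)
    assume "\<not> k' \<le> k"
    then have lt: "k < k'" by simp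
    \<comment> \<open>Coordinates of the \<open>q\<close>-th matrix: \<open>k\<close> rows and
      \<open>k' > k\<close> columns, hence a nontrivial kernel.\<close>
    define a where "a l q = (\<Sum>y\<in>I. c l y * As ! q $$ y)" for l q
    obtain d where d: "\<exists>q<k'. d q \<noteq> 0" "\<forall>l<k. (\<Sum>q<k'. a l q * d q) = 0"
      using underdetermined_system[OF lt, of a] by auto
    have "(\<Sum>q<k'. d q * As ! q $$ x) = 0" if x: "x \<in> I" for x
    proof -
      have "As ! q $$ x = (\<Sum>l<k. b l x * a l q)" if "q < k'" for q
        unfolding a_def by (rule span) (use that As x in auto)
      then have "(\<Sum>q<k'. d q * As ! q $$ x) = (\<Sum>q<k'. d q * (\<Sum>l<k. b l x * a l q))"
        by (intro sum.cong) auto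
      also have "\<dots> = (\<Sum>l<k. \<Sum>q<k'. d q * (b l x * a l q))"
        unfolding sum_distrib_left by (rule sum.swap)
      also have "\<dots> = (\<Sum>l<k. b l x * (\<Sum>q<k'. a l q * d q))"
        by (simp add: sum_distrib_left mult_ac)
      also have "\<dots> = 0" using d(2) by simp
      finally show ?thesis .
    qed
    then have "\<forall>i<m. \<forall>j<n. (\<Sum>q<length As. d q * As ! q $$ (i,j)) = 0"
      using As(1) by (simp add: I_def)
    then have "\<forall>q<length As. d q = 0" using As(3) unfolding mats_lin_indep_def by blast
    then show False using d(1) As(1) by auto
  qed
qed

section \<open>Subspaces and their splittings\<close>

lemma mat_assoc_dim:
  "dim_col A = dim_row B \<Longrightarrow> dim_col B = dim_row C \<Longrightarrow> (A * B) * C = A * (B * (C :: complex mat))"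
  by (rule assoc_mult_mat) auto

lemma mat_vec_assoc_dim:
  "dim_col A = dim_row B \<Longrightarrow> dim_col B = dim_vec v \<Longrightarrow> (A * B) *\<^sub>v v = A *\<^sub>v (B *\<^sub>v (v :: complex vec))"
  by (rule assoc_mult_mat_vec) auto

lemma mat_eqI_vec:
  assumes A: "(A :: complex mat) \<in> carrier_mat m n" and B: "B \<in> carrier_mat m n"
    and "\<And>v. v \<in> carrier_vec n \<Longrightarrow> A *\<^sub>v v = B *\<^sub>v v"
  shows "A = B"
proof (rule eq_matI)
  fix i j assume "i < dim_row B" "j < dim_col B"
  then have ij: "i < m" "j < n" using B by auto
  then have "(A *\<^sub>v unit_vec n j) $ i = (B *\<^sub>v unit_vec n j) $ i" using assms(3)[of "unit_vec n j"] by simp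
  then show "A $$ (i,j) = B $$ (i,j)" using ij A B by simp
qed (use A B in auto)

lemma kernel_subspace:
  assumes A: "(A :: complex mat) \<in> carrier_mat m n"
  shows "is_subspace n {v \<in> carrier_vec n. A *\<^sub>v v = 0\<^sub>v m}"
  unfolding is_subspace_def using A
  by (auto simp: mult_add_distrib_mat_vec[OF A] mult_mat_vec[OF A])

lemma range_subspace:
  assumes A: "(A :: complex mat) \<in> carrier_mat m n"
  shows "is_subspace m ((*\<^sub>v) A ` carrier_vec n)"
  unfolding is_subspace_def
proof (intro conjI ballI allI)
  show "(*\<^sub>v) A ` carrier_vec n \<subseteq> carrier_vec m"
    by (intro image_subsetI mult_mat_vec_carrier[OF A])
  have "A *\<^sub>v 0\<^sub>v n = 0\<^sub>v m" using A by (intro eq_vecI) simp_all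
  then show "0\<^sub>v m \<in> (*\<^sub>v) A ` carrier_vec n" by (intro image_eqI[of _ _ "0\<^sub>v n"]) simp_all
next
  fix v w assume "v \<in> (*\<^sub>v) A ` carrier_vec n" "w \<in> (*\<^sub>v) A ` carrier_vec n"
  then obtain x y where xy: "v = A *\<^sub>v x" "w = A *\<^sub>v y" "x \<in> carrier_vec n" "y \<in> carrier_vec n" by auto
  then have "v + w = A *\<^sub>v (x + y)" by (simp add: mult_add_distrib_mat_vec[OF A])
  then show "v + w \<in> (*\<^sub>v) A ` carrier_vec n"
    by (rule image_eqI) (rule add_carrier_vec[OF xy(3,4)])
next
  fix c v assume "v \<in> (*\<^sub>v) A ` carrier_vec n"
  then obtain x where x: "v = A *\<^sub>v x" "x \<in> carrier_vec n" by auto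
  then have "c \<cdot>\<^sub>v v = A *\<^sub>v (c \<cdot>\<^sub>v x)" by (simp add: mult_mat_vec[OF A])
  then show "c \<cdot>\<^sub>v v \<in> (*\<^sub>v) A ` carrier_vec n"
    by (rule image_eqI) (rule smult_carrier_vec[THEN iffD2, OF x(2)])
qed

text \<open>Matrix form of \<open>dual_basis\<close>: \<open>B\<close> parametrizes
  \<open>W\<close>, \<open>C\<close> is a retraction onto the coordinates, and \<open>B * C\<close>
  acts as the identity on \<open>W\<close>.\<close>

lemma subspace_dual_basis:
  assumes W: "is_subspace n W"
  shows "\<exists>k B C. k \<le> n \<and> B \<in> carrier_mat n k \<and> C \<in> carrier_mat k n \<and> C * B = 1\<^sub>m k \<and>
    (\<forall>v\<in>carrier_vec k. B *\<^sub>v v \<in> W) \<and> (\<forall>w\<in>W. B *\<^sub>v (C *\<^sub>v w) = w)"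
proof -
  \<comment> \<open>\<open>dual_basis\<close> speaks of functions; values at arguments
    \<open>n\<close> and above are irrelevant.\<close>
  define W' where "W' = {f. vec n f \<in> W}"
  have sub: "W \<subseteq> carrier_vec n" "0\<^sub>v n \<in> W" "\<And>v w. v \<in> W \<Longrightarrow> w \<in> W \<Longrightarrow> v + w \<in> W"
    "\<And>c v. v \<in> W \<Longrightarrow> c \<cdot>\<^sub>v v \<in> W" using W by (auto simp: is_subspace_def)
  have "vec n (\<lambda>_. 0) = (0\<^sub>v n :: complex vec)" by auto
  then have "(\<lambda>_. 0) \<in> W'" using sub(2) by (simp add: W'_def)
  then have ne: "W' \<noteq> {}" by blast
  have cl: "(\<lambda>x. u x + a * v x) \<in> W'" if "u \<in> W'" "v \<in> W'" for u v a
  proof -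
    have "vec n (\<lambda>x. u x + a * v x) = vec n u + a \<cdot>\<^sub>v vec n v" by auto
    then show ?thesis using that sub(3,4) by (simp add: W'_def)
  qed
  have fin: "finite {..<n}" by simp
  obtain k b c where k: "k \<le> card {..<n}" and b: "\<forall>l<k. b l \<in> W'"
    and c: "\<forall>l<k. \<forall>m<k. (\<Sum>x<n. c l x * b m x) = (if l = m then 1 else 0)"
    and span: "\<forall>w\<in>W'. \<forall>x\<in>{..<n}. w x = (\<Sum>l<k. b l x * (\<Sum>y<n. c l y * w y))"
    using dual_basis[OF fin ne cl] by blast
  define B where "B = mat n k (\<lambda>(x,l). b l x)"
  define C where "C = mat k n (\<lambda>(l,x). c l x)"
  have B: "B \<in> carrier_mat n k" and C: "C \<in> carrier_mat k n" by (simp_all add: B_def C_def)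
  have "C * B = 1\<^sub>m k"
  proof (rule eq_matI)
    fix l m assume "l < dim_row (1\<^sub>m k :: complex mat)" "m < dim_col (1\<^sub>m k :: complex mat)"
    then have lm: "l < k" "m < k" by auto
    have "(C * B) $$ (l,m) = (\<Sum>x<n. c l x * b m x)"
      unfolding mult_entry[OF C B lm] using lm by (intro sum.cong) (auto simp: B_def C_def)
    then show "(C * B) $$ (l,m) = 1\<^sub>m k $$ (l,m)" using c lm by simp
  qed (use B C in auto)
  moreover have "B *\<^sub>v v \<in> W" if v: "v \<in> carrier_vec k" for v
  proof -
    have "(\<lambda>x. \<Sum>l<k. v $ l * b l x) \<in> W'"
      by (rule subspace_sum_mem[OF ne]) (use cl b in auto)
    moreover have "vec n (\<lambda>x. \<Sum>l<k. v $ l * b l x) = B *\<^sub>v v"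
    proof (rule eq_vecI)
      fix x assume "x < dim_vec (B *\<^sub>v v)"
      then have x: "x < n" using B by simp
      show "vec n (\<lambda>x. \<Sum>l<k. v $ l * b l x) $ x = (B *\<^sub>v v) $ x"
        unfolding mult_vec_entry[OF B v x] using x by (simp add: B_def mult.commute)
    qed (use B in simp)
    ultimately show ?thesis by (simp add: W'_def)
  qed
  moreover have "B *\<^sub>v (C *\<^sub>v w) = w" if w: "w \<in> W" for w
  proof -
    have wc: "w \<in> carrier_vec n" using w sub(1) by blast
    then have "vec n (\<lambda>x. w $ x) = w" by auto
    then have "(\<lambda>x. w $ x) \<in> W'" using w by (simp add: W'_def)
    then have s: "w $ x = (\<Sum>l<k. b l x * (\<Sum>y<n. c l y * w $ y))" if "x < n" for x
      using bspec[OF bspec[OF span], of "\<lambda>x. w $ x" x] that by simp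
    have Cw: "C *\<^sub>v w \<in> carrier_vec k" using C wc by simp
    show ?thesis
    proof (rule eq_vecI)
      fix x assume "x < dim_vec w"
      then have x: "x < n" using wc by simp
      have "(B *\<^sub>v (C *\<^sub>v w)) $ x = (\<Sum>l<k. b l x * (\<Sum>y<n. c l y * w $ y))"
        unfolding mult_vec_entry[OF B Cw x]
      proof (intro sum.cong refl)
        fix l assume "l \<in> {..<k}"
        then have l: "l < k" by simp
        show "B $$ (x,l) * (C *\<^sub>v w) $ l = b l x * (\<Sum>y<n. c l y * w $ y)"
          unfolding mult_vec_entry[OF C wc l] using x l by (simp add: B_def C_def)
      qed
      then show "(B *\<^sub>v (C *\<^sub>v w)) $ x = w $ x" using s[OF x] by simp
    qed (use B wc in simp)
  qed
  ultimately show ?thesis using k B C by (intro exI[of _ k] exI[of _ B] exI[of _ C]) auto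
qed

section \<open>Kronecker products\<close>

lemma sum_div_mod:
  fixes F :: "nat \<Rightarrow> nat \<Rightarrow> complex"
  shows "(\<Sum>k<n * m. F (k div m) (k mod m)) = (\<Sum>i<n. \<Sum>j<m. F i j)"
proof (cases "m = 0")
  case False
  have lt: "i * m + j < n * m" if "i < n" "j < m" for i j
  proof -
    have "i * m + j < i * m + m" using that by simp
    also have "\<dots> = Suc i * m" by simp
    also have "\<dots> \<le> n * m" using that by (intro mult_le_mono1) simp
    finally show ?thesis .
  qed
  have "(\<Sum>k<n * m. F (k div m) (k mod m)) = (\<Sum>p\<in>{..<n} \<times> {..<m}. F (fst p) (snd p))"
    using False
    by (intro sum.reindex_bij_witness[where i = "\<lambda>p. fst p * m + snd p" and j = "\<lambda>k. (k div m, k mod m)"])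
      (auto simp: less_mult_imp_div_less lt)
  then show ?thesis by (simp add: sum.cartesian_product case_prod_unfold)
qed simp

lemma kron_carrier: "A \<in> carrier_mat n n \<Longrightarrow> B \<in> carrier_mat m m \<Longrightarrow> kron A B \<in> carrier_mat (n * m) (n * m)"
  by (simp add: kron_def)

lemma kron_index:
  assumes "A \<in> carrier_mat n n" "B \<in> carrier_mat m m" "i < n * m" "j < n * m"
  shows "kron A B $$ (i,j) = A $$ (i div m, j div m) * B $$ (i mod m, j mod m)"
  using assms by (simp add: kron_def)

lemma kron_mult:
  assumes A: "A \<in> carrier_mat n n" "A' \<in> carrier_mat n n" and B: "B \<in> carrier_mat m m" "B' \<in> carrier_mat m m"
  shows "kron (A * A') (B * B') = kron A B * kron A' B'"
proof (rule eq_matI)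
  fix i j assume "i < dim_row (kron A B * kron A' B')" "j < dim_col (kron A B * kron A' B')"
  then have ij: "i < n * m" "j < n * m" using A B by (auto simp: kron_def)
  then have m: "m > 0" by (cases m) auto
  have d: "i div m < n" "j div m < n" "i mod m < m" "j mod m < m"
    using ij m by (auto simp: less_mult_imp_div_less)
  have "(kron A B * kron A' B') $$ (i,j) = (\<Sum>k<n * m. kron A B $$ (i,k) * kron A' B' $$ (k,j))"
    by (rule mult_entry[OF kron_carrier[OF A(1) B(1)] kron_carrier[OF A(2) B(2)] ij])
  also have "\<dots> = (\<Sum>k<n * m. (A $$ (i div m, k div m) * B $$ (i mod m, k mod m)) *
      (A' $$ (k div m, j div m) * B' $$ (k mod m, j mod m)))"
    using ij by (intro sum.cong) (auto simp: kron_index[OF A(1) B(1)] kron_index[OF A(2) B(2)])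
  also have "\<dots> = (\<Sum>k<n. \<Sum>l<m. (A $$ (i div m, k) * B $$ (i mod m, l)) * (A' $$ (k, j div m) * B' $$ (l, j mod m)))"
    by (rule sum_div_mod)
  also have "\<dots> = (A * A') $$ (i div m, j div m) * (B * B') $$ (i mod m, j mod m)"
    unfolding mult_entry[OF A d(1,2)] mult_entry[OF B d(3,4)] sum_product by (simp only: mult_ac)
  also have "\<dots> = kron (A * A') (B * B') $$ (i,j)"
    by (rule kron_index[symmetric, OF mult_carrier_mat[OF A] mult_carrier_mat[OF B] ij])
  finally show "kron (A * A') (B * B') $$ (i,j) = (kron A B * kron A' B') $$ (i,j)" by simp
qed (use A B in \<open>auto simp: kron_def\<close>)

lemma mtr_kron:
  assumes A: "A \<in> carrier_mat n n" and B: "B \<in> carrier_mat m m"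
  shows "mtr (kron A B) = mtr A * mtr B"
proof -
  have "mtr (kron A B) = (\<Sum>k<n * m. A $$ (k div m, k div m) * B $$ (k mod m, k mod m))"
    unfolding mtr_def using kron_carrier[OF A B] by (intro sum.cong) (auto simp: kron_index[OF A B])
  also have "\<dots> = (\<Sum>i<n. \<Sum>j<m. A $$ (i,i) * B $$ (j,j))" by (rule sum_div_mod)
  finally show ?thesis using A B by (simp add: mtr_def sum_product)
qed

lemma kron_one: "kron (1\<^sub>m n) (1\<^sub>m m) = 1\<^sub>m (n * m)"
proof (rule eq_matI)
  fix i j assume "i < dim_row (1\<^sub>m (n * m) :: complex mat)" "j < dim_col (1\<^sub>m (n * m) :: complex mat)"
  then have ij: "i < n * m" "j < n * m" by auto
  then have m: "m > 0" by (cases m) auto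
  have d: "i div m < n" "j div m < n" "i mod m < m" "j mod m < m"
    using ij m by (auto simp: less_mult_imp_div_less)
  have "i = j \<longleftrightarrow> i div m = j div m \<and> i mod m = j mod m" by (metis div_mult_mod_eq)
  then show "kron (1\<^sub>m n) (1\<^sub>m m) $$ (i,j) = 1\<^sub>m (n * m) $$ (i,j)"
    using ij d by (auto simp: kron_index[of _ n _ m])
qed (auto simp: kron_def)

section \<open>Characters of finite orthogonal matrix groups\<close>

text \<open>Transposition plays the part of the inverse, so all averaging and conjugation can be
  written with \<open>g\<^sup>T\<close>, and closure under inverses is closure under
  transposition.\<close>

locale finite_orthogonal_group =
  fixes G :: "complex mat set"
  assumes finite_G: "finite G"
    and G_carrier: "g \<in> G \<Longrightarrow> g \<in> carrier_mat 3 3"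
    and one_G: "1\<^sub>m 3 \<in> G"
    and mult_G: "g \<in> G \<Longrightarrow> h \<in> G \<Longrightarrow> g * h \<in> G"
    and transpose_G: "g \<in> G \<Longrightarrow> g\<^sup>T \<in> G"
    and orth: "g \<in> G \<Longrightarrow> g * g\<^sup>T = 1\<^sub>m 3"
begin

lemma orth': "g \<in> G \<Longrightarrow> g\<^sup>T * g = 1\<^sub>m 3"
  using orth[OF transpose_G] by simp

lemma one_mult_G: "g \<in> G \<Longrightarrow> 1\<^sub>m 3 * g = g"
  by (rule left_mult_one_mat[OF G_carrier])

lemma mult_one_G: "g \<in> G \<Longrightarrow> g * 1\<^sub>m 3 = g"
  by (rule right_mult_one_mat[OF G_carrier])

lemma assoc_G: "g \<in> G \<Longrightarrow> h \<in> G \<Longrightarrow> k \<in> G \<Longrightarrow> g * h * k = g * (h * k)"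
  using G_carrier by (meson assoc_mult_mat)

lemma cancel_G: "g \<in> G \<Longrightarrow> h \<in> G \<Longrightarrow> g\<^sup>T * (g * h) = h" "g \<in> G \<Longrightarrow> h \<in> G \<Longrightarrow> g * (g\<^sup>T * h) = h"
  by (simp_all add: assoc_G[symmetric] transpose_G orth orth' one_mult_G)

lemma transpose_mult_G: "g \<in> G \<Longrightarrow> h \<in> G \<Longrightarrow> (g * h)\<^sup>T = h\<^sup>T * g\<^sup>T"
  using transpose_mult G_carrier by blast

lemma card_G_pos: "card G > 0"
  using finite_G one_G by (auto simp: card_gt_0_iff)

lemma sum_G_left: "h \<in> G \<Longrightarrow> (\<Sum>g\<in>G. F (h * g)) = (\<Sum>g\<in>G. F g)"
  by (rule sum.reindex_bij_witness[where i = "\<lambda>g. h\<^sup>T * g" and j = "\<lambda>g. h * g"])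
    (simp_all add: cancel_G mult_G transpose_G)

lemma sum_G_conj: "h \<in> G \<Longrightarrow> (\<Sum>g\<in>G. F (h * g * h\<^sup>T)) = (\<Sum>g\<in>G. F g)"
  by (rule sum.reindex_bij_witness[where i = "\<lambda>g. h\<^sup>T * g * h" and j = "\<lambda>g. h * g * h\<^sup>T"])
    (simp_all add: assoc_G cancel_G mult_G transpose_G orth orth' mult_one_G)

lemma sum_G_transpose: "(\<Sum>g\<in>G. F (g\<^sup>T)) = (\<Sum>g\<in>G. F g)"
  by (rule sum.reindex_bij_witness[where i = transpose_mat and j = transpose_mat])
    (simp_all add: transpose_G)

lemma is_repD:
  assumes "is_rep G n \<rho>"
  shows "g \<in> G \<Longrightarrow> \<rho> g \<in> carrier_mat n n" "\<rho> (1\<^sub>m 3) = 1\<^sub>m n"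
    "g \<in> G \<Longrightarrow> h \<in> G \<Longrightarrow> \<rho> (g * h) = \<rho> g * \<rho> h"
    "g \<in> G \<Longrightarrow> \<rho> g * \<rho> (g\<^sup>T) = 1\<^sub>m n" "g \<in> G \<Longrightarrow> \<rho> (g\<^sup>T) * \<rho> g = 1\<^sub>m n"
proof -
  show r: "g \<in> G \<Longrightarrow> \<rho> g \<in> carrier_mat n n" "\<rho> (1\<^sub>m 3) = 1\<^sub>m n"
    "g \<in> G \<Longrightarrow> h \<in> G \<Longrightarrow> \<rho> (g * h) = \<rho> g * \<rho> h" for g h
    using assms by (auto simp: is_rep_def)
  show "g \<in> G \<Longrightarrow> \<rho> g * \<rho> (g\<^sup>T) = 1\<^sub>m n" "g \<in> G \<Longrightarrow> \<rho> (g\<^sup>T) * \<rho> g = 1\<^sub>m n"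
    by (metis r(2,3) transpose_G orth, metis r(2,3) transpose_G orth')
qed

lemma hom_space_rep_iff:
  assumes r: "is_rep G n \<rho>" and s: "is_rep G m \<sigma>"
  shows "mat m n f \<in> hom_space G n \<rho> m \<sigma> \<longleftrightarrow> (\<forall>g\<in>G. \<forall>i<m. \<forall>j<n.
    (\<Sum>l<n. f (i,l) * \<rho> g $$ (l,j)) = (\<Sum>l<m. \<sigma> g $$ (i,l) * f (l,j)))"
  by (subst hom_space_iff) (auto simp: is_repD(1)[OF r] is_repD(1)[OF s])

lemma rep_entry:
  assumes "is_rep G n \<rho>" "g \<in> G" "h \<in> G" "i < n" "j < n"
  shows "(\<Sum>l<n. \<rho> g $$ (i,l) * \<rho> h $$ (l,j)) = \<rho> (g * h) $$ (i,j)"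
  using mult_entry[OF is_repD(1)[OF assms(1,2)] is_repD(1)[OF assms(1,3)] assms(4,5)]
    is_repD(3)[OF assms(1-3)] by simp

text \<open>Kernel of the averaging operator that sends \<open>A\<close> to the mean of
  \<open>\<sigma> g * A * \<rho> (g\<^sup>T)\<close> over \<open>G\<close>: \<open>y\<close> is the
  input entry and \<open>x\<close> the output entry.\<close>

definition avg_entry :: "(complex mat \<Rightarrow> complex mat) \<Rightarrow> (complex mat \<Rightarrow> complex mat) \<Rightarrow>
    nat \<times> nat \<Rightarrow> nat \<times> nat \<Rightarrow> complex" where
  "avg_entry \<rho> \<sigma> x y = (\<Sum>g\<in>G. \<sigma> g $$ (fst x, fst y) * \<rho> (g\<^sup>T) $$ (snd y, snd x)) / of_nat (card G)"

lemma avg_entry_hom: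
  assumes r: "is_rep G n \<rho>" and s: "is_rep G m \<sigma>" and y: "y \<in> {..<m} \<times> {..<n}"
  shows "mat m n (\<lambda>x. avg_entry \<rho> \<sigma> x y) \<in> hom_space G n \<rho> m \<sigma>"
  unfolding hom_space_rep_iff[OF r s]
proof (intro ballI allI impI)
  fix h i j assume h: "h \<in> G" and i: "i < m" and j: "j < n"
  obtain p q where pq: "y = (p,q)" "p < m" "q < n" using y by auto
  let ?N = "complex_of_nat (card G)"
  have "(\<Sum>l<n. avg_entry \<rho> \<sigma> (i,l) y * \<rho> h $$ (l,j))
      = (\<Sum>g\<in>G. \<sigma> g $$ (i,p) * (\<Sum>l<n. \<rho> (g\<^sup>T) $$ (q,l) * \<rho> h $$ (l,j))) / ?N"
    unfolding avg_entry_def sum_distrib_left sum_distrib_right sum_divide_distrib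
    by (subst sum.swap) (simp add: pq mult.assoc)
  also have "\<dots> = (\<Sum>g\<in>G. \<sigma> g $$ (i,p) * \<rho> (g\<^sup>T * h) $$ (q,j)) / ?N"
    by (simp add: rep_entry[OF r transpose_G h pq(3) j] cong: sum.cong)
  \<comment> \<open>Replacing \<open>g\<close> by \<open>h * g\<close> cancels \<open>h\<close> in
    the factor of \<open>\<rho>\<close> and lets it appear on the left of
    \<open>\<sigma>\<close>.\<close>
  also have "(\<Sum>g\<in>G. \<sigma> g $$ (i,p) * \<rho> (g\<^sup>T * h) $$ (q,j))
      = (\<Sum>g\<in>G. \<sigma> (h * g) $$ (i,p) * \<rho> ((h * g)\<^sup>T * h) $$ (q,j))"
    by (rule sum_G_left[OF h, symmetric])
  also have "\<dots> = (\<Sum>g\<in>G. \<sigma> (h * g) $$ (i,p) * \<rho> (g\<^sup>T) $$ (q,j))"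
    by (intro sum.cong refl)
      (simp add: transpose_mult_G h assoc_G transpose_G orth' mult_one_G)
  also have "\<dots> = (\<Sum>g\<in>G. (\<Sum>l<m. \<sigma> h $$ (i,l) * \<sigma> g $$ (l,p)) * \<rho> (g\<^sup>T) $$ (q,j))"
    by (simp add: rep_entry[OF s h _ i pq(2)] cong: sum.cong)
  also have "\<dots> / ?N = (\<Sum>l<m. \<sigma> h $$ (i,l) * avg_entry \<rho> \<sigma> (l,j) y)"
    unfolding avg_entry_def sum_distrib_left sum_distrib_right sum_divide_distrib
    by (subst sum.swap) (simp add: pq mult.assoc)
  finally show "(\<Sum>l<n. avg_entry \<rho> \<sigma> (i,l) y * \<rho> h $$ (l,j)) = (\<Sum>l<m. \<sigma> h $$ (i,l) * avg_entry \<rho> \<sigma> (l,j) y)" .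
qed

text \<open>For an intertwiner each single term \<open>\<sigma> g * A * \<rho> (g\<^sup>T)\<close>
  already equals \<open>A\<close>, hence so does the mean.\<close>

lemma avg_entry_fixes_hom:
  assumes r: "is_rep G n \<rho>" and s: "is_rep G m \<sigma>" and A: "A \<in> hom_space G n \<rho> m \<sigma>"
    and x: "x \<in> {..<m} \<times> {..<n}"
  shows "(\<Sum>y\<in>{..<m} \<times> {..<n}. avg_entry \<rho> \<sigma> x y * A $$ y) = A $$ x"
proof -
  let ?N = "complex_of_nat (card G)"
  obtain i j where ij: "x = (i,j)" "i < m" "j < n" using x by auto
  have Ac: "A \<in> carrier_mat m n" and Ah: "\<And>g. g \<in> G \<Longrightarrow> A * \<rho> g = \<sigma> g * A"
    using A by (auto simp: hom_space_def)
  have fx: "(\<Sum>p<m. \<Sum>q<n. \<sigma> g $$ (i,p) * \<rho> (g\<^sup>T) $$ (q,j) * A $$ (p,q)) = A $$ (i,j)"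
    if g: "g \<in> G" for g
  proof -
    note rg = is_repD(1)[OF r g] is_repD(1)[OF r transpose_G[OF g]] is_repD(1)[OF s g]
    have "A $$ (i,j) = (A * (\<rho> g * \<rho> (g\<^sup>T))) $$ (i,j)"
      using is_repD(4)[OF r g] Ac by simp
    also have "A * (\<rho> g * \<rho> (g\<^sup>T)) = \<sigma> g * A * \<rho> (g\<^sup>T)"
      using assoc_mult_mat[OF Ac rg(1,2)] Ah[OF g] by simp
    also have "\<dots> = \<sigma> g * (A * \<rho> (g\<^sup>T))" by (rule assoc_mult_mat[OF rg(3) Ac rg(2)])
    also have "\<dots> $$ (i,j) = (\<Sum>p<m. \<sigma> g $$ (i,p) * (A * \<rho> (g\<^sup>T)) $$ (p,j))"
      using Ac rg by (intro mult_entry[OF rg(3) _ ij(2,3)]) auto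
    also have "\<dots> = (\<Sum>p<m. \<sigma> g $$ (i,p) * (\<Sum>q<n. A $$ (p,q) * \<rho> (g\<^sup>T) $$ (q,j)))"
      by (intro sum.cong refl) (simp add: mult_entry[OF Ac rg(2) _ ij(3)] del: index_mult_mat(1))
    also have "\<dots> = (\<Sum>p<m. \<Sum>q<n. \<sigma> g $$ (i,p) * \<rho> (g\<^sup>T) $$ (q,j) * A $$ (p,q))"
      by (simp add: sum_distrib_left mult_ac)
    finally show ?thesis by simp
  qed
  have "(\<Sum>y\<in>{..<m} \<times> {..<n}. avg_entry \<rho> \<sigma> x y * A $$ y)
      = (\<Sum>y\<in>{..<m} \<times> {..<n}. \<Sum>g\<in>G. \<sigma> g $$ (i, fst y) * \<rho> (g\<^sup>T) $$ (snd y, j) * A $$ y) / ?N"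
    by (simp add: avg_entry_def ij(1) sum_distrib_right sum_divide_distrib)
  also have "(\<Sum>y\<in>{..<m} \<times> {..<n}. \<Sum>g\<in>G. \<sigma> g $$ (i, fst y) * \<rho> (g\<^sup>T) $$ (snd y, j) * A $$ y)
    = (\<Sum>g\<in>G. \<Sum>y\<in>{..<m} \<times> {..<n}. \<sigma> g $$ (i, fst y) * \<rho> (g\<^sup>T) $$ (snd y, j) * A $$ y)"
    by (rule sum.swap)
  also have "\<dots> = (\<Sum>g\<in>G. \<Sum>p<m. \<Sum>q<n. \<sigma> g $$ (i,p) * \<rho> (g\<^sup>T) $$ (q,j) * A $$ (p,q))"
    by (intro sum.cong refl) (simp add: sum.cartesian_product case_prod_unfold)
  also have "\<dots> = (\<Sum>g\<in>G. A $$ (i,j))" by (intro sum.cong refl fx)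
  finally show ?thesis using card_G_pos ij by simp
qed

text \<open>Averaging projects onto the intertwiners, so their dimension is the trace of
  \<open>avg_entry\<close>; the trace of
  \<open>A \<mapsto> \<sigma> g * A * \<rho> (g\<^sup>T)\<close> splits into a product of two
  characters. Irreducibility is not assumed, so the formula applies both to Schur's lemma and to the
  McKay numbers.\<close>

lemma hom_dim_characters:
  assumes r: "is_rep G n \<rho>" and s: "is_rep G m \<sigma>"
  shows "of_nat (card G) * of_nat (hom_dim G n \<rho> m \<sigma>) = (\<Sum>g\<in>G. mtr (\<sigma> g) * mtr (\<rho> (g\<^sup>T)))"
proof -
  let ?I = "{..<m} \<times> {..<n}" and ?N = "complex_of_nat (card G)"
  define W where "W = {f. mat m n f \<in> hom_space G n \<rho> m \<sigma>}"
  have W: "f \<in> W \<longleftrightarrow> (\<forall>g\<in>G. \<forall>i<m. \<forall>j<n.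
    (\<Sum>l<n. f (i,l) * \<rho> g $$ (l,j)) = (\<Sum>l<m. \<sigma> g $$ (i,l) * f (l,j)))" for f
    unfolding W_def mem_Collect_eq hom_space_rep_iff[OF r s] ..
  have "(\<lambda>x. 0) \<in> W" by (simp add: W)
  then have ne: "W \<noteq> {}" by blast
  have cl: "(\<lambda>x. u x + a * v x) \<in> W" if "u \<in> W" "v \<in> W" for u v a
  proof -
    have "(\<Sum>l<n. (u (i,l) + a * v (i,l)) * \<rho> g $$ (l,j)) =
        (\<Sum>l<m. \<sigma> g $$ (i,l) * (u (l,j) + a * v (l,j)))" if g: "g \<in> G" "i < m" "j < n" for g i j
    proof -
      have "(\<Sum>l<n. (u (i,l) + a * v (i,l)) * \<rho> g $$ (l,j)) =
        (\<Sum>l<n. u (i,l) * \<rho> g $$ (l,j)) + a * (\<Sum>l<n. v (i,l) * \<rho> g $$ (l,j))"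
        by (simp add: algebra_simps sum.distrib sum_distrib_left)
      also have "\<dots> = (\<Sum>l<m. \<sigma> g $$ (i,l) * u (l,j)) + a * (\<Sum>l<m. \<sigma> g $$ (i,l) * v (l,j))"
        using \<open>u \<in> W\<close> \<open>v \<in> W\<close> g unfolding W by simp
      also have "\<dots> = (\<Sum>l<m. \<sigma> g $$ (i,l) * (u (l,j) + a * v (l,j)))"
        by (simp add: algebra_simps sum.distrib sum_distrib_left)
      finally show ?thesis .
    qed
    then show ?thesis unfolding W by blast
  qed
  have fin: "finite ?I" by simp
  obtain k b c where b: "\<forall>l<(k::nat). b l \<in> W"
    and c: "\<forall>l<k. \<forall>q<k. (\<Sum>x\<in>?I. c l x * b q x) = (if l = q then 1 else 0)"
    and span: "\<forall>w\<in>W. \<forall>x\<in>?I. w x = (\<Sum>l<k. b l x * (\<Sum>y\<in>?I. c l y * w y))"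
    using dual_basis[OF fin ne cl] by blast
  note b = b[rule_format] and c = c[rule_format] and span = span[rule_format]
  have memW: "(\<lambda>x. A $$ x) \<in> W" if "A \<in> hom_space G n \<rho> m \<sigma>" for A
  proof -
    have "mat m n (\<lambda>x. A $$ x) = A" using that by (intro eq_matI) (auto simp: hom_space_def)
    then show ?thesis using that by (simp add: W_def)
  qed
  have "hom_dim G n \<rho> m \<sigma> = k"
  proof (rule hom_dim_eq_card_basis[of _ m n b])
    show "mat m n (b l) \<in> hom_space G n \<rho> m \<sigma>" if "l < k" for l using b[OF that] by (simp add: W_def)
    show "(\<Sum>x\<in>?I. c l x * b q x) = (if l = q then 1 else 0)" if "l < k" "q < k" for l q
      using that by (rule c)
    show "A $$ x = (\<Sum>l<k. b l x * (\<Sum>y\<in>?I. c l y * A $$ y))"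
      if "A \<in> hom_space G n \<rho> m \<sigma>" "x \<in> ?I" for A x
      by (rule span[OF memW[OF that(1)] that(2)])
  qed
  moreover have "(\<Sum>x\<in>?I. avg_entry \<rho> \<sigma> x x) = of_nat k"
  proof (rule trace_projection[OF fin b c span, where P = "avg_entry \<rho> \<sigma>"])
    show "(\<lambda>x. avg_entry \<rho> \<sigma> x y) \<in> W" if "y \<in> ?I" for y
      using avg_entry_hom[OF r s that] by (simp add: W_def)
    show "(\<Sum>y\<in>?I. avg_entry \<rho> \<sigma> x y * w y) = w x" if "w \<in> W" "x \<in> ?I" for w x
    proof -
      have "mat m n w \<in> hom_space G n \<rho> m \<sigma>" using that by (simp add: W_def)
      from avg_entry_fixes_hom[OF r s this that(2)] have
        "(\<Sum>y\<in>?I. avg_entry \<rho> \<sigma> x y * mat m n w $$ y) = mat m n w $$ x" .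
      moreover have "mat m n w $$ y = w y" if "y \<in> ?I" for y using that by auto
      ultimately show ?thesis using that(2) by (simp cong: sum.cong)
    qed
  qed
  moreover have "(\<Sum>x\<in>?I. avg_entry \<rho> \<sigma> x x) = (\<Sum>g\<in>G. mtr (\<sigma> g) * mtr (\<rho> (g\<^sup>T))) / ?N"
  proof -
    have "(\<Sum>x\<in>?I. avg_entry \<rho> \<sigma> x x)
      = (\<Sum>g\<in>G. \<Sum>x\<in>?I. \<sigma> g $$ (fst x, fst x) * \<rho> (g\<^sup>T) $$ (snd x, snd x)) / ?N"
      unfolding avg_entry_def by (subst sum.swap) (simp add: sum_divide_distrib)
    also have "(\<Sum>g\<in>G. \<Sum>x\<in>?I. \<sigma> g $$ (fst x, fst x) * \<rho> (g\<^sup>T) $$ (snd x, snd x))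
      = (\<Sum>g\<in>G. mtr (\<sigma> g) * mtr (\<rho> (g\<^sup>T)))"
    proof (intro sum.cong refl)
      fix g assume g: "g \<in> G"
      have "dim_row (\<sigma> g) = m" "dim_row (\<rho> (g\<^sup>T)) = n"
        using is_repD(1)[OF s g] is_repD(1)[OF r transpose_G[OF g]] by auto
      then show "(\<Sum>x\<in>?I. \<sigma> g $$ (fst x, fst x) * \<rho> (g\<^sup>T) $$ (snd x, snd x)) = mtr (\<sigma> g) * mtr (\<rho> (g\<^sup>T))"
        by (simp add: mtr_def sum_product sum.cartesian_product case_prod_unfold)
    qed
    finally show ?thesis .
  qed
  ultimately show ?thesis using card_G_pos by (simp add: field_simps)
qed

end

section \<open>Schur's lemma and its consequences for characters\<close>

context finite_orthogonal_group
begin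

lemma is_rep_irreducible: "irreducible_rep G n \<rho> \<Longrightarrow> is_rep G n \<rho>"
  by (simp add: irreducible_rep_def)

lemma irreducible_subspaceD:
  assumes "irreducible_rep G n \<rho>" "is_subspace n W" "\<And>g w. g \<in> G \<Longrightarrow> w \<in> W \<Longrightarrow> \<rho> g *\<^sub>v w \<in> W"
  shows "W = {0\<^sub>v n} \<or> W = carrier_vec n"
  using assms unfolding irreducible_rep_def by blast

lemma hom_spaceD:
  assumes "A \<in> hom_space G n \<rho> m \<sigma>"
  shows "A \<in> carrier_mat m n" "g \<in> G \<Longrightarrow> A * \<rho> g = \<sigma> g * A"
  using assms by (auto simp: hom_space_def)

lemma hom_space_apply:
  assumes r: "is_rep G n \<rho>" and s: "is_rep G m \<sigma>" and A: "A \<in> hom_space G n \<rho> m \<sigma>"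
    and g: "g \<in> G" and v: "v \<in> carrier_vec n"
  shows "A *\<^sub>v (\<rho> g *\<^sub>v v) = \<sigma> g *\<^sub>v (A *\<^sub>v v)"
  using assoc_mult_mat_vec[OF hom_spaceD(1)[OF A] is_repD(1)[OF r g] v]
    assoc_mult_mat_vec[OF is_repD(1)[OF s g] hom_spaceD(1)[OF A] v] hom_spaceD(2)[OF A g] by simp

lemma rep_apply_zero:
  assumes "is_rep G n \<rho>" "g \<in> G"
  shows "\<rho> g *\<^sub>v 0\<^sub>v n = 0\<^sub>v n"
  using is_repD(1)[OF assms] by (intro eq_vecI) simp_all

lemma hom_injective:
  assumes irr: "irreducible_rep G n \<rho>" and s: "is_rep G m \<sigma>" and A: "A \<in> hom_space G n \<rho> m \<sigma>"
    and A0: "A \<noteq> 0\<^sub>m m n" and v: "v \<in> carrier_vec n" "A *\<^sub>v v = 0\<^sub>v m"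
  shows "v = 0\<^sub>v n"
proof -
  note Ac = hom_spaceD(1)[OF A] and r = is_rep_irreducible[OF irr]
  let ?K = "{v \<in> carrier_vec n. A *\<^sub>v v = 0\<^sub>v m}"
  have "?K = {0\<^sub>v n} \<or> ?K = carrier_vec n"
  proof (rule irreducible_subspaceD[OF irr kernel_subspace[OF Ac]])
    fix g w assume g: "g \<in> G" and w: "w \<in> ?K"
    have "A *\<^sub>v (\<rho> g *\<^sub>v w) = 0\<^sub>v m"
      using hom_space_apply[OF r s A g, of w] w rep_apply_zero[OF s g] by simp
    then show "\<rho> g *\<^sub>v w \<in> ?K" using mult_mat_vec_carrier[OF is_repD(1)[OF r g], of w] w by simp
  qed
  moreover have "?K \<noteq> carrier_vec n"
  proof
    assume K: "?K = carrier_vec n"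
    have "A = 0\<^sub>m m n" by (rule mat_eq_0_iff_mult_vec[OF Ac]) (use K in blast)
    then show False using A0 by simp
  qed
  ultimately show ?thesis using v by blast
qed

text \<open>Kernel and range of an intertwiner are invariant, so a nonzero one between irreducibles
  is bijective; \<open>square_if_bijective\<close> supplies the equality of degrees that
  \<open>iso_rep\<close> demands.\<close>

lemma schur_iso:
  assumes irr: "irreducible_rep G n \<rho>" and irs: "irreducible_rep G m \<sigma>"
    and A: "A \<in> hom_space G n \<rho> m \<sigma>" and A0: "A \<noteq> 0\<^sub>m m n"
  shows "iso_rep G n \<rho> m \<sigma>"
proof -
  note Ac = hom_spaceD(1)[OF A] and r = is_rep_irreducible[OF irr] and s = is_rep_irreducible[OF irs]
  let ?R = "(*\<^sub>v) A ` carrier_vec n"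
  have "?R = {0\<^sub>v m} \<or> ?R = carrier_vec m"
  proof (rule irreducible_subspaceD[OF irs range_subspace[OF Ac]])
    fix g w assume g: "g \<in> G" and w: "w \<in> ?R"
    then obtain v where v: "v \<in> carrier_vec n" "w = A *\<^sub>v v" by blast
    have "\<sigma> g *\<^sub>v w = A *\<^sub>v (\<rho> g *\<^sub>v v)"
      unfolding v(2) by (rule hom_space_apply[OF r s A g v(1), symmetric])
    then show "\<sigma> g *\<^sub>v w \<in> ?R"
      by (rule image_eqI) (rule mult_mat_vec_carrier[OF is_repD(1)[OF r g] v(1)])
  qed
  moreover have "?R \<noteq> {0\<^sub>v m}"
  proof
    assume R: "?R = {0\<^sub>v m}"
    have "A = 0\<^sub>m m n" by (rule mat_eq_0_iff_mult_vec[OF Ac]) (use R in blast)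
    then show False using A0 by simp
  qed
  ultimately have R: "?R = carrier_vec m" by blast
  have "m = n \<and> invertible_mat A"
  proof (rule square_if_bijective[OF Ac])
    show "v = 0\<^sub>v n" if "v \<in> carrier_vec n" "A *\<^sub>v v = 0\<^sub>v m" for v
      by (rule hom_injective[OF irr s A A0 that])
    show "\<exists>v\<in>carrier_vec n. A *\<^sub>v v = w" if "w \<in> carrier_vec m" for w
    proof -
      have "w \<in> ?R" using that R by simp
      then show ?thesis by auto
    qed
  qed
  then show ?thesis using Ac hom_spaceD(2)[OF A] unfolding iso_rep_def by auto
qed

text \<open>A complex matrix has an eigenvalue \<open>c\<close>; the intertwiner
  \<open>A - c\<close> is then not injective, so \<open>hom_injective\<close> forces it to
  vanish.\<close>

lemma schur_scalar:
  assumes irr: "irreducible_rep G n \<rho>" and A: "A \<in> hom_space G n \<rho> n \<rho>"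
  shows "\<exists>c. A = c \<cdot>\<^sub>m 1\<^sub>m n"
proof -
  note Ac = hom_spaceD(1)[OF A] and r = is_rep_irreducible[OF irr]
  have n: "n > 0" using irr by (simp add: irreducible_rep_def)
  obtain c where "c \<in> spectrum A" using spectrum_non_empty[OF Ac n] by blast
  then obtain v where v: "v \<in> carrier_vec n" "v \<noteq> 0\<^sub>v n" "A *\<^sub>v v = c \<cdot>\<^sub>v v"
    unfolding spectrum_def eigenvalue_def eigenvector_def using Ac by auto
  define A' where "A' = A - c \<cdot>\<^sub>m 1\<^sub>m n"
  have A'c: "A' \<in> carrier_mat n n" unfolding A'_def by (rule minus_carrier_mat) simp
  have cI: "(c \<cdot>\<^sub>m 1\<^sub>m n) * B = c \<cdot>\<^sub>m B" "B * (c \<cdot>\<^sub>m 1\<^sub>m n) = c \<cdot>\<^sub>m B" if "B \<in> carrier_mat n n" for B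
    using that mult_smult_assoc_mat[OF one_carrier_mat that] mult_smult_distrib[OF that one_carrier_mat] by simp_all
  have "A' * \<rho> g = \<rho> g * A'" if g: "g \<in> G" for g
  proof -
    note rg = is_repD(1)[OF r g]
    have "A' * \<rho> g = A * \<rho> g - (c \<cdot>\<^sub>m 1\<^sub>m n) * \<rho> g"
      unfolding A'_def by (rule minus_mult_distrib_mat[OF Ac _ rg]) simp
    also have "\<dots> = \<rho> g * A - \<rho> g * (c \<cdot>\<^sub>m 1\<^sub>m n)" using cI[OF rg] hom_spaceD(2)[OF A g] by simp
    also have "\<dots> = \<rho> g * A'"
      unfolding A'_def by (rule mult_minus_distrib_mat[OF rg Ac, symmetric]) simp
    finally show ?thesis .
  qed
  then have A': "A' \<in> hom_space G n \<rho> n \<rho>" using A'c by (simp add: hom_space_def)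
  have "A' *\<^sub>v v = A *\<^sub>v v - (c \<cdot>\<^sub>m 1\<^sub>m n) *\<^sub>v v"
    unfolding A'_def by (rule minus_mult_distrib_mat_vec[OF Ac _ v(1)]) simp
  also have "(c \<cdot>\<^sub>m 1\<^sub>m n) *\<^sub>v v = c \<cdot>\<^sub>v v" using v(1) by (intro eq_vecI) simp_all
  also have "A *\<^sub>v v - c \<cdot>\<^sub>v v = 0\<^sub>v n" using v by simp
  finally have "A' *\<^sub>v v = 0\<^sub>v n" .
  then have A'0: "A' = 0\<^sub>m n n" using hom_injective[OF irr r A' _ v(1)] v(2) by blast
  have "A = c \<cdot>\<^sub>m 1\<^sub>m n"
  proof (rule eq_matI)
    fix i j assume "i < dim_row (c \<cdot>\<^sub>m 1\<^sub>m n)" "j < dim_col (c \<cdot>\<^sub>m 1\<^sub>m n)"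
    then have ij: "i < n" "j < n" by auto
    have "A' $$ (i,j) = 0" using A'0 ij by simp
    then show "A $$ (i,j) = (c \<cdot>\<^sub>m 1\<^sub>m n) $$ (i,j)" using ij Ac by (simp add: A'_def)
  qed (use Ac in simp_all)
  then show ?thesis by blast
qed

lemma hom_dim_noniso:
  assumes "irreducible_rep G n \<rho>" "irreducible_rep G m \<sigma>" "\<not> iso_rep G n \<rho> m \<sigma>"
  shows "hom_dim G n \<rho> m \<sigma> = 0"
\<comment> \<open>With \<open>k = 0\<close> the two families are placeholders; only the spanning
  condition has content, and it says that every intertwiner is zero.\<close>
proof (rule hom_dim_eq_card_basis[where b = "\<lambda>_ _. 0" and c = "\<lambda>_ _. 0"])
  fix A x assume "A \<in> hom_space G n \<rho> m \<sigma>" "x \<in> {..<m} \<times> {..<n}"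
  then have "A = 0\<^sub>m m n" "fst x < m" "snd x < n" using schur_iso[OF assms(1,2)] assms(3) by auto
  then show "A $$ x = (\<Sum>l<(0::nat). 0 * (\<Sum>y\<in>{..<m} \<times> {..<n}. 0 * A $$ y))"
    by (cases x) simp
qed simp_all

lemma hom_dim_self:
  assumes irr: "irreducible_rep G n \<rho>"
  shows "hom_dim G n \<rho> n \<rho> = 1"
\<comment> \<open>The identity matrix is the basis and the entry at \<open>(0,0)\<close> its dual
  functional; that entry exists because irreducibility includes \<open>n > 0\<close>.\<close>
proof (rule hom_dim_eq_card_basis[where b = "\<lambda>l x. if fst x = snd x then 1 else 0"
      and c = "\<lambda>l x. if x = (0,0) then 1 else 0"])
  note r = is_rep_irreducible[OF irr]
  have n: "n > 0" using irr by (simp add: irreducible_rep_def)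
  have one: "mat n n (\<lambda>x. if fst x = snd x then 1 else 0) = (1\<^sub>m n :: complex mat)"
    by (rule eq_matI) simp_all
  have "1\<^sub>m n \<in> hom_space G n \<rho> n \<rho>"
    unfolding hom_space_def
    by (simp add: left_mult_one_mat[OF is_repD(1)[OF r]] right_mult_one_mat[OF is_repD(1)[OF r]])
  then show "mat n n (\<lambda>x. if fst x = snd x then 1 else 0) \<in> hom_space G n \<rho> n \<rho>" by (simp add: one)
  have d: "(\<Sum>x\<in>{..<n} \<times> {..<n}. (if x = (0,0) then 1 else 0) * F x) = F (0,0)" for F :: "nat \<times> nat \<Rightarrow> complex"
    using n by (simp add: if_distrib[of "\<lambda>z. z * _"] cong: if_cong)
  show "(\<Sum>x\<in>{..<n} \<times> {..<n}. (if x = (0,0) then 1 else 0) * (if fst x = snd x then 1 else (0::complex)))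
    = (if l = q then 1 else 0)" if "l < 1" "q < 1" for l q :: nat
    using that by (simp add: d)
  show "A $$ x = (\<Sum>l<(1::nat). (if fst x = snd x then 1 else 0) *
      (\<Sum>y\<in>{..<n} \<times> {..<n}. (if y = (0,0) then 1 else 0) * A $$ y))"
    if A: "A \<in> hom_space G n \<rho> n \<rho>" and x: "x \<in> {..<n} \<times> {..<n}" for A x
  proof -
    obtain c where "A = c \<cdot>\<^sub>m 1\<^sub>m n" using schur_scalar[OF irr A] by blast
    then show ?thesis unfolding d using x n by (cases x) simp
  qed
qed

lemma iso_rep_character:
  assumes iso: "iso_rep G n \<rho> m \<sigma>" and r: "is_rep G n \<rho>" and s: "is_rep G m \<sigma>" and g: "g \<in> G"
  shows "mtr (\<rho> g) = mtr (\<sigma> g)"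
proof -
  obtain A where nm: "n = m" and A: "A \<in> carrier_mat n n" "invertible_mat A" "A * \<rho> g = \<sigma> g * A"
    using iso g unfolding iso_rep_def by blast
  obtain B where B: "B \<in> carrier_mat n n" "A * B = 1\<^sub>m n" "B * A = 1\<^sub>m n"
    using invertible_mat_obtain_inverse[OF A(1,2)] by blast
  note rg = is_repD(1)[OF r g] and sg = is_repD(1)[OF s g, folded nm]
  have "\<rho> g = B * (A * \<rho> g)"
    using assoc_mult_mat[OF B(1) A(1) rg] B(3) rg by simp
  then have "mtr (\<rho> g) = mtr (B * (\<sigma> g * A))" using A(3) by simp
  also have "\<dots> = mtr (\<sigma> g * A * B)" by (rule mtr_comm[OF B(1)]) (use sg A in simp)
  also have "\<sigma> g * A * B = \<sigma> g" using assoc_mult_mat[OF sg A(1) B(1)] B(2) sg by simp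
  finally show ?thesis .
qed

lemma character_conj:
  assumes r: "is_rep G n \<rho>" and g: "g \<in> G" and h: "h \<in> G"
  shows "mtr (\<rho> (h * g * h\<^sup>T)) = mtr (\<rho> g)"
proof -
  note c = is_repD(1)[OF r g] is_repD(1)[OF r h] is_repD(1)[OF r transpose_G[OF h]]
  have "\<rho> (h * g * h\<^sup>T) = \<rho> h * \<rho> g * \<rho> (h\<^sup>T)"
    by (simp add: is_repD(3)[OF r] g h mult_G transpose_G)
  also have "mtr \<dots> = mtr (\<rho> (h\<^sup>T) * (\<rho> h * \<rho> g))" by (rule mtr_comm) (use c in auto)
  also have "\<rho> (h\<^sup>T) * (\<rho> h * \<rho> g) = \<rho> g"
    using assoc_mult_mat[OF c(3,2,1)] is_repD(5)[OF r h] c by simp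
  finally show ?thesis .
qed

end

section \<open>Irreducible constituents and operators attached to class functions\<close>

context finite_orthogonal_group
begin

text \<open>A splitting \<open>(B, C)\<close> of an invariant subspace of least positive dimension cuts out an
  irreducible representation \<open>C \<rho> B\<close>.\<close>

lemma irreducible_subrep:
  assumes r: "is_rep G n \<rho>" and W: "is_subspace n W" and W0: "W \<noteq> {0\<^sub>v n}"
    and inv: "\<And>g w. g \<in> G \<Longrightarrow> w \<in> W \<Longrightarrow> \<rho> g *\<^sub>v w \<in> W"
  shows "\<exists>k \<tau> A. irreducible_rep G k \<tau> \<and> A \<in> hom_space G k \<tau> n \<rho> \<and> A \<noteq> 0\<^sub>m n k \<and>
    (\<forall>v\<in>carrier_vec k. A *\<^sub>v v \<in> W)"
proof -
  have Wc: "W \<subseteq> carrier_vec n" and W0': "0\<^sub>v n \<in> W" using W by (auto simp: is_subspace_def)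
  \<comment> \<open>The last condition is invariance of the range of \<open>B\<close>: the
    retraction \<open>B * C\<close> fixes \<open>\<rho> g * B\<close>.\<close>
  define S where "S k B C \<longleftrightarrow> k > 0 \<and> B \<in> carrier_mat n k \<and> C \<in> carrier_mat k n \<and> C * B = 1\<^sub>m k \<and>
    (\<forall>v\<in>carrier_vec k. B *\<^sub>v v \<in> W) \<and> (\<forall>g\<in>G. B * (C * (\<rho> g * B)) = \<rho> g * B)" for k B C
  have "\<exists>k B C. S k B C"
  proof -
    obtain k B C where BC: "B \<in> carrier_mat n k" "C \<in> carrier_mat k n" "C * B = 1\<^sub>m k"
      "\<forall>v\<in>carrier_vec k. B *\<^sub>v v \<in> W" "\<forall>w\<in>W. B *\<^sub>v (C *\<^sub>v w) = w"
      using subspace_dual_basis[OF W] by blast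
    have "k > 0"
    proof (rule ccontr)
      assume "\<not> k > 0"
      then have k: "k = 0" by simp
      have "w = 0\<^sub>v n" if w: "w \<in> W" for w
      proof -
        have "B *\<^sub>v (C *\<^sub>v w) = 0\<^sub>v n" using BC(1,2) k by (intro eq_vecI) (simp_all add: scalar_prod_def)
        then show ?thesis using BC(5) w by simp
      qed
      then show False using W0 W0' by blast
    qed
    moreover have "B * (C * (\<rho> g * B)) = \<rho> g * B" if g: "g \<in> G" for g
    proof (rule mat_eqI_vec[of _ n k])
      note rg = is_repD(1)[OF r g]
      fix v :: "complex vec" assume v: "v \<in> carrier_vec k"
      have "B *\<^sub>v (C *\<^sub>v (\<rho> g *\<^sub>v (B *\<^sub>v v))) = \<rho> g *\<^sub>v (B *\<^sub>v v)"
        using BC(4,5) inv[OF g] v by simp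
      then show "(B * (C * (\<rho> g * B))) *\<^sub>v v = (\<rho> g * B) *\<^sub>v v"
        using BC(1,2) rg v by (simp add: mat_vec_assoc_dim)
    qed (use BC(1,2) is_repD(1)[OF r g] in simp_all)
    ultimately have "S k B C" using BC unfolding S_def by blast
    then show ?thesis by blast
  qed
  then have ex: "\<exists>k. \<exists>B C. S k B C" .
  define k where "k = (LEAST k. \<exists>B C. S k B C)"
  obtain B C where SBC: "S k B C" using LeastI_ex[OF ex] unfolding k_def by blast
  have least: "\<not> S k' B' C'" if "k' < k" for k' B' C'
    using not_less_Least[of k' "\<lambda>k. \<exists>B C. S k B C"] that unfolding k_def by blast
  have k0: "k > 0" and B: "B \<in> carrier_mat n k" and C: "C \<in> carrier_mat k n" and CB: "C * B = 1\<^sub>m k"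
    and BW: "\<And>v. v \<in> carrier_vec k \<Longrightarrow> B *\<^sub>v v \<in> W"
    and BC: "\<And>g. g \<in> G \<Longrightarrow> B * (C * (\<rho> g * B)) = \<rho> g * B"
    using SBC unfolding S_def by auto
  have dB: "dim_row B = n" "dim_col B = k" and dC: "dim_row C = k" "dim_col C = n" using B C by auto
  have dr: "dim_row (\<rho> g) = n" "dim_col (\<rho> g) = n" if "g \<in> G" for g using is_repD(1)[OF r that] by auto
  have CBX: "C * (B * X) = X" if "dim_row X = k" for X
    using CB that mat_assoc_dim[of C B X] dB dC by simp
  have BCX: "B * (C * (\<rho> g * (B * X))) = \<rho> g * (B * X)" if g: "g \<in> G" and X: "dim_row X = k" for g X
  proof -
    have "B * (C * (\<rho> g * (B * X))) = (B * (C * (\<rho> g * B))) * X"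
      by (simp add: mat_assoc_dim dB dC dr[OF g] X)
    also have "\<dots> = \<rho> g * (B * X)" unfolding BC[OF g] by (simp add: mat_assoc_dim dB dC dr[OF g] X)
    finally show ?thesis .
  qed
  define \<tau> where "\<tau> g = C * (\<rho> g * B)" for g
  have \<tau>c: "\<tau> g \<in> carrier_mat k k" if "g \<in> G" for g
    using B C is_repD(1)[OF r that] by (simp add: \<tau>_def)
  have \<tau>r: "is_rep G k \<tau>" unfolding is_rep_def
  proof (intro conjI ballI)
    show "\<tau> (1\<^sub>m 3) = 1\<^sub>m k" using is_repD(2)[OF r] B CB by (simp add: \<tau>_def)
    fix g h assume gh: "g \<in> G" "h \<in> G"
    have "\<tau> g * \<tau> h = C * (\<rho> g * (B * (C * (\<rho> h * B))))"
      by (simp add: \<tau>_def mat_assoc_dim dB dC dr gh)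
    also have "\<dots> = C * (\<rho> g * (\<rho> h * B))" by (simp add: BC gh)
    also have "\<dots> = \<tau> (g * h)" by (simp add: \<tau>_def is_repD(3)[OF r] gh mat_assoc_dim dB dr)
    finally show "\<tau> (g * h) = \<tau> g * \<tau> h" by simp
  qed (rule \<tau>c)
  have "irreducible_rep G k \<tau>" unfolding irreducible_rep_def
  proof (intro conjI allI impI \<tau>r k0, elim conjE)
    fix U assume U: "is_subspace k U" and Uinv: "\<forall>g\<in>G. \<forall>w\<in>U. \<tau> g *\<^sub>v w \<in> U"
    show "U = {0\<^sub>v k} \<or> U = carrier_vec k"
    proof (rule ccontr)
      assume neg: "\<not> ?thesis"
      have Uc: "U \<subseteq> carrier_vec k" and U0: "0\<^sub>v k \<in> U" using U by (auto simp: is_subspace_def)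
      obtain k' B' C' where k': "k' \<le> k" and B': "B' \<in> carrier_mat k k'" and C': "C' \<in> carrier_mat k' k"
        and C'B': "C' * B' = 1\<^sub>m k'" and B'U: "\<forall>v\<in>carrier_vec k'. B' *\<^sub>v v \<in> U"
        and B'C': "\<forall>w\<in>U. B' *\<^sub>v (C' *\<^sub>v w) = w"
        using subspace_dual_basis[OF U] by blast
      have dB': "dim_row B' = k" "dim_col B' = k'" and dC': "dim_row C' = k'" "dim_col C' = k" using B' C' by auto
      have "k' \<noteq> 0"
      proof
        assume z: "k' = 0"
        have "w = 0\<^sub>v k" if w: "w \<in> U" for w
        proof -
          have "B' *\<^sub>v (C' *\<^sub>v w) = 0\<^sub>v k" using B' C' z by (intro eq_vecI) (simp_all add: scalar_prod_def)
          then show ?thesis using B'C' w by simp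
        qed
        then show False using neg U0 by blast
      qed
      moreover have "k' \<noteq> k"
      proof
        assume z: "k' = k"
        have "B' * C' = 1\<^sub>m k" using mat_mult_left_right_inverse[of C' k B'] B' C' C'B' z by simp
        have "v \<in> U" if v: "v \<in> carrier_vec k" for v
        proof -
          have "B' *\<^sub>v (C' *\<^sub>v v) = (B' * C') *\<^sub>v v" using v by (simp add: mat_vec_assoc_dim dB' dC' z)
          also have "\<dots> = v" using \<open>B' * C' = 1\<^sub>m k\<close> v by simp
          finally show ?thesis using B'U[rule_format, OF mult_mat_vec_carrier[OF C' v]] by simp
        qed
        then show False using neg Uc by blast
      qed
      ultimately have lt: "k' < k" and pos: "k' > 0" using k' by auto
      have B'inv: "B' * (C' * (\<tau> g * B')) = \<tau> g * B'" if g: "g \<in> G" for g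
      proof (rule mat_eqI_vec[of _ k k'])
        fix v :: "complex vec" assume v: "v \<in> carrier_vec k'"
        have "B' *\<^sub>v (C' *\<^sub>v (\<tau> g *\<^sub>v (B' *\<^sub>v v))) = \<tau> g *\<^sub>v (B' *\<^sub>v v)"
          using B'U B'C' Uinv g v by simp
        then show "(B' * (C' * (\<tau> g * B'))) *\<^sub>v v = (\<tau> g * B') *\<^sub>v v"
          using B' C' \<tau>c[OF g] v by (simp add: mat_vec_assoc_dim)
      qed (use B' C' \<tau>c[OF g] in simp_all)
      \<comment> \<open>Splitting an invariant subspace \<open>U\<close> of the piece and composing
        with \<open>(B, C)\<close> gives a splitting of smaller positive dimension, against
        minimality of \<open>k\<close>.\<close>
      have "S k' (B * B') (C' * C)" unfolding S_def
      proof (intro conjI ballI)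
        show "(C' * C) * (B * B') = 1\<^sub>m k'"
          by (simp add: mat_assoc_dim dB dC dB' dC' CBX C'B')
        show "(B * B') *\<^sub>v v \<in> W" if "v \<in> carrier_vec k'" for v
          using that by (simp add: mat_vec_assoc_dim dB dB' BW mult_mat_vec_carrier[OF B'])
        fix g assume g: "g \<in> G"
        have "(B * B') * ((C' * C) * (\<rho> g * (B * B'))) = B * (B' * (C' * (\<tau> g * B')))"
          by (simp add: \<tau>_def mat_assoc_dim dB dC dB' dC' dr[OF g])
        also have "\<dots> = B * (\<tau> g * B')" by (simp add: B'inv[OF g])
        also have "\<dots> = B * (C * (\<rho> g * (B * B')))" by (simp add: \<tau>_def mat_assoc_dim dB dC dB' dr[OF g])
        also have "\<dots> = \<rho> g * (B * B')" by (rule BCX[OF g dB'(1)])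
        finally show "(B * B') * ((C' * C) * (\<rho> g * (B * B'))) = \<rho> g * (B * B')" .
      qed (use pos B B' C C' in simp_all)
      then show False using least[OF lt] by blast
    qed
  qed
  moreover have "B \<in> hom_space G k \<tau> n \<rho>" using B BC by (simp add: hom_space_def \<tau>_def)
  moreover have "B \<noteq> 0\<^sub>m n k"
  proof
    assume "B = 0\<^sub>m n k"
    then have "1\<^sub>m k = (0\<^sub>m k k :: complex mat)" using CB C by simp
    then have "(1\<^sub>m k :: complex mat) $$ (0,0) = 0" using k0 by simp
    then show False using k0 by simp
  qed
  ultimately show ?thesis using BW by blast
qed

text \<open>The group algebra element with coefficients \<open>f\<close>, acting through
  \<open>\<rho>\<close>; in other words the Fourier transform of \<open>f\<close> at
  \<open>\<rho>\<close>.\<close>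

definition class_op :: "(complex mat \<Rightarrow> complex) \<Rightarrow> nat \<Rightarrow> (complex mat \<Rightarrow> complex mat) \<Rightarrow> complex mat" where
  "class_op f n \<rho> = msum G n n (\<lambda>g. f g \<cdot>\<^sub>m \<rho> g)"

lemma class_op_carrier [simp]: "class_op f n \<rho> \<in> carrier_mat n n"
  by (simp add: class_op_def)

lemma class_op_index:
  assumes "is_rep G n \<rho>" "i < n" "j < n"
  shows "class_op f n \<rho> $$ (i,j) = (\<Sum>g\<in>G. f g * \<rho> g $$ (i,j))"
proof -
  have "(f g \<cdot>\<^sub>m \<rho> g) $$ (i,j) = f g * \<rho> g $$ (i,j)" if "g \<in> G" for g
    using is_repD(1)[OF assms(1) that] assms(2,3) by simp
  then show ?thesis using assms by (simp add: class_op_def msum_index)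
qed

lemma class_op_intertwines:
  assumes r: "is_rep G n \<rho>" and s: "is_rep G m \<sigma>" and A: "A \<in> hom_space G n \<rho> m \<sigma>"
  shows "A * class_op f n \<rho> = class_op f m \<sigma> * A"
proof -
  note Ac = hom_spaceD(1)[OF A]
  have "A * class_op f n \<rho> = msum G m n (\<lambda>g. A * (f g \<cdot>\<^sub>m \<rho> g))"
    unfolding class_op_def by (rule mult_msum[OF Ac]) (use is_repD(1)[OF r] in simp)
  also have "\<dots> = msum G m n (\<lambda>g. (f g \<cdot>\<^sub>m \<sigma> g) * A)"
  proof (rule msum_cong)
    fix g assume g: "g \<in> G"
    show "A * (f g \<cdot>\<^sub>m \<rho> g) = (f g \<cdot>\<^sub>m \<sigma> g) * A"
      using mult_smult_distrib[OF Ac is_repD(1)[OF r g]] mult_smult_assoc_mat[OF is_repD(1)[OF s g] Ac]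
        hom_spaceD(2)[OF A g] by simp
  qed
  also have "\<dots> = class_op f m \<sigma> * A"
    unfolding class_op_def by (rule msum_mult[OF Ac, symmetric]) (use is_repD(1)[OF s] in simp)
  finally show ?thesis .
qed

text \<open>A class function is central in the group algebra: conjugating the summation variable by
  \<open>h\<close> moves \<open>\<rho> h\<close> from one side to the other.\<close>

lemma class_op_hom:
  assumes r: "is_rep G n \<rho>" and f: "\<And>g h. g \<in> G \<Longrightarrow> h \<in> G \<Longrightarrow> f (h * g * h\<^sup>T) = f g"
  shows "class_op f n \<rho> \<in> hom_space G n \<rho> n \<rho>"
  unfolding hom_space_def
proof (intro CollectI conjI ballI class_op_carrier)
  fix h assume h: "h \<in> G"
  note rh = is_repD(1)[OF r h]
  have "class_op f n \<rho> * \<rho> h = msum G n n (\<lambda>g. (f g \<cdot>\<^sub>m \<rho> g) * \<rho> h)"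
    unfolding class_op_def by (rule msum_mult[OF rh]) (use is_repD(1)[OF r] in simp)
  also have "\<dots> = msum G n n (\<lambda>g. f (h * g * h\<^sup>T) \<cdot>\<^sub>m \<rho> (h * g * h\<^sup>T * h))"
  proof (rule eq_matI)
    fix i j assume "i < dim_row (msum G n n (\<lambda>g. f (h * g * h\<^sup>T) \<cdot>\<^sub>m \<rho> (h * g * h\<^sup>T * h)))"
      "j < dim_col (msum G n n (\<lambda>g. f (h * g * h\<^sup>T) \<cdot>\<^sub>m \<rho> (h * g * h\<^sup>T * h)))"
    then have ij: "i < n" "j < n" by (simp_all add: msum_def)
    have "(\<Sum>g\<in>G. ((f g \<cdot>\<^sub>m \<rho> g) * \<rho> h) $$ (i,j)) = (\<Sum>g\<in>G. (f g \<cdot>\<^sub>m \<rho> (g * h)) $$ (i,j))"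
      by (intro sum.cong refl) (simp only: mult_smult_assoc_mat[OF is_repD(1)[OF r] rh] is_repD(3)[OF r _ h])
    also have "\<dots> = (\<Sum>g\<in>G. (f (h * g * h\<^sup>T) \<cdot>\<^sub>m \<rho> (h * g * h\<^sup>T * h)) $$ (i,j))"
      by (rule sum_G_conj[OF h, symmetric])
    finally show "msum G n n (\<lambda>g. (f g \<cdot>\<^sub>m \<rho> g) * \<rho> h) $$ (i,j) =
      msum G n n (\<lambda>g. f (h * g * h\<^sup>T) \<cdot>\<^sub>m \<rho> (h * g * h\<^sup>T * h)) $$ (i,j)"
      using ij by (simp only: msum_index)
  qed (simp_all add: msum_def)
  also have "\<dots> = msum G n n (\<lambda>g. \<rho> h * (f g \<cdot>\<^sub>m \<rho> g))"
  proof (rule msum_cong)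
    fix g assume g: "g \<in> G"
    have "h * g * h\<^sup>T * h = h * g" by (simp add: assoc_G mult_G transpose_G g h orth' mult_one_G)
    then show "f (h * g * h\<^sup>T) \<cdot>\<^sub>m \<rho> (h * g * h\<^sup>T * h) = \<rho> h * (f g \<cdot>\<^sub>m \<rho> g)"
      using f[OF g h] mult_smult_distrib[OF rh is_repD(1)[OF r g]] is_repD(3)[OF r h g] by simp
  qed
  also have "\<dots> = \<rho> h * class_op f n \<rho>"
    unfolding class_op_def by (rule mult_msum[OF rh, symmetric]) (use is_repD(1)[OF r] in simp)
  finally show "class_op f n \<rho> * \<rho> h = \<rho> h * class_op f n \<rho>" .
qed

text \<open>By Schur the operator is a scalar \<open>c\<close>, and its trace \<open>c * n\<close>
  is the given vanishing sum.\<close>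

lemma class_op_irreducible_eq_0:
  assumes irr: "irreducible_rep G n \<rho>" and f: "\<And>g h. g \<in> G \<Longrightarrow> h \<in> G \<Longrightarrow> f (h * g * h\<^sup>T) = f g"
    and z: "(\<Sum>g\<in>G. f g * mtr (\<rho> g)) = 0"
  shows "class_op f n \<rho> = 0\<^sub>m n n"
proof -
  note r = is_rep_irreducible[OF irr]
  have n: "n > 0" using irr by (simp add: irreducible_rep_def)
  obtain c where c: "class_op f n \<rho> = c \<cdot>\<^sub>m 1\<^sub>m n"
    using schur_scalar[OF irr class_op_hom[OF r f]] by blast
  have "mtr (class_op f n \<rho>) = (\<Sum>i<n. \<Sum>g\<in>G. f g * \<rho> g $$ (i,i))"
    unfolding mtr_def carrier_matD(1)[OF class_op_carrier] by (intro sum.cong) (auto simp: class_op_index[OF r])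
  also have "\<dots> = (\<Sum>g\<in>G. \<Sum>i<n. f g * \<rho> g $$ (i,i))" by (rule sum.swap)
  also have "\<dots> = (\<Sum>g\<in>G. f g * mtr (\<rho> g))"
  proof (intro sum.cong refl)
    fix g assume "g \<in> G"
    then have "dim_row (\<rho> g) = n" using is_repD(1)[OF r] by auto
    then show "(\<Sum>i<n. f g * \<rho> g $$ (i,i)) = f g * mtr (\<rho> g)" by (simp add: mtr_def sum_distrib_left)
  qed
  finally have "mtr (c \<cdot>\<^sub>m 1\<^sub>m n) = 0" using z c by simp
  then have "c = 0" using n by (simp add: mtr_def)
  then show ?thesis unfolding c by (intro eq_matI) simp_all
qed

end

section \<open>Class functions are detected by irreducible characters\<close>

context finite_orthogonal_group
begin

text \<open>On the regular representation let \<open>T\<close> be the operator of \<open>f\<close>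
  and \<open>T'\<close> its adjoint. If \<open>T'\<close> were nonzero, its range would contain an
  irreducible piece. There \<open>T\<close> acts as zero by
  \<open>class_op_irreducible_eq_0\<close>; but a vector in the range of \<open>T'\<close> that
  \<open>T\<close> kills is orthogonal to itself. Hence \<open>T' = 0\<close>, and its entries are
  the conjugated values of \<open>f\<close>.\<close>

lemma class_function_eq_0:
  assumes f: "\<And>g h. g \<in> G \<Longrightarrow> h \<in> G \<Longrightarrow> f (h * g * h\<^sup>T) = f g"
    and z: "\<And>n \<tau>. irreducible_rep G n \<tau> \<Longrightarrow> (\<Sum>g\<in>G. f g * mtr (\<tau> g)) = 0"
    and g0: "g0 \<in> G"
  shows "f g0 = 0"
proof -
  obtain gl where gl: "set gl = G" "distinct gl" using finite_distinct_list[OF finite_G] by blast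
  define n where "n = length gl"
  have glG: "gl ! a \<in> G" if "a < n" for a using that gl(1) by (auto simp: n_def)
  have gl_ex: "\<exists>a<n. gl ! a = g" if "g \<in> G" for g
    using that gl(1) by (metis in_set_conv_nth n_def)
  have gl_inj: "gl ! a = gl ! b \<longleftrightarrow> a = b" if "a < n" "b < n" for a b
    using that gl(2) by (simp add: n_def nth_eq_iff_index_eq)
  \<comment> \<open>The regular representation as permutation matrices on the enumeration
    \<open>gl\<close>; the entries are real, so the transpose is also the adjoint.\<close>
  define R where "R g = mat n n (\<lambda>(a,b). if g * gl ! b = gl ! a then 1 else (0::complex))" for g
  have Rc: "R g \<in> carrier_mat n n" for g by (simp add: R_def)
  have R: "is_rep G n R" unfolding is_rep_def
  proof (intro conjI ballI Rc)
    show "R (1\<^sub>m 3) = 1\<^sub>m n"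
      by (rule eq_matI) (auto simp: R_def one_mult_G glG gl_inj)
    fix g h assume gh: "g \<in> G" "h \<in> G"
    show "R (g * h) = R g * R h"
    proof (rule eq_matI)
      fix a b assume "a < dim_row (R g * R h)" "b < dim_col (R g * R h)"
      then have ab: "a < n" "b < n" by (simp_all add: R_def)
      obtain c where c: "c < n" "gl ! c = h * gl ! b" using gl_ex[of "h * gl ! b"] mult_G glG ab gh by metis
      have "(R g * R h) $$ (a,b) = (\<Sum>l<n. R g $$ (a,l) * R h $$ (l,b))" by (rule mult_entry[OF Rc Rc ab])
      also have "\<dots> = (\<Sum>l<n. if l = c then R g $$ (a,c) else 0)"
        using ab c gl_inj by (intro sum.cong) (auto simp: R_def)
      also have "\<dots> = R g $$ (a,c)" using c by simp
      also have "\<dots> = R (g * h) $$ (a,b)" using ab c by (simp add: R_def assoc_G gh glG)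
      finally show "R (g * h) $$ (a,b) = (R g * R h) $$ (a,b)" by simp
    qed (simp_all add: R_def)
  qed
  \<comment> \<open>Coefficients of the adjoint: conjugate the value and invert the group
    element.\<close>
  define f' where "f' g = cnj (f (g\<^sup>T))" for g
  have f'c: "f' (h * g * h\<^sup>T) = f' g" if "g \<in> G" "h \<in> G" for g h
    using f[of "g\<^sup>T" h] that by (simp add: f'_def transpose_mult_G mult_G transpose_G assoc_G)
  define T where "T = class_op f n R"
  define T' where "T' = class_op f' n R"
  have Tc: "T \<in> carrier_mat n n" and T'c: "T' \<in> carrier_mat n n" by (simp_all add: T_def T'_def)
  have R_transpose: "R (g\<^sup>T) $$ (a,b) = R g $$ (b,a)" if "g \<in> G" "a < n" "b < n" for g a b
  proof -
    have "g\<^sup>T * gl ! b = gl ! a \<longleftrightarrow> g * gl ! a = gl ! b"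
      using cancel_G[OF that(1), of "gl ! a"] cancel_G[OF that(1), of "gl ! b"] glG that by metis
    then show ?thesis using that by (simp add: R_def)
  qed
  have cnjR: "cnj (R g $$ (a,b)) = R g $$ (a,b)" if "a < n" "b < n" for g a b
    using that by (simp add: R_def)
  have adj: "T' $$ (a,b) = cnj (T $$ (b,a))" if ab: "a < n" "b < n" for a b
  proof -
    have "T' $$ (a,b) = (\<Sum>g\<in>G. f' (g\<^sup>T) * R (g\<^sup>T) $$ (a,b))"
      unfolding T'_def class_op_index[OF R ab] by (rule sum_G_transpose[symmetric])
    also have "\<dots> = (\<Sum>g\<in>G. cnj (f g * R g $$ (b,a)))"
      by (intro sum.cong refl) (simp add: f'_def R_transpose ab cnjR)
    also have "\<dots> = cnj (T $$ (b,a))"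
      unfolding T_def class_op_index[OF R ab(2,1)] by simp
    finally show ?thesis .
  qed
  let ?W = "(*\<^sub>v) T' ` carrier_vec n"
  have W: "?W = {0\<^sub>v n}"
  proof (rule ccontr)
    assume W0: "?W \<noteq> {0\<^sub>v n}"
    have "R g *\<^sub>v w \<in> ?W" if g: "g \<in> G" and w: "w \<in> ?W" for g w
    proof -
      obtain v where v: "v \<in> carrier_vec n" "w = T' *\<^sub>v v" using w by blast
      have "R g *\<^sub>v w = T' *\<^sub>v (R g *\<^sub>v v)"
        unfolding v(2) T'_def by (rule hom_space_apply[OF R R class_op_hom[OF R f'c] g v(1), symmetric])
      then show ?thesis by (rule image_eqI) (rule mult_mat_vec_carrier[OF Rc v(1)])
    qed
    from irreducible_subrep[OF R range_subspace[OF T'c] W0 this]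
    obtain k \<tau> A where irr: "irreducible_rep G k \<tau>" and A: "A \<in> hom_space G k \<tau> n R" "A \<noteq> 0\<^sub>m n k"
      and AW: "\<forall>v\<in>carrier_vec k. A *\<^sub>v v \<in> ?W" by blast
    note Ac = hom_spaceD(1)[OF A(1)]
    have "T * A = A * class_op f k \<tau>"
      unfolding T_def by (rule class_op_intertwines[OF is_rep_irreducible[OF irr] R A(1), symmetric])
    also have "\<dots> = 0\<^sub>m n k"
      using class_op_irreducible_eq_0[OF irr f z[OF irr]] Ac by simp
    finally have TA: "T * A = 0\<^sub>m n k" .
    have "A = 0\<^sub>m n k"
    proof (rule mat_eq_0_iff_mult_vec[OF Ac])
      fix v :: "complex vec" assume v: "v \<in> carrier_vec k"
      define w where "w = A *\<^sub>v v"
      have wc: "w \<in> carrier_vec n" using Ac v by (simp add: w_def)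
      have "T *\<^sub>v w = (T * A) *\<^sub>v v" unfolding w_def by (rule assoc_mult_mat_vec[OF Tc Ac v, symmetric])
      then have Tw: "T *\<^sub>v w = 0\<^sub>v n" using TA v by (intro eq_vecI) simp_all
      obtain u where u: "u \<in> carrier_vec n" "w = T' *\<^sub>v u" using AW v unfolding w_def by blast
      \<comment> \<open>With \<open>w = T' u\<close>, the squared norm of \<open>w\<close> is the
        Hermitian product of \<open>w\<close> with \<open>T' u\<close>, which by adjointness is the
        product of \<open>T w\<close> with \<open>u\<close>, hence zero.\<close>
      have "(\<Sum>a<n. cnj (w $ a) * w $ a) = (\<Sum>a<n. cnj (w $ a) * (\<Sum>b<n. cnj (T $$ (b,a)) * u $ b))"
        by (intro sum.cong refl) (simp add: u(2) mult_vec_entry[OF T'c u(1)] adj del: index_mult_mat_vec)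
      also have "\<dots> = (\<Sum>b<n. u $ b * cnj (\<Sum>a<n. T $$ (b,a) * w $ a))"
        unfolding sum_distrib_left cnj_sum by (subst sum.swap) (simp add: mult_ac)
      also have "\<dots> = (\<Sum>b<n. u $ b * cnj ((T *\<^sub>v w) $ b))"
        by (intro sum.cong refl) (simp add: mult_vec_entry[OF Tc wc] del: index_mult_mat_vec)
      also have "\<dots> = 0" by (simp add: Tw)
      finally have "(\<Sum>a<n. cnj (w $ a) * w $ a) = 0" .
      moreover have "cnj (w $ a) * w $ a = complex_of_real ((norm (w $ a))\<^sup>2)" for a
        by (metis complex_norm_square mult.commute of_real_power)
      ultimately have "complex_of_real (\<Sum>a<n. (norm (w $ a))\<^sup>2) = 0" by simp
      then have "(\<Sum>a<n. (norm (w $ a))\<^sup>2) = 0" using of_real_eq_0_iff by blast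
      then have "\<forall>a<n. w $ a = 0" by (subst (asm) sum_nonneg_eq_0_iff) auto
      then show "A *\<^sub>v v = 0\<^sub>v n" using wc unfolding w_def[symmetric] by (intro eq_vecI) auto
    qed
    then show False using A(2) by simp
  qed
  \<comment> \<open>In the column of the identity only one group element contributes to each entry,
    so the row of \<open>g0\<^sup>T\<close> displays
    \<open>f' (g0\<^sup>T) = cnj (f g0)\<close>.\<close>
  obtain a where a: "a < n" "gl ! a = g0\<^sup>T" using gl_ex[OF transpose_G[OF g0]] by blast
  obtain b where b: "b < n" "gl ! b = 1\<^sub>m 3" using gl_ex[OF one_G] by blast
  have "T' *\<^sub>v unit_vec n b = 0\<^sub>v n" using W unit_vec_carrier by blast
  then have "(T' *\<^sub>v unit_vec n b) $ a = 0" using a by simp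
  then have "0 = T' $$ (a,b)" using a b T'c by simp
  also have "\<dots> = (\<Sum>g\<in>G. f' g * R g $$ (a,b))" unfolding T'_def by (rule class_op_index[OF R a(1) b(1)])
  also have "\<dots> = (\<Sum>g\<in>G. if g = g0\<^sup>T then f' (g0\<^sup>T) else 0)"
    using a b by (intro sum.cong) (auto simp: R_def mult_one_G)
  also have "\<dots> = cnj (f g0)" using finite_G transpose_G[OF g0] by (simp add: f'_def)
  finally show ?thesis by simp
qed

end

section \<open>The determinants in terms of conjugacy classes\<close>

lemma det_mat_diag: "det (mat_diag n P) = (\<Prod>a<n. P a :: 'a :: idom)"
proof -
  have "det (mat_diag n P) = prod_list (diag_mat (mat_diag n P))"
    by (rule det_upper_triangular[of _ n]) (auto simp: mat_diag_def)
  then show ?thesis by (simp add: prod_list_diag_prod mat_diag_def atLeast0LessThan)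
qed

text \<open>A matrix whose first column is replaced by the first unit vector has the top-left entry of
  the adjugate as determinant; for \<open>A = Y D X\<close> the adjugate is \<open>Y (adj D) X\<close>.\<close>

lemma det_diagonalized:
  fixes A :: "'a :: idom mat"
  assumes A: "A \<in> carrier_mat n n" and X: "X \<in> carrier_mat n n" and Y: "Y \<in> carrier_mat n n"
    and XY: "X * Y = 1\<^sub>m n" and YX: "Y * X = 1\<^sub>m n" and XA: "X * A = mat_diag n P * X"
  shows "det A = (\<Prod>a<n. P a)"
    and "n > 0 \<Longrightarrow> (\<Prod>a<n. P a) \<noteq> 0 \<Longrightarrow>
      det (mat n n (\<lambda>(i,j). if j = 0 then (if i = 0 then 1 else 0) else A $$ (i,j))) =
      (\<Sum>a<n. Y $$ (0,a) * (\<Prod>b\<in>{..<n} - {a}. P b) * X $$ (a,0))"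
proof -
  have D: "mat_diag n P \<in> carrier_mat n n" by simp
  have dX: "det X \<noteq> 0" using det_mult[OF X Y] XY by auto
  have "det X * det A = (\<Prod>a<n. P a) * det X"
    using det_mult[OF X A, symmetric] unfolding XA det_mult[OF D X] det_mat_diag .
  then show dA: "det A = (\<Prod>a<n. P a)" using dX by simp
  assume n: "n > 0" and nz: "(\<Prod>a<n. P a) \<noteq> 0"
  define p where "p = (\<Prod>a<n. P a)"
  define Q where "Q a = (\<Prod>b\<in>{..<n} - {a}. P b)" for a
  define K where "K = Y * (mat_diag n Q * X)"
  have E: "mat_diag n Q \<in> carrier_mat n n" by simp
  have Kc: "K \<in> carrier_mat n n"
    unfolding K_def by (rule mult_carrier_mat[OF Y mult_carrier_mat[OF E X]])
  have PQ: "P a * Q a = p" if "a < n" for a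
    using that by (simp add: Q_def p_def prod.remove[of "{..<n}" a])
  have DQ: "mat_diag n P * mat_diag n Q = p \<cdot>\<^sub>m 1\<^sub>m n"
    unfolding mat_diag_diag by (rule eq_matI) (auto simp: PQ mat_diag_def)
  have "A = Y * (X * A)" using assoc_mult_mat[OF Y X A] YX A by simp
  then have A': "A = Y * (mat_diag n P * X)" using XA by simp
  have "A * K = p \<cdot>\<^sub>m 1\<^sub>m n"
  proof -
    note c = mult_carrier_mat[OF D X] mult_carrier_mat[OF E X]
    have "A * K = Y * ((mat_diag n P * X) * (Y * (mat_diag n Q * X)))"
      unfolding A' K_def by (rule assoc_mult_mat[OF Y c(1) Kc[unfolded K_def]])
    also have "(mat_diag n P * X) * (Y * (mat_diag n Q * X)) = mat_diag n P * (X * (Y * (mat_diag n Q * X)))"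
      by (rule assoc_mult_mat[OF D X Kc[unfolded K_def]])
    also have "X * (Y * (mat_diag n Q * X)) = mat_diag n Q * X"
      using assoc_mult_mat[OF X Y c(2)] unfolding XY left_mult_one_mat[OF c(2)] by (rule sym)
    also have "mat_diag n P * (mat_diag n Q * X) = (p \<cdot>\<^sub>m 1\<^sub>m n) * X"
      using assoc_mult_mat[OF D E X] DQ by simp
    also have "(p \<cdot>\<^sub>m 1\<^sub>m n) * X = p \<cdot>\<^sub>m X" using mult_smult_assoc_mat[OF one_carrier_mat X] X by simp
    also have "Y * (p \<cdot>\<^sub>m X) = p \<cdot>\<^sub>m 1\<^sub>m n" using mult_smult_distrib[OF Y X] YX by simp
    finally show ?thesis .
  qed
  \<comment> \<open>Multiplying \<open>A * K = p\<close> by the adjugate gives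
    \<open>p * K = p * adj A\<close>; the nonzero \<open>p\<close> cancels entrywise in the domain,
    so no inverse of \<open>A\<close> over a fraction field is needed.\<close>
  then have "adj_mat A * (A * K) = adj_mat A * (p \<cdot>\<^sub>m 1\<^sub>m n)" by simp
  also have "\<dots> = p \<cdot>\<^sub>m adj_mat A"
    using mult_smult_distrib[OF adj_mat(1)[OF A] one_carrier_mat] adj_mat(1)[OF A] by simp
  also have "adj_mat A * (A * K) = (adj_mat A * A) * K"
    by (rule assoc_mult_mat[OF adj_mat(1)[OF A] A Kc, symmetric])
  also have "\<dots> = p \<cdot>\<^sub>m K"
    using adj_mat(3)[OF A] dA mult_smult_assoc_mat[OF one_carrier_mat Kc] Kc by (simp add: p_def)
  finally have "(p \<cdot>\<^sub>m K) $$ (0,0) = (p \<cdot>\<^sub>m adj_mat A) $$ (0,0)" by simp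
  then have K0: "K $$ (0,0) = cofactor A 0 0"
    using n nz Kc A by (simp add: p_def adj_mat_def)
  define A0 where "A0 = mat n n (\<lambda>(i,j). if j = 0 then (if i = 0 then 1 else 0) else A $$ (i,j))"
  have A0: "A0 \<in> carrier_mat n n" by (simp add: A0_def)
  have "det A0 = (\<Sum>i<n. A0 $$ (i,0) * cofactor A0 i 0)" by (rule laplace_expansion_column[OF A0 n])
  also have "\<dots> = (\<Sum>i<n. if i = 0 then cofactor A0 0 0 else 0)"
    using n by (intro sum.cong) (auto simp: A0_def)
  also have "\<dots> = cofactor A0 0 0" using n by simp
  also have "mat_delete A0 0 0 = mat_delete A 0 0"
    using A by (intro eq_matI) (auto simp: mat_delete_def A0_def)
  then have "cofactor A0 0 0 = cofactor A 0 0" by (simp add: cofactor_def)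
  finally have "det A0 = K $$ (0,0)" using K0 by simp
  also have "K $$ (0,0) = (\<Sum>a<n. Y $$ (0,a) * Q a * X $$ (a,0))"
  proof -
    have "K $$ (0,0) = row Y 0 \<bullet> col (mat n n (\<lambda>(i,j). Q i * X $$ (i,j))) 0"
      unfolding K_def mat_diag_mult_left[OF X] using n Y by simp
    also have "\<dots> = (\<Sum>a<n. Y $$ (0,a) * Q a * X $$ (a,0))"
      using n Y by (simp add: scalar_prod_def atLeast0LessThan mult.assoc)
    finally show ?thesis .
  qed
  finally show "det (mat n n (\<lambda>(i,j). if j = 0 then (if i = 0 then 1 else 0) else A $$ (i,j))) =
      (\<Sum>a<n. Y $$ (0,a) * (\<Prod>b\<in>{..<n} - {a}. P b) * X $$ (a,0))"
    unfolding A0_def Q_def .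
qed

section \<open>The natural representation and conjugacy classes\<close>

context finite_orthogonal_group
begin

lemma is_rep_natural: "is_rep G 3 (\<lambda>g. g)"
  by (simp add: is_rep_def G_carrier)

lemma is_rep_kron:
  assumes r: "is_rep G n \<rho>"
  shows "is_rep G (n * 3) (\<lambda>g. kron (\<rho> g) (nat_rep g))"
  unfolding is_rep_def nat_rep_def
  by (auto simp: kron_carrier[OF is_repD(1)[OF r] G_carrier] is_repD(2)[OF r] kron_one is_repD(3)[OF r]
      kron_mult[OF is_repD(1)[OF r] is_repD(1)[OF r] G_carrier G_carrier])

lemma inv3_eq_transpose:
  assumes g: "g \<in> G"
  shows "inv3 g = g\<^sup>T"
  unfolding inv3_def
proof (rule the_equality)
  show "g\<^sup>T \<in> carrier_mat 3 3 \<and> g * g\<^sup>T = 1\<^sub>m 3" using G_carrier[OF g] orth[OF g] by simp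
  fix h assume h: "h \<in> carrier_mat 3 3 \<and> g * h = 1\<^sub>m 3"
  have "h = 1\<^sub>m 3 * h" by (rule left_mult_one_mat[OF conjunct1[OF h], symmetric])
  also have "\<dots> = g\<^sup>T * (g * h)"
    unfolding orth'[OF g, symmetric]
    by (rule assoc_mult_mat) (rule G_carrier[OF transpose_G[OF g]], rule G_carrier[OF g], rule conjunct1[OF h])
  finally show "h = g\<^sup>T" using h G_carrier[OF transpose_G[OF g]] by simp
qed

text \<open>The natural representation and its dual coincide as functions on \<open>G\<close> only,
  which suffices because \<open>hom_space\<close> evaluates representations on \<open>G\<close>
  alone.\<close>

lemma McKayBstar_eq_McKayB: "McKayBstar G Rs i j = McKayB G Rs i j"
proof -
  have "hom_space G n \<rho> m (\<lambda>g. kron (\<sigma> g) (dual_nat_rep g)) = hom_space G n \<rho> m (\<lambda>g. kron (\<sigma> g) (nat_rep g))"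
    for n m and \<rho> \<sigma> :: "complex mat \<Rightarrow> complex mat"
    by (auto simp: hom_space_def dual_nat_rep_def nat_rep_def inv3_eq_transpose)
  then show ?thesis by (simp add: McKayB_def McKayBstar_def multiplicity_def hom_dim_def)
qed

text \<open>Conjugacy is written without an inverse, so that membership is literally the equation
  tested by \<open>z_conjugate_to\<close>.\<close>

definition conj_class :: "complex mat \<Rightarrow> complex mat set" where
  "conj_class r = {g \<in> G. \<exists>h\<in>G. h * g = r * h}"

lemma conj_class_eq:
  assumes r: "r \<in> G" and g: "g \<in> conj_class r" and f: "\<And>g h. g \<in> G \<Longrightarrow> h \<in> G \<Longrightarrow> f (h * g * h\<^sup>T) = f g"
  shows "f g = f r"
proof -
  obtain h where h: "g \<in> G" "h \<in> G" "h * g = r * h" using g by (auto simp: conj_class_def)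
  have "h * g * h\<^sup>T = r" unfolding h(3) by (simp add: assoc_G r h transpose_G orth mult_one_G)
  then show ?thesis using f[OF h(1,2)] by simp
qed

lemma conj_class_conj:
  assumes r: "r \<in> G" and g: "g \<in> G" and k: "k \<in> G"
  shows "k * g * k\<^sup>T \<in> conj_class r \<longleftrightarrow> g \<in> conj_class r"
proof
  assume "k * g * k\<^sup>T \<in> conj_class r"
  then obtain h where h: "h \<in> G" "h * (k * g * k\<^sup>T) = r * h" by (auto simp: conj_class_def)
  have "h * k * g = h * (k * g * k\<^sup>T) * k" by (simp add: assoc_G g k h(1) mult_G transpose_G orth' mult_one_G)
  also have "\<dots> = r * (h * k)" unfolding h(2) by (simp add: assoc_G r k h(1))
  finally show "g \<in> conj_class r" using g mult_G[OF h(1) k] by (auto simp: conj_class_def)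
next
  assume "g \<in> conj_class r"
  then obtain h where h: "h \<in> G" "h * g = r * h" by (auto simp: conj_class_def)
  have "h * k\<^sup>T * (k * g * k\<^sup>T) = h * g * k\<^sup>T"
    by (simp add: assoc_G g k h(1) mult_G transpose_G cancel_G)
  also have "\<dots> = r * (h * k\<^sup>T)" unfolding h(2) by (simp add: assoc_G r k h(1) transpose_G)
  finally show "k * g * k\<^sup>T \<in> conj_class r"
    using mult_G[OF h(1) transpose_G[OF k]] mult_G[OF mult_G[OF k g] transpose_G[OF k]] by (auto simp: conj_class_def)
qed

section \<open>Characters of a complete list of irreducibles\<close>

context
  fixes Rs :: "(nat \<times> (complex mat \<Rightarrow> complex mat)) list"
  assumes Rs: "complete_irreps G Rs"
begin

abbreviation chi :: "nat \<Rightarrow> complex mat \<Rightarrow> complex" where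
  "chi i g \<equiv> mtr (snd (Rs ! i) g)"

lemma irreducible_Rs: "i < length Rs \<Longrightarrow> irreducible_rep G (fst (Rs ! i)) (snd (Rs ! i))"
  using Rs by (simp add: complete_irreps_def)

lemma rep_Rs: "i < length Rs \<Longrightarrow> is_rep G (fst (Rs ! i)) (snd (Rs ! i))"
  by (rule is_rep_irreducible[OF irreducible_Rs])

lemma chi_conj: "i < length Rs \<Longrightarrow> g \<in> G \<Longrightarrow> h \<in> G \<Longrightarrow> chi i (h * g * h\<^sup>T) = chi i g"
  by (rule character_conj[OF rep_Rs])

lemma chi_orthogonal:
  assumes i: "i < length Rs" and j: "j < length Rs"
  shows "(\<Sum>g\<in>G. chi i g * chi j (g\<^sup>T)) = (if i = j then of_nat (card G) else 0)"
proof -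
  have "\<not> iso_rep G (fst (Rs ! j)) (snd (Rs ! j)) (fst (Rs ! i)) (snd (Rs ! i))" if "i \<noteq> j"
    using Rs i j that by (auto simp: complete_irreps_def)
  then have "hom_dim G (fst (Rs ! j)) (snd (Rs ! j)) (fst (Rs ! i)) (snd (Rs ! i)) = (if i = j then 1 else 0)"
    using hom_dim_noniso[OF irreducible_Rs[OF j] irreducible_Rs[OF i]] hom_dim_self[OF irreducible_Rs[OF j]] by simp
  then show ?thesis using hom_dim_characters[OF rep_Rs[OF j] rep_Rs[OF i]] by (simp split: if_splits)
qed

text \<open>Subtracting the projection to the listed characters leaves a class function
  \<open>F\<close> orthogonal to all of them. By completeness of the list and invariance of
  characters under isomorphism, it is orthogonal to every irreducible character and vanishes by
  \<open>class_function_eq_0\<close>.\<close>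

lemma class_function_expansion:
  assumes f: "\<And>g h. g \<in> G \<Longrightarrow> h \<in> G \<Longrightarrow> f (h * g * h\<^sup>T) = f g" and h: "h \<in> G"
  shows "of_nat (card G) * f h = (\<Sum>i<length Rs. (\<Sum>g\<in>G. f g * chi i (g\<^sup>T)) * chi i h)"
proof -
  let ?N = "complex_of_nat (card G)" and ?k = "length Rs"
  define a where "a i = (\<Sum>g\<in>G. f g * chi i (g\<^sup>T))" for i
  define F where "F g = ?N * f g - (\<Sum>i<?k. a i * chi i g)" for g
  have Fc: "F (h * g * h\<^sup>T) = F g" if "g \<in> G" "h \<in> G" for g h
    unfolding F_def f[OF that] using chi_conj[OF _ that] by simp
  have Fo: "(\<Sum>g\<in>G. F g * chi j (g\<^sup>T)) = 0" if j: "j < ?k" for j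
  proof -
    have "(\<Sum>g\<in>G. F g * chi j (g\<^sup>T)) = ?N * a j - (\<Sum>g\<in>G. \<Sum>i<?k. a i * (chi i g * chi j (g\<^sup>T)))"
      by (simp add: F_def left_diff_distrib sum_subtractf a_def sum_distrib_left sum_distrib_right mult.assoc)
    also have "(\<Sum>g\<in>G. \<Sum>i<?k. a i * (chi i g * chi j (g\<^sup>T))) = (\<Sum>i<?k. a i * (\<Sum>g\<in>G. chi i g * chi j (g\<^sup>T)))"
      by (subst sum.swap) (simp add: sum_distrib_left)
    also have "\<dots> = (\<Sum>i<?k. if i = j then a j * ?N else 0)"
      using j by (intro sum.cong) (auto simp: chi_orthogonal)
    also have "\<dots> = a j * ?N" using j by simp
    finally show ?thesis by simp
  qed
  \<comment> \<open>The orthogonality of \<open>F\<close> pairs it with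
    \<open>chi j (g\<^sup>T)\<close>, while \<open>class_function_eq_0\<close> pairs with the
    character at \<open>g\<close>; it is therefore applied to \<open>F\<close> composed with
    transposition.\<close>
  have "F ((h\<^sup>T)\<^sup>T) = 0"
  proof (rule class_function_eq_0[of "\<lambda>g. F (g\<^sup>T)" "h\<^sup>T"])
    show "F ((k * g * k\<^sup>T)\<^sup>T) = F (g\<^sup>T)" if "g \<in> G" "k \<in> G" for g k
      using Fc[OF transpose_G[OF that(1)] that(2)] that
      by (simp add: transpose_mult_G mult_G transpose_G assoc_G)
    fix n \<tau> assume irr: "irreducible_rep G n \<tau>"
    then obtain r where r: "r \<in> set Rs" "iso_rep G n \<tau> (fst r) (snd r)"
      using Rs unfolding complete_irreps_def by blast
    then obtain j where j: "j < ?k" "r = Rs ! j" by (metis in_set_conv_nth)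
    have "(\<Sum>g\<in>G. F (g\<^sup>T) * mtr (\<tau> g)) = (\<Sum>g\<in>G. F (g\<^sup>T) * chi j g)"
      by (intro sum.cong refl arg_cong2[where f = "(*)"]
          iso_rep_character[OF r(2)[unfolded j(2)] is_rep_irreducible[OF irr] rep_Rs[OF j(1)]])
    also have "\<dots> = (\<Sum>g\<in>G. F (g\<^sup>T) * chi j ((g\<^sup>T)\<^sup>T))" by simp
    also have "\<dots> = (\<Sum>g\<in>G. F g * chi j (g\<^sup>T))" by (rule sum_G_transpose)
    also have "\<dots> = 0" by (rule Fo[OF j(1)])
    finally show "(\<Sum>g\<in>G. F (g\<^sup>T) * mtr (\<tau> g)) = 0" .
  qed (rule transpose_G[OF h])
  then show ?thesis by (simp add: F_def a_def)
qed

lemma McKayB_character: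
  assumes i: "i < length Rs" and j: "j < length Rs"
  shows "of_nat (card G) * of_nat (McKayB G Rs i j) = (\<Sum>g\<in>G. chi j g * mtr g * chi i (g\<^sup>T))"
  unfolding McKayB_def multiplicity_def hom_dim_characters[OF rep_Rs[OF i] is_rep_kron[OF rep_Rs[OF j]]]
  by (intro sum.cong refl) (simp add: nat_rep_def mtr_kron[OF is_repD(1)[OF rep_Rs[OF j]] G_carrier])

text \<open>The product is a class function whose expansion coefficients are, by
  \<open>McKayB_character\<close>, the McKay numbers. This is the eigenvector equation for the
  matrix \<open>B\<close>, with eigenvalue the trace of \<open>h\<close>.\<close>

lemma chi_times_natural:
  assumes j: "j < length Rs" and h: "h \<in> G"
  shows "chi j h * mtr h = (\<Sum>i<length Rs. of_nat (McKayB G Rs i j) * chi i h)"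
proof -
  have "of_nat (card G) * (chi j h * mtr h) = (\<Sum>i<length Rs. (\<Sum>g\<in>G. chi j g * mtr g * chi i (g\<^sup>T)) * chi i h)"
    by (rule class_function_expansion[OF _ h])
      (simp add: chi_conj[OF j] character_conj[OF is_rep_natural])
  also have "\<dots> = of_nat (card G) * (\<Sum>i<length Rs. of_nat (McKayB G Rs i j) * chi i h)"
    unfolding sum_distrib_left
    by (intro sum.cong refl, subst McKayB_character[OF _ j, symmetric]) (simp_all add: mult.assoc)
  finally show ?thesis using card_G_pos by simp
qed

section \<open>The determinants from a system of class representatives\<close>

context
  fixes c :: nat and r :: "nat \<Rightarrow> complex mat"
  assumes r: "\<And>a. a < c \<Longrightarrow> r a \<in> G"
    and cover: "\<And>g. g \<in> G \<Longrightarrow> \<exists>a<c. g \<in> conj_class (r a)"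
    and nonconj: "\<And>a b h. a < c \<Longrightarrow> b < c \<Longrightarrow> a \<noteq> b \<Longrightarrow> h \<in> G \<Longrightarrow> h * r a \<noteq> r b * h"
begin

lemma conj_class_disjoint:
  assumes a: "a < c" and b: "b < c" and g: "g \<in> conj_class (r a)" "g \<in> conj_class (r b)"
  shows "a = b"
proof (rule ccontr)
  assume ne: "a \<noteq> b"
  obtain h k where h: "h \<in> G" "h * g = r a * h" and k: "k \<in> G" "k * g = r b * k" and gG: "g \<in> G"
    using g by (auto simp: conj_class_def)
  have "k * h\<^sup>T * r a = k * (h\<^sup>T * (r a * h)) * h\<^sup>T"
    by (simp add: assoc_G h k r[OF a] mult_G transpose_G orth mult_one_G)
  also have "h\<^sup>T * (r a * h) = g" unfolding h(2)[symmetric] by (rule cancel_G(1)[OF h(1) gG])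
  also have "k * g * h\<^sup>T = r b * (k * h\<^sup>T)" unfolding k(2) by (simp add: assoc_G h k r[OF b] transpose_G)
  finally show False using nonconj[OF a b ne mult_G[OF k(1) transpose_G[OF h(1)]]] by simp
qed

lemma sum_G_classes:
  assumes f: "\<And>g h. g \<in> G \<Longrightarrow> h \<in> G \<Longrightarrow> f (h * g * h\<^sup>T) = f g"
  shows "(\<Sum>g\<in>G. f g) = (\<Sum>a<c. of_nat (card (conj_class (r a))) * (f (r a) :: complex))"
proof -
  have U: "G = (\<Union>a\<in>{..<c}. conj_class (r a))"
    using cover unfolding conj_class_def by blast
  have "(\<Sum>g\<in>(\<Union>a\<in>{..<c}. conj_class (r a)). f g) = (\<Sum>a<c. \<Sum>g\<in>conj_class (r a). f g)"
  proof (rule sum.UNION_disjoint)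
    show "\<forall>a\<in>{..<c}. finite (conj_class (r a))"
      using finite_G by (simp add: conj_class_def)
    show "\<forall>a\<in>{..<c}. \<forall>b\<in>{..<c}. a \<noteq> b \<longrightarrow> conj_class (r a) \<inter> conj_class (r b) = {}"
      using conj_class_disjoint by blast
  qed simp
  also have "\<dots> = (\<Sum>a<c. \<Sum>g\<in>conj_class (r a). f (r a))"
    by (intro sum.cong refl conj_class_eq[OF r _ f]) simp_all
  finally show ?thesis using U by simp
qed

text \<open>Neither row nor column orthogonality alone makes the table square;
  \<open>Y * X = 1\<close> and \<open>X * Y = 1\<close> together do, and
  \<open>det_diagonalized\<close> then applies. The second equation is multiplied by the group order
  so that the right-hand side has integral weights.\<close>

lemma McKay_determinants:
  defines "P a \<equiv> [:1, - mtr (r a), mtr (r a), - 1:]"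
  shows "map_poly of_int (det (Mt G Rs)) = (\<Prod>a<c. P a)"
    and "of_nat (card G) * map_poly of_int (det (M0t G Rs)) =
      (\<Sum>a<c. of_nat (card (conj_class (r a))) * (\<Prod>b\<in>{..<c} - {a}. P b))"
proof -
  let ?N = "complex_of_nat (card G)"
  have N: "?N \<noteq> 0" using card_G_pos by simp
  define k where "k = length Rs"
  define s where "s a = complex_of_nat (card (conj_class (r a)))" for a
  define X where "X = mat c k (\<lambda>(a,i). chi i (r a))"
  \<comment> \<open>Candidate inverse of the table: inverse group elements, weighted by the relative
    class sizes that turn sums over classes into means over \<open>G\<close>.\<close>
  define Y where "Y = mat k c (\<lambda>(i,a). s a * chi i ((r a)\<^sup>T) / ?N)"
  have Xc: "X \<in> carrier_mat c k" and Yc: "Y \<in> carrier_mat k c" by (simp_all add: X_def Y_def)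
  have k0: "k > 0" using Rs by (simp add: complete_irreps_def k_def)
  have chi_conj_T: "chi i ((h * g * h\<^sup>T)\<^sup>T) = chi i (g\<^sup>T)" if "i < k" "g \<in> G" "h \<in> G" for i g h
    using chi_conj[of i "g\<^sup>T" h] that by (simp add: k_def transpose_mult_G mult_G transpose_G assoc_G)
  have YX: "Y * X = 1\<^sub>m k"
  proof (rule eq_matI)
    fix i j assume "i < dim_row (1\<^sub>m k :: complex mat)" "j < dim_col (1\<^sub>m k :: complex mat)"
    then have ij: "i < k" "j < k" by auto
    have "(Y * X) $$ (i,j) = (\<Sum>a<c. s a * (chi j (r a) * chi i ((r a)\<^sup>T))) / ?N"
      unfolding mult_entry[OF Yc Xc ij] sum_divide_distrib
      by (intro sum.cong) (auto simp: X_def Y_def ij)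
    also have "(\<Sum>a<c. s a * (chi j (r a) * chi i ((r a)\<^sup>T))) = (\<Sum>g\<in>G. chi j g * chi i (g\<^sup>T))"
      unfolding s_def
      by (rule sum_G_classes[symmetric]) (use ij in \<open>simp add: chi_conj chi_conj_T k_def\<close>)
    also have "\<dots> = (if i = j then ?N else 0)" using chi_orthogonal[of j i] ij by (simp add: k_def)
    finally show "(Y * X) $$ (i,j) = 1\<^sub>m k $$ (i,j)" using ij N by simp
  qed (use Xc Yc in auto)
  have XY: "X * Y = 1\<^sub>m c"
  proof (rule eq_matI)
    fix a b assume "a < dim_row (1\<^sub>m c :: complex mat)" "b < dim_col (1\<^sub>m c :: complex mat)"
    then have ab: "a < c" "b < c" by auto
    \<comment> \<open>Column orthogonality is the expansion of the indicator of a single class in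
      irreducible characters.\<close>
    define \<delta> where "\<delta> g = (if g \<in> conj_class (r b) then 1 else (0::complex))" for g
    have \<delta>c: "\<delta> (h * g * h\<^sup>T) = \<delta> g" if "g \<in> G" "h \<in> G" for g h
      using conj_class_conj[OF r[OF ab(2)] that] by (simp add: \<delta>_def)
    have \<delta>r: "\<delta> (r d) = (if d = b then 1 else 0)" if d: "d < c" for d
    proof -
      have "r d \<in> conj_class (r d)" unfolding conj_class_def
        using r[OF d] one_G by (auto intro!: bexI[of _ "1\<^sub>m 3"] simp: one_mult_G mult_one_G)
      then show ?thesis using conj_class_disjoint[OF d ab(2)] by (auto simp: \<delta>_def)
    qed
    have inner: "(\<Sum>g\<in>G. \<delta> g * chi i (g\<^sup>T)) = s b * chi i ((r b)\<^sup>T)" if i: "i < k" for i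
    proof -
      have "(\<Sum>g\<in>G. \<delta> g * chi i (g\<^sup>T)) = (\<Sum>d<c. s d * (\<delta> (r d) * chi i ((r d)\<^sup>T)))"
        unfolding s_def by (rule sum_G_classes) (simp add: \<delta>c chi_conj_T[OF i])
      also have "\<dots> = (\<Sum>d<c. if d = b then s b * chi i ((r b)\<^sup>T) else 0)"
        by (intro sum.cong) (auto simp: \<delta>r)
      finally show ?thesis using ab by simp
    qed
    have "(X * Y) $$ (a,b) = (\<Sum>i<k. (\<Sum>g\<in>G. \<delta> g * chi i (g\<^sup>T)) * chi i (r a)) / ?N"
      unfolding mult_entry[OF Xc Yc ab] sum_divide_distrib
      by (intro sum.cong) (auto simp: X_def Y_def ab inner)
    also have "\<dots> = \<delta> (r a)"
      using class_function_expansion[of \<delta> "r a", OF \<delta>c r[OF ab(1)], symmetric] N by (simp add: k_def)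
    finally show "(X * Y) $$ (a,b) = 1\<^sub>m c $$ (a,b)" using ab by (simp add: \<delta>r)
  qed (use Xc Yc in auto)
  \<comment> \<open>The number of irreducibles equals the number of classes, by comparing the traces
    of the two identity matrices.\<close>
  have "complex_of_nat k = of_nat c" using mtr_comm[OF Xc Yc] unfolding XY YX mtr_one by simp
  then have kc: "k = c" by simp
  \<comment> \<open>The table has complex entries and \<open>Mt\<close> has integer polynomials;
    both are moved to complex polynomials, the table as constants.\<close>
  interpret lift: comm_ring_hom "\<lambda>z :: complex. [:z:]"
    by unfold_locales (auto simp: one_pCons)
  have hom_det: "det (map_mat (map_poly complex_of_int) B) = map_poly of_int (det B)" for B
    by (rule comm_ring_hom.hom_det) unfold_locales
  define X' where "X' = map_mat (\<lambda>z. [:z:]) X"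
  define Y' where "Y' = map_mat (\<lambda>z. [:z:]) Y"
  define A where "A = map_mat (map_poly complex_of_int) (Mt G Rs)"
  have Mc: "Mt G Rs \<in> carrier_mat c c" "M0t G Rs \<in> carrier_mat c c"
    by (simp_all add: Mt_def M0t_def kc[symmetric] k_def)
  have A: "A \<in> carrier_mat c c" and X': "X' \<in> carrier_mat c c" and Y': "Y' \<in> carrier_mat c c"
    using Xc Yc Mc by (simp_all add: A_def X'_def Y'_def kc)
  have XY': "X' * Y' = 1\<^sub>m c"
    unfolding X'_def Y'_def using lift.mat_hom_mult[OF Xc Yc] XY lift.mat_hom_one by simp
  have YX': "Y' * X' = 1\<^sub>m c"
    unfolding X'_def Y'_def using lift.mat_hom_mult[OF Yc Xc] YX lift.mat_hom_one kc by simp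
  have Aij: "poly (A $$ (i,j)) x = (if i = j then 1 - x ^ 3 else 0) + of_nat (McKayB G Rs i j) * (x\<^sup>2 - x)"
    if "i < c" "j < c" for i j x
    using that kc by (simp add: A_def Mt_def k_def McKayBstar_eq_McKayB hom_distribs map_poly_monom
        poly_monom algebra_simps)
  have XA: "X' * A = mat_diag c P * X'"
  proof (rule eq_matI)
    fix a j assume "a < dim_row (mat_diag c P * X')" "j < dim_col (mat_diag c P * X')"
    then have aj: "a < c" "j < c" using X' by (simp_all add: mat_diag_def)
    show "(X' * A) $$ (a,j) = (mat_diag c P * X') $$ (a,j)"
    \<comment> \<open>Complex polynomials with equal values agree, so the identity reduces at each
      \<open>x\<close> to \<open>chi_times_natural\<close>.\<close>
    proof (rule poly_eq_poly_eq_iff[THEN iffD1], rule ext)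
      fix x
      have "poly ((X' * A) $$ (a,j)) x = (\<Sum>i<c. chi i (r a) *
          ((if i = j then 1 - x ^ 3 else 0) + of_nat (McKayB G Rs i j) * (x\<^sup>2 - x)))"
        using X' A aj by (simp add: scalar_prod_def atLeast0LessThan poly_sum Aij X'_def X_def kc)
      also have "\<dots> = (\<Sum>i<c. if i = j then chi j (r a) * (1 - x ^ 3) else 0) +
          (\<Sum>i<c. of_nat (McKayB G Rs i j) * chi i (r a)) * (x\<^sup>2 - x)"
        unfolding sum_distrib_right sum.distrib[symmetric]
        by (intro sum.cong) (auto simp: algebra_simps)
      also have "(\<Sum>i<c. of_nat (McKayB G Rs i j) * chi i (r a)) = chi j (r a) * mtr (r a)"
        using chi_times_natural[of j "r a"] r aj by (simp add: kc[symmetric] k_def)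
      also have "(\<Sum>i<c. if i = j then chi j (r a) * (1 - x ^ 3) else 0) = chi j (r a) * (1 - x ^ 3)"
        using aj by simp
      also have "chi j (r a) * (1 - x ^ 3) + chi j (r a) * mtr (r a) * (x\<^sup>2 - x) = poly (P a) x * chi j (r a)"
        by (simp add: P_def algebra_simps power2_eq_square power3_eq_cube)
      also have "\<dots> = poly ((mat_diag c P * X') $$ (a,j)) x"
        unfolding mat_diag_mult_left[OF X'] using aj by (simp add: X'_def X_def kc)
      finally show "poly ((X' * A) $$ (a,j)) x = poly ((mat_diag c P * X') $$ (a,j)) x" .
    qed
  qed (use X' A in \<open>simp_all add: mat_diag_def\<close>)
  note det = det_diagonalized[OF A X' Y' XY' YX' XA]
  show "map_poly of_int (det (Mt G Rs)) = (\<Prod>a<c. P a)"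
    using det(1) by (simp only: A_def hom_det)
  have P0: "(\<Prod>a<c. P a) \<noteq> 0" by (simp add: P_def)
  have c0: "c > 0" using k0 kc by simp
  have "map_mat (map_poly of_int) (M0t G Rs) =
      mat c c (\<lambda>(i,j). if j = 0 then (if i = 0 then 1 else 0) else A $$ (i,j))"
    using Mc by (intro eq_matI) (auto simp: A_def M0t_def)
  then have "map_poly complex_of_int (det (M0t G Rs)) = (\<Sum>a<c. Y' $$ (0,a) * (\<Prod>b\<in>{..<c} - {a}. P b) * X' $$ (a,0))"
    using det(2)[OF c0 P0] hom_det[of "M0t G Rs"] by simp
  also have "\<dots> = (\<Sum>a<c. [:s a / ?N:] * (\<Prod>b\<in>{..<c} - {a}. P b))"
  proof (intro sum.cong refl)
    fix a assume "a \<in> {..<c}"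
    then have a: "a < c" by simp
    \<comment> \<open>Index 0 is the trivial representation: its column in the table is all ones and
      its row in the inverse lists the relative class sizes, which are the weights of the final
      sum.\<close>
    have triv: "chi 0 g = 1" if "g \<in> G" for g
      using Rs that by (simp add: complete_irreps_def mtr_one)
    have "X' $$ (a,0) = 1" "Y' $$ (0,a) = [:s a / ?N:]"
      using a c0 r[OF a] by (simp_all add: X'_def Y'_def X_def Y_def kc triv transpose_G)
    then show "Y' $$ (0,a) * (\<Prod>b\<in>{..<c} - {a}. P b) * X' $$ (a,0) = [:s a / ?N:] * (\<Prod>b\<in>{..<c} - {a}. P b)"
      by simp
  qed
  finally have "of_nat (card G) * map_poly of_int (det (M0t G Rs)) =
      (\<Sum>a<c. of_nat (card G) * ([:s a / ?N:] * (\<Prod>b\<in>{..<c} - {a}. P b)))"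
    by (simp add: sum_distrib_left)
  also have "\<dots> = (\<Sum>a<c. of_nat (card (conj_class (r a))) * (\<Prod>b\<in>{..<c} - {a}. P b))"
  proof (intro sum.cong refl)
    fix a
    have "of_nat (card G) * [:s a / ?N:] = (of_nat (card (conj_class (r a))) :: complex poly)"
      using N by (simp add: of_nat_poly s_def)
    then show "of_nat (card G) * ([:s a / ?N:] * (\<Prod>b\<in>{..<c} - {a}. P b)) =
      of_nat (card (conj_class (r a))) * (\<Prod>b\<in>{..<c} - {a}. P b)" by (simp only: mult.assoc[symmetric])
  qed
  finally show "of_nat (card G) * map_poly of_int (det (M0t G Rs)) =
      (\<Sum>a<c. of_nat (card (conj_class (r a))) * (\<Prod>b\<in>{..<c} - {a}. P b))" .
qed

end
end
end

section \<open>Exact arithmetic with matrices over the golden field\<close>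

text \<open>The pair \<open>(a, b)\<close> stands for \<open>a + b \<cdot> golden\<close>. A \<open>zmat\<close> is a matrix of rows that carries a
  global factor \<open>1/2\<close>, which is the common denominator of the icosahedral rotations.\<close>

type_synonym zphi = "int \<times> int"
type_synonym zvec = "zphi \<times> zphi \<times> zphi"
type_synonym zmat = "zvec \<times> zvec \<times> zvec"

fun zadd :: "zphi \<Rightarrow> zphi \<Rightarrow> zphi" where "zadd (a,b) (c,d) = (a + c, b + d)"
fun zsub :: "zphi \<Rightarrow> zphi \<Rightarrow> zphi" where "zsub (a,b) (c,d) = (a - c, b - d)"
text \<open>Multiplication reduced by \<open>golden * golden = golden + 1\<close>.\<close>

fun zmul :: "zphi \<Rightarrow> zphi \<Rightarrow> zphi" where "zmul (a,b) (c,d) = (a * c + b * d, a * d + b * c + b * d)"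

fun zdot :: "zvec \<Rightarrow> zvec \<Rightarrow> zphi" where
  "zdot (a,b,c) (x,y,z) = zadd (zmul a x) (zadd (zmul b y) (zmul c z))"

fun ztr :: "zmat \<Rightarrow> zmat" where
  "ztr ((a,b,c),(d,e,f),(g,h,i)) = ((a,d,g),(b,e,h),(c,f,i))"

fun zapply :: "zmat \<Rightarrow> zvec \<Rightarrow> zvec" where
  "zapply (r,s,t) v = (zdot r v, zdot s v, zdot t v)"

text \<open>Multiplies \<open>A\<close> by the transpose of the second argument, whose rows serve
  directly as columns; orthogonality is then the value of \<open>zmult_tr A A\<close>.\<close>

fun zmult_tr :: "zmat \<Rightarrow> zmat \<Rightarrow> zmat" where
  "zmult_tr A (u,v,w) = ztr (zapply A u, zapply A v, zapply A w)"

text \<open>Numerators only: a product of two halves carries the factor 1/4. Two products can be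
  compared directly, but comparing a product with a \<open>zmat\<close> needs
  \<open>zdouble\<close>.\<close>

definition zmult :: "zmat \<Rightarrow> zmat \<Rightarrow> zmat" where
  "zmult A B = zmult_tr A (ztr B)"

fun zscale :: "zphi \<Rightarrow> zvec \<Rightarrow> zvec" where
  "zscale k (a,b,c) = (zmul k a, zmul k b, zmul k c)"

fun zdouble :: "zmat \<Rightarrow> zmat" where
  "zdouble (r,s,t) = (zscale (2,0) r, zscale (2,0) s, zscale (2,0) t)"

fun zdet :: "zmat \<Rightarrow> zphi" where
  "zdet ((a,b,c),(d,e,f),(g,h,i)) =
    zadd (zsub (zmul a (zsub (zmul e i) (zmul f h))) (zmul b (zsub (zmul d i) (zmul f g))))
      (zmul c (zsub (zmul d h) (zmul e g)))"

fun vadd :: "zvec \<Rightarrow> zvec \<Rightarrow> zvec" where "vadd (a,b,c) (x,y,z) = (zadd a x, zadd b y, zadd c z)"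
fun vsub :: "zvec \<Rightarrow> zvec \<Rightarrow> zvec" where "vsub (a,b,c) (x,y,z) = (zsub a x, zsub b y, zsub c z)"

definition zone :: zmat where
  "zone = (((2,0),(0,0),(0,0)),((0,0),(2,0),(0,0)),((0,0),(0,0),(2,0)))"

text \<open>Both constants clear denominators: \<open>zdouble zone\<close> is the identity over 4,
  and 8 is the cube of the common denominator 2.\<close>

definition z_rotation :: "zmat \<Rightarrow> bool" where
  "z_rotation A \<longleftrightarrow> zmult_tr A A = zdouble zone \<and> zdet A = (8,0)"

definition cube_zvertices :: "zvec list" where
  "cube_zvertices = [((a,0),(b,0),(c,0)). a \<leftarrow> [1,-1], b \<leftarrow> [1,-1], c \<leftarrow> [1,-1]]"

definition icosa_zvertices :: "zvec list" where
  "icosa_zvertices = [((0,0),(a,0),(0,b)). a \<leftarrow> [1,-1], b \<leftarrow> [1,-1]] @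
    [((a,0),(0,b),(0,0)). a \<leftarrow> [1,-1], b \<leftarrow> [1,-1]] @
    [((0,b),(0,0),(a,0)). a \<leftarrow> [1,-1], b \<leftarrow> [1,-1]]"

text \<open>The linear map that sends three fixed vertices to \<open>u\<close>, \<open>v\<close>, \<open>w\<close>; in both cases the first two
  vertices span an edge of length 2.\<close>

fun cube_frame :: "zvec \<Rightarrow> zvec \<Rightarrow> zvec \<Rightarrow> zmat" where
  "cube_frame u v w = ztr (vadd v w, vsub u w, vsub u v)"

fun icosa_frame :: "zvec \<Rightarrow> zvec \<Rightarrow> zvec \<Rightarrow> zmat" where
  "icosa_frame u v w = ztr (vsub (zscale (2,0) w) (zscale (0,1) (vsub u v)), vsub u v, zscale (-1,1) (vadd u v))"

text \<open>Prunes the search: the first two reference vertices have distance 2, so their images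
  under a rotation must too.\<close>

definition z_edge :: "zvec \<times> zvec \<Rightarrow> bool" where
  "z_edge = (\<lambda>(u,v). zdot (vsub u v) (vsub u v) = (4,0))"

definition z_frames :: "(zvec \<Rightarrow> zvec \<Rightarrow> zvec \<Rightarrow> zmat) \<Rightarrow> zvec list \<Rightarrow> zmat list" where
  "z_frames F V = filter z_rotation [F u v w. (u,v) \<leftarrow> filter z_edge (List.product V V), w \<leftarrow> V]"

text \<open>The factor 2 balances the denominator of \<open>A\<close>, since \<open>zapply\<close>
  works with numerators while vertices have none.\<close>

definition z_preserves :: "zvec list \<Rightarrow> zmat \<Rightarrow> bool" where
  "z_preserves V A \<longleftrightarrow> list_all (\<lambda>v. list_ex (\<lambda>w. zapply A v = zscale (2,0) w) V) V"

text \<open>A witness \<open>(i, a)\<close> says that \<open>L ! i\<close> conjugates \<open>A\<close> to the representative \<open>L ! (R ! a)\<close> of class \<open>a\<close>.\<close>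

definition z_conjugate_to :: "zmat list \<Rightarrow> nat list \<Rightarrow> zmat \<Rightarrow> nat \<times> nat \<Rightarrow> bool" where
  "z_conjugate_to L R A = (\<lambda>(i,a). zmult (L ! i) A = zmult (L ! (R ! a)) (L ! i))"

definition z_nonconjugate :: "zmat list \<Rightarrow> zmat \<Rightarrow> zmat \<Rightarrow> bool" where
  "z_nonconjugate L A B \<longleftrightarrow> list_all (\<lambda>h. zmult h A \<noteq> zmult B h) L"

section \<open>Matrices of size 3 by their nine entries\<close>

definition mat3 :: "complex \<Rightarrow> complex \<Rightarrow> complex \<Rightarrow> complex \<Rightarrow> complex \<Rightarrow> complex \<Rightarrow> complex \<Rightarrow> complex \<Rightarrow> complex
    \<Rightarrow> complex mat" where
  "mat3 a b c d e f g h i = mat 3 3 (\<lambda>(k,l). [[a,b,c],[d,e,f],[g,h,i]] ! k ! l)"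

lemma mat3_carrier [simp]: "mat3 a b c d e f g h i \<in> carrier_mat 3 3"
  by (simp add: mat3_def)

lemma less_3_cases: "(i::nat) < 3 \<Longrightarrow> i = 0 \<or> i = 1 \<or> i = 2"
  by auto

lemma mat3_index:
  "mat3 a b c d e f g h i $$ (0,0) = a" "mat3 a b c d e f g h i $$ (0,Suc 0) = b"
  "mat3 a b c d e f g h i $$ (0,2) = c" "mat3 a b c d e f g h i $$ (Suc 0,0) = d"
  "mat3 a b c d e f g h i $$ (Suc 0,Suc 0) = e" "mat3 a b c d e f g h i $$ (Suc 0,2) = f"
  "mat3 a b c d e f g h i $$ (2,0) = g" "mat3 a b c d e f g h i $$ (2,Suc 0) = h"
  "mat3 a b c d e f g h i $$ (2,2) = i"
  by (simp_all add: mat3_def)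

lemma eq_mat3I:
  assumes "A \<in> carrier_mat 3 3"
    "A $$ (0,0) = a" "A $$ (0,1) = b" "A $$ (0,2) = c" "A $$ (1,0) = d" "A $$ (1,1) = e" "A $$ (1,2) = f"
    "A $$ (2,0) = g" "A $$ (2,1) = h" "A $$ (2,2) = i"
  shows "A = mat3 a b c d e f g h i"
proof (rule eq_matI)
  fix k l assume "k < dim_row (mat3 a b c d e f g h i)" "l < dim_col (mat3 a b c d e f g h i)"
  then have "k < 3" "l < 3" by (simp_all add: mat3_def)
  then show "A $$ (k,l) = mat3 a b c d e f g h i $$ (k,l)"
    using assms(2-) by (auto dest!: less_3_cases simp: mat3_index)
qed (use assms(1) in \<open>auto simp: mat3_def\<close>)

lemma mat3_eq_iff:
  "mat3 a b c d e f g h i = mat3 a' b' c' d' e' f' g' h' i' \<longleftrightarrow>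
    a = a' \<and> b = b' \<and> c = c' \<and> d = d' \<and> e = e' \<and> f = f' \<and> g = g' \<and> h = h' \<and> i = i'"
  by (metis mat3_index)

lemma sum_lessThan_3: "(\<Sum>k<(3::nat). F k) = F 0 + F 1 + (F 2 :: complex)"
  by (simp add: numeral_3_eq_3 numeral_2_eq_2)

lemma mat3_mult:
  "mat3 a b c d e f g h i * mat3 a' b' c' d' e' f' g' h' i' =
    mat3 (a*a' + b*d' + c*g') (a*b' + b*e' + c*h') (a*c' + b*f' + c*i')
         (d*a' + e*d' + f*g') (d*b' + e*e' + f*h') (d*c' + e*f' + f*i')
         (g*a' + h*d' + i*g') (g*b' + h*e' + i*h') (g*c' + h*f' + i*i')"
  by (rule eq_mat3I, rule mult_carrier_mat[OF mat3_carrier mat3_carrier])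
    (simp_all add: mult_entry[OF mat3_carrier mat3_carrier] sum_lessThan_3 mat3_index del: index_mult_mat)

lemma mat3_transpose: "(mat3 a b c d e f g h i)\<^sup>T = mat3 a d g b e h c f i"
  by (rule eq_mat3I) (simp_all add: mat3_index carrier_matD[OF mat3_carrier])

lemma mat3_one: "1\<^sub>m 3 = mat3 1 0 0 0 1 0 0 0 1"
  by (rule eq_mat3I) simp_all

lemma det_2x2:
  assumes A: "(A :: complex mat) \<in> carrier_mat 2 2"
  shows "det A = A $$ (0,0) * A $$ (1,1) - A $$ (0,1) * A $$ (1,0)"
proof -
  have "det A = (\<Sum>j<2. A $$ (0,j) * cofactor A 0 j)" by (rule laplace_expansion_row[OF A]) simp
  also have "\<dots> = A $$ (0,0) * cofactor A 0 0 + A $$ (0,1) * cofactor A 0 1" by (simp add: numeral_2_eq_2)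
  finally have e: "det A = A $$ (0,0) * cofactor A 0 0 + A $$ (0,1) * cofactor A 0 1" .
  have d: "mat_delete A 0 j \<in> carrier_mat 1 1" for j using A by (simp add: mat_delete_def)
  show ?thesis unfolding e cofactor_def det_single[OF d] using A by (simp add: mat_delete_def)
qed

lemma mat3_det: "det (mat3 a b c d e f g h i) = a * (e * i - f * h) - b * (d * i - f * g) + c * (d * h - e * g)"
proof -
  let ?A = "mat3 a b c d e f g h i"
  have d: "mat_delete ?A 0 j \<in> carrier_mat 2 2" for j
    by (simp add: mat_delete_def carrier_matD[OF mat3_carrier])
  have "det ?A = (\<Sum>j<3. ?A $$ (0,j) * cofactor ?A 0 j)"
    by (rule laplace_expansion_row[OF mat3_carrier]) simp
  then show ?thesis
    unfolding sum_lessThan_3 cofactor_def det_2x2[OF d]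
    by (simp add: mat_delete_def carrier_matD[OF mat3_carrier] mat3_index numeral_2_eq_2[symmetric] algebra_simps)
qed

lemma mat3_apply:
  "mat3 a b c d e f g h i *\<^sub>v vec_of_list [x,y,z] = vec_of_list [a*x + b*y + c*z, d*x + e*y + f*z, g*x + h*y + i*z]"
proof (rule eq_vecI)
  have v: "vec_of_list [x,y,z] \<in> carrier_vec 3" by (rule carrier_vecI) simp
  fix k assume "k < dim_vec (vec_of_list [a*x + b*y + c*z, d*x + e*y + f*z, g*x + h*y + i*z])"
  then have k: "k < 3" by simp
  show "(mat3 a b c d e f g h i *\<^sub>v vec_of_list [x,y,z]) $ k =
    vec_of_list [a*x + b*y + c*z, d*x + e*y + f*z, g*x + h*y + i*z] $ k"
    unfolding mult_vec_entry[OF mat3_carrier v k] sum_lessThan_3 vec_of_list_index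
    using less_3_cases[OF k] by (elim disjE) (simp_all add: mat3_index)
qed (simp add: mat3_def)

lemma vec3_eq_iff: "vec_of_list [x,y,z] = vec_of_list [x',y',z'] \<longleftrightarrow> x = x' \<and> y = y' \<and> z = (z' :: complex)"
  by (metis list.inject list_vec)

lemma mat3_exhaust:
  assumes "A \<in> carrier_mat 3 3"
  obtains a b c d e f g h i where "A = mat3 a b c d e f g h i"
  using eq_mat3I[OF assms refl refl refl refl refl refl refl refl refl] that by blast

section \<open>The golden field and the meaning of the integer encoding\<close>

lemma golden_square: "golden * golden = golden + 1"
proof -
  have "complex_of_real (sqrt 5) * complex_of_real (sqrt 5) = 5"
    by (metis of_real_mult of_real_numeral real_sqrt_mult_self abs_numeral)
  then show ?thesis by (simp add: golden_def field_simps)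
qed

text \<open>The reduction rule in right-nested form, as needed after \<open>algebra_simps\<close>
  has sorted the factors.\<close>

lemma golden_mult_left: "golden * (golden * x) = golden * x + x"
  using golden_square by (metis distrib_right mult.assoc mult_1)

lemma golden_real: "golden \<in> \<real>"
  by (simp add: golden_def)

fun zval :: "zphi \<Rightarrow> complex" where
  "zval (a,b) = of_int a + of_int b * golden"

lemma zval_add: "zval (zadd x y) = zval x + zval y"
  by (cases x; cases y) (simp add: algebra_simps)

lemma zval_sub: "zval (zsub x y) = zval x - zval y"
  by (cases x; cases y) (simp add: algebra_simps)

lemma zval_mul: "zval (zmul x y) = zval x * zval y"
proof (cases x; cases y)
  fix a b c d assume "x = (a,b)" "y = (c,d)"
  moreover have "zval (a,b) * zval (c,d) = of_int (a * c) + of_int (a * d + b * c) * golden + of_int (b * d) * (golden * golden)"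
    by (simp add: algebra_simps)
  ultimately show ?thesis by (simp add: golden_square algebra_simps)
qed

lemmas zval_arith = zval_add zval_sub zval_mul

lemma zval_real: "zval x \<in> \<real>"
  by (cases x) (simp add: golden_real)

text \<open>Irrationality of sqrt 5 over the integers: after division by the gcd, 5 would divide
  both coprime parts.\<close>

lemma square_eq_5_square: "p * p = 5 * (q * q) \<Longrightarrow> q = 0" for p q :: int
proof (rule ccontr)
  assume eq: "p * p = 5 * (q * q)" and q: "q \<noteq> 0"
  have p5: "prime (5 :: int)" by (simp add: prime_int_numeral_eq)
  define g where "g = gcd p q"
  define p' q' where "p' = p div g" and "q' = q div g"
  have pq: "p = g * p'" "q = g * q'" by (simp_all add: g_def p'_def q'_def)
  have cop: "coprime p' q'" unfolding p'_def q'_def g_def by (rule div_gcd_coprime) (use q in simp)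
  have g: "g \<noteq> 0" using q by (simp add: g_def)
  have "g * g * (p' * p') = (g * p') * (g * p')" by (simp only: mult_ac)
  also have "\<dots> = 5 * ((g * q') * (g * q'))" unfolding pq[symmetric] by (rule eq)
  also have "\<dots> = g * g * (5 * (q' * q'))" by (simp only: mult_ac)
  finally have "g * g * (p' * p') = g * g * (5 * (q' * q'))" .
  then have eq': "p' * p' = 5 * (q' * q')" using g by simp
  then have "5 dvd p' * p'" by (rule dvdI)
  then have d: "5 dvd p'" using prime_dvd_mult_iff[OF p5] by blast
  then obtain r where r: "p' = 5 * r" by (rule dvdE)
  have "q' * q' = 5 * (r * r)" using eq' unfolding r by simp
  then have "5 dvd q' * q'" by (rule dvdI)
  then have "5 dvd q'" using prime_dvd_mult_iff[OF p5] by blast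
  then have "5 dvd (1::int)" by (rule coprime_common_divisor[OF cop d])
  then show False by simp
qed

text \<open>Lets equality and inequality of complex matrices be decided on integer tuples;
  nonconjugacy and distinctness of group elements depend on the inequalities.\<close>

lemma zval_inj: "zval x = zval y \<longleftrightarrow> x = y"
proof
  assume eq: "zval x = zval y"
  obtain a b where x: "x = (a,b)" by (cases x)
  obtain c d where y: "y = (c,d)" by (cases y)
  have "of_int (a - c) + of_int (b - d) * golden = 0" using eq by (simp add: x y algebra_simps)
  \<comment> \<open>Multiplying by 2 and inserting the definition of \<open>golden\<close> gives an
    integer plus an integer multiple of sqrt 5, ready for squaring.\<close>
  then have "complex_of_real (of_int (2 * (a - c) + (b - d)) + of_int (b - d) * sqrt 5) = 0"
    by (simp add: golden_def field_simps)
  then have s: "real_of_int (2 * (a - c) + (b - d)) = - of_int (b - d) * sqrt 5"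
    unfolding of_real_eq_0_iff by linarith
  have "real_of_int ((2 * (a - c) + (b - d)) * (2 * (a - c) + (b - d))) = of_int (5 * ((b - d) * (b - d)))"
  proof -
    have "- x * sqrt 5 * (- x * sqrt 5) = 5 * (x * x)" for x :: real
      by (simp add: algebra_simps)
    then show ?thesis by (simp only: of_int_mult s of_int_numeral)
  qed
  then have "(2 * (a - c) + (b - d)) * (2 * (a - c) + (b - d)) = 5 * ((b - d) * (b - d))"
    unfolding of_int_eq_iff .
  from square_eq_5_square[OF this] have "b = d" by simp
  moreover then have "a = c" using eq by (simp add: x y)
  ultimately show "x = y" by (simp add: x y)
qed simp

fun zvec_val :: "zvec \<Rightarrow> complex vec" where
  "zvec_val (a,b,c) = vec_of_list [zval a, zval b, zval c]"

fun zmat_val :: "zmat \<Rightarrow> complex mat" where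
  "zmat_val ((a,b,c),(d,e,f),(g,h,i)) = mat3 (zval a / 2) (zval b / 2) (zval c / 2)
     (zval d / 2) (zval e / 2) (zval f / 2) (zval g / 2) (zval h / 2) (zval i / 2)"

lemma zmat_exhaust: obtains a b c d e f g h i where "A = (((a,b,c),(d,e,f),(g,h,i)) :: zmat)"
  by (metis prod.collapse)

lemma zmat_val_carrier: "zmat_val A \<in> carrier_mat 3 3"
  by (cases A rule: zmat_exhaust) simp

lemma zmat_val_inj: "zmat_val A = zmat_val B \<longleftrightarrow> A = B"
  by (cases A rule: zmat_exhaust; cases B rule: zmat_exhaust) (simp add: mat3_eq_iff zval_inj)

lemma zmat_val_transpose: "(zmat_val A)\<^sup>T = zmat_val (ztr A)"
  by (cases A rule: zmat_exhaust) (simp add: mat3_transpose)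

text \<open>The value of a numerator matrix over the denominator 4, the one that products of two
  \<open>zmat\<close> values have.\<close>

fun zmat_quarter :: "zmat \<Rightarrow> complex mat" where
  "zmat_quarter ((a,b,c),(d,e,f),(g,h,i)) = mat3 (zval a / 4) (zval b / 4) (zval c / 4)
     (zval d / 4) (zval e / 4) (zval f / 4) (zval g / 4) (zval h / 4) (zval i / 4)"

lemma zmat_quarter_inj: "zmat_quarter A = zmat_quarter B \<longleftrightarrow> A = B"
  by (cases A rule: zmat_exhaust; cases B rule: zmat_exhaust) (simp add: mat3_eq_iff zval_inj)

lemma zval_numeral: "zval (numeral k, 0) = numeral k" "zval (1,0) = 1" "zval (0,0) = 0" "zval (-1,0) = -1"
  "zval (0,1) = golden" "zval (-1,1) = golden - 1"
  by simp_all

lemma zmat_quarter_double: "zmat_quarter (zdouble A) = zmat_val A"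
  by (cases A rule: zmat_exhaust) (simp add: mat3_eq_iff zval_arith zval_numeral del: zval.simps)

lemma zmat_val_mult_tr: "zmat_val A * zmat_val (ztr B) = zmat_quarter (zmult_tr A B)"
  by (cases A rule: zmat_exhaust; cases B rule: zmat_exhaust)
    (simp add: mat3_mult mat3_eq_iff zval_arith add_divide_distrib del: zval.simps)

lemma ztr_ztr: "ztr (ztr A) = A"
  by (cases A rule: zmat_exhaust) simp

lemma zmat_val_mult: "zmat_val A * zmat_val B = zmat_quarter (zmult A B)"
  using zmat_val_mult_tr[of A "ztr B"] by (simp add: ztr_ztr zmult_def)

lemma zmat_val_one: "zmat_val zone = 1\<^sub>m 3"
  by (simp add: zone_def mat3_one mat3_eq_iff)

lemma zmat_val_det: "det (zmat_val A) = zval (zdet A) / 8"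
  by (cases A rule: zmat_exhaust) (simp add: mat3_det zval_arith field_simps del: zval.simps)

lemma z_rotation_iff:
  "z_rotation A \<longleftrightarrow> zmat_val A * (zmat_val A)\<^sup>T = 1\<^sub>m 3 \<and> det (zmat_val A) = 1"
proof -
  have "zmat_val A * (zmat_val A)\<^sup>T = 1\<^sub>m 3 \<longleftrightarrow> zmat_quarter (zmult_tr A A) = zmat_quarter (zdouble zone)"
    unfolding zmat_val_transpose zmat_val_mult_tr zmat_quarter_double zmat_val_one ..
  moreover have "det (zmat_val A) = 1 \<longleftrightarrow> zval (zdet A) = zval (8,0)"
    by (auto simp: zmat_val_det)
  ultimately show ?thesis unfolding z_rotation_def zmat_quarter_inj zval_inj by simp
qed

lemma zmat_val_apply: "zapply A v = zscale (2,0) w \<Longrightarrow> zmat_val A *\<^sub>v zvec_val v = zvec_val w"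
proof -
  assume eq: "zapply A v = zscale (2,0) w"
  obtain x y z where v: "v = (x,y,z)" by (cases v)
  obtain x' y' z' where w: "w = (x',y',z')" by (cases w)
  obtain a b c d e f g h i where A: "A = ((a,b,c),(d,e,f),(g,h,i))" by (rule zmat_exhaust)
  have "zval (zdot (a,b,c) v) = zval (zmul (2,0) x')" "zval (zdot (d,e,f) v) = zval (zmul (2,0) y')"
    "zval (zdot (g,h,i) v) = zval (zmul (2,0) z')"
    using eq by (simp_all add: A w)
  then show ?thesis
    by (simp add: A v w mat3_apply vec3_eq_iff zval_arith zval_numeral field_simps del: zval.simps vec_of_list_Cons)
qed

lemma zmat_val_entries_real:
  assumes "i < 3" "j < 3"
  shows "zmat_val A $$ (i,j) \<in> \<real>"
proof -
  obtain a b c d e f g h k where A: "A = ((a,b,c),(d,e,f),(g,h,k))" by (rule zmat_exhaust)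
  show ?thesis
    using less_3_cases[OF assms(1)] less_3_cases[OF assms(2)]
    by (elim disjE) (simp_all add: A mat3_index zval_real del: zval.simps)
qed

lemma zvec_val_carrier: "zvec_val v \<in> carrier_vec 3"
  by (cases v) (simp add: carrier_vecI)

section \<open>Rotation groups of finite vertex sets\<close>

lemma rotation_groupD:
  assumes "g \<in> rotation_group V"
  shows "g \<in> carrier_mat 3 3" "\<And>i j. i < 3 \<Longrightarrow> j < 3 \<Longrightarrow> g $$ (i,j) \<in> \<real>" "g * g\<^sup>T = 1\<^sub>m 3" "det g = 1"
    "\<And>v. v \<in> V \<Longrightarrow> g *\<^sub>v v \<in> V"
  using assms by (auto simp: rotation_group_def)

lemma rotation_groupI:
  assumes "g \<in> carrier_mat 3 3" "\<And>i j. i < 3 \<Longrightarrow> j < 3 \<Longrightarrow> g $$ (i,j) \<in> \<real>" "g * g\<^sup>T = 1\<^sub>m 3" "det g = 1"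
    "\<And>v. v \<in> V \<Longrightarrow> g *\<^sub>v v \<in> V"
  shows "g \<in> rotation_group V"
  using assms by (auto simp: rotation_group_def)

text \<open>The definition only asks that \<open>g\<close> map \<open>V\<close> into itself. Since
  \<open>V\<close> is finite and \<open>g\<close> injective, it permutes \<open>V\<close>, and so
  does the transpose; this gives closure under inverses.\<close>

lemma rotation_group_finite_orthogonal:
  assumes V: "finite V" "V \<subseteq> carrier_vec 3" and fin: "finite (rotation_group V)"
  shows "finite_orthogonal_group (rotation_group V)"
proof
  let ?G = "rotation_group V"
  note D = rotation_groupD
  have Tc: "g\<^sup>T \<in> carrier_mat 3 3" if "g \<in> ?G" for g using D(1)[OF that] by simp
  have left: "g\<^sup>T * g = 1\<^sub>m 3" if g: "g \<in> ?G" for g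
    by (rule mat_mult_left_right_inverse[OF D(1)[OF g] Tc[OF g] D(3)[OF g]])
  show "finite ?G" by (rule fin)
  show "g \<in> carrier_mat 3 3" if "g \<in> ?G" for g by (rule D(1)[OF that])
  show "g * g\<^sup>T = 1\<^sub>m 3" if "g \<in> ?G" for g by (rule D(3)[OF that])
  show "1\<^sub>m 3 \<in> ?G"
  proof (rule rotation_groupI)
    show "1\<^sub>m 3 *\<^sub>v v \<in> V" if "v \<in> V" for v using that V(2) by (simp add: one_mult_mat_vec[OF subsetD[OF V(2)]])
  qed simp_all
  show "g * h \<in> ?G" if g: "g \<in> ?G" and h: "h \<in> ?G" for g h
  proof (rule rotation_groupI)
    note gc = D(1)[OF g] and hc = D(1)[OF h]
    show "g * h \<in> carrier_mat 3 3" by (rule mult_carrier_mat[OF gc hc])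
    show "(g * h) $$ (i,j) \<in> \<real>" if "i < 3" "j < 3" for i j
      unfolding mult_entry[OF gc hc that]
      by (intro sum_in_Reals Reals_mult D(2)[OF g] D(2)[OF h]) (use that in simp_all)
    have "(g * h) * (g * h)\<^sup>T = g * h * (h\<^sup>T * g\<^sup>T)" unfolding transpose_mult[OF gc hc] ..
    also have "\<dots> = g * (h * (h\<^sup>T * g\<^sup>T))"
      by (rule assoc_mult_mat[OF gc hc mult_carrier_mat[OF Tc[OF h] Tc[OF g]]])
    also have "h * (h\<^sup>T * g\<^sup>T) = g\<^sup>T"
      unfolding assoc_mult_mat[OF hc Tc[OF h] Tc[OF g], symmetric] D(3)[OF h] by (rule left_mult_one_mat[OF Tc[OF g]])
    finally show "(g * h) * (g * h)\<^sup>T = 1\<^sub>m 3" using D(3)[OF g] by simp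
    show "det (g * h) = 1" using det_mult[OF gc hc] D(4)[OF g] D(4)[OF h] by simp
    show "(g * h) *\<^sub>v v \<in> V" if v: "v \<in> V" for v
      unfolding assoc_mult_mat_vec[OF gc hc subsetD[OF V(2) v]] by (rule D(5)[OF g D(5)[OF h v]])
  qed
  show "g\<^sup>T \<in> ?G" if g: "g \<in> ?G" for g
  proof (rule rotation_groupI)
    note gc = D(1)[OF g]
    show "g\<^sup>T \<in> carrier_mat 3 3" by (rule Tc[OF g])
    show "g\<^sup>T $$ (i,j) \<in> \<real>" if "i < 3" "j < 3" for i j using D(2)[OF g] gc that by simp
    show "g\<^sup>T * (g\<^sup>T)\<^sup>T = 1\<^sub>m 3" using left[OF g] by simp
    show "det (g\<^sup>T) = 1" using det_transpose[OF gc] D(4)[OF g] by simp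
    have cancel: "g\<^sup>T *\<^sub>v (g *\<^sub>v w) = w" if w: "w \<in> V" for w
      using assoc_mult_mat_vec[OF Tc[OF g] gc subsetD[OF V(2) w]] subsetD[OF V(2) w] left[OF g] by simp
    have "inj_on ((*\<^sub>v) g) V" by (rule inj_on_inverseI[of _ "(*\<^sub>v) (g\<^sup>T)"]) (rule cancel)
    moreover have "(*\<^sub>v) g ` V \<subseteq> V" by (rule image_subsetI) (rule D(5)[OF g])
    ultimately have onto: "(*\<^sub>v) g ` V = V" using endo_inj_surj[OF V(1)] by blast
    show "g\<^sup>T *\<^sub>v v \<in> V" if "v \<in> V" for v
    proof -
      have "v \<in> (*\<^sub>v) g ` V" using that onto by simp
      then obtain w where "w \<in> V" "v = g *\<^sub>v w" by (rule imageE)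
      then show ?thesis using cancel by simp
    qed
  qed
qed

text \<open>\<open>z_rotation\<close> tests the rows; orthonormality of the columns follows because
  a one-sided inverse of a square matrix is two-sided. The numerators of a unit column have squared
  length 4.\<close>

lemma z_rotation_columns:
  assumes "z_rotation (ztr (x,y,z))"
  shows "zdot y y = (4,0)" "zdot z z = (4,0)"
proof -
  let ?A = "ztr (x,y,z)"
  have o: "zmat_val ?A * (zmat_val ?A)\<^sup>T = 1\<^sub>m 3" using assms z_rotation_iff by blast
  have "(zmat_val ?A)\<^sup>T * zmat_val ?A = 1\<^sub>m 3"
    by (rule mat_mult_left_right_inverse[OF zmat_val_carrier _ o]) (simp add: zmat_val_carrier)
  then have "zmat_val (x,y,z) * zmat_val (ztr (x,y,z)) = zmat_val zone"
    unfolding zmat_val_transpose ztr_ztr zmat_val_one .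
  then have "zmult_tr (x,y,z) (x,y,z) = zdouble zone"
    unfolding zmat_val_mult_tr zmat_quarter_double[of zone, symmetric] zmat_quarter_inj .
  then show "zdot y y = (4,0)" "zdot z z = (4,0)" by (simp_all add: zone_def)
qed

text \<open>An element of the group is recovered from the images of three vertices, hence occurs
  among the candidates, and \<open>edge\<close> guarantees that the pruning does not lose it.
  Conversely, every surviving candidate was checked to preserve the vertices.\<close>

lemma rotation_group_eq_frames:
  assumes V: "V = zvec_val ` set Z"
    and base: "u0 \<in> set Z" "v0 \<in> set Z" "w0 \<in> set Z"
    and frame: "\<And>g u v w. g \<in> carrier_mat 3 3 \<Longrightarrow> g *\<^sub>v zvec_val u0 = zvec_val u \<Longrightarrow>
      g *\<^sub>v zvec_val v0 = zvec_val v \<Longrightarrow> g *\<^sub>v zvec_val w0 = zvec_val w \<Longrightarrow> g = zmat_val (F u v w)"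
    and edge: "\<And>u v w. z_rotation (F u v w) \<Longrightarrow> z_edge (u,v)"
    and preserves: "list_all (z_preserves Z) (z_frames F Z)"
  shows "rotation_group V = zmat_val ` set (z_frames F Z)"
proof (intro equalityI subsetI)
  fix g assume g: "g \<in> rotation_group V"
  note D = rotation_groupD[OF g]
  have ex: "\<exists>u'\<in>set Z. g *\<^sub>v zvec_val u = zvec_val u'" if "u \<in> set Z" for u
  proof -
    have "g *\<^sub>v zvec_val u \<in> zvec_val ` set Z" using D(5)[of "zvec_val u"] that unfolding V by blast
    then show ?thesis by (auto elim!: imageE)
  qed
  obtain u v w where uvw: "u \<in> set Z" "v \<in> set Z" "w \<in> set Z" "g *\<^sub>v zvec_val u0 = zvec_val u"
    "g *\<^sub>v zvec_val v0 = zvec_val v" "g *\<^sub>v zvec_val w0 = zvec_val w"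
    using ex[OF base(1)] ex[OF base(2)] ex[OF base(3)] by blast
  have gF: "g = zmat_val (F u v w)" by (rule frame[OF D(1) uvw(4-6)])
  have "z_rotation (F u v w)" using D(3,4) unfolding z_rotation_iff gF by simp
  moreover have "(u,v) \<in> set (filter z_edge (List.product Z Z))"
    using edge[OF calculation] uvw(1,2) by simp
  then have "F u v w \<in> (\<Union>p\<in>set (filter z_edge (List.product Z Z)). set (case p of (u,v) \<Rightarrow> map (F u v) Z))"
    by (rule UN_I) (simp add: uvw(3))
  ultimately have "F u v w \<in> set (z_frames F Z)"
    by (simp only: z_frames_def set_filter set_concat set_map mem_Collect_eq image_image)
  then show "g \<in> zmat_val ` set (z_frames F Z)" unfolding gF by (rule imageI)
next
  fix g assume "g \<in> zmat_val ` set (z_frames F Z)"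
  then obtain A where A: "A \<in> set (z_frames F Z)" "g = zmat_val A" by (rule imageE)
  then have rot: "z_rotation A" by (simp add: z_frames_def)
  have pres: "z_preserves Z A" using preserves A(1) by (simp add: list_all_iff)
  show "g \<in> rotation_group V"
  proof (rule rotation_groupI)
    show "g \<in> carrier_mat 3 3" unfolding A(2) by (rule zmat_val_carrier)
    show "g $$ (i,j) \<in> \<real>" if "i < 3" "j < 3" for i j unfolding A(2) by (rule zmat_val_entries_real[OF that])
    show "g * g\<^sup>T = 1\<^sub>m 3" "det g = 1" using rot unfolding A(2) z_rotation_iff by simp_all
    fix v assume "v \<in> V"
    then obtain u where u: "u \<in> set Z" "v = zvec_val u" unfolding V by (rule imageE)
    then obtain w where "w \<in> set Z" "zapply A u = zscale (2,0) w"
      using pres by (auto simp: z_preserves_def list_all_iff list_ex_iff)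
    then show "g *\<^sub>v v \<in> V" unfolding A(2) u(2) V using zmat_val_apply by simp
  qed
qed

lemma mtr_zmat_val: "mtr (zmat_val ((a,b,c),(d,e,f),(g,h,i))) = (zval a + zval e + zval i) / 2"
  by (simp add: mtr_def sum_lessThan_3 carrier_matD[OF mat3_carrier] mat3_index add_divide_distrib del: zval.simps)

section \<open>The tetrahedral, octahedral and icosahedral groups\<close>

text \<open>Arranged by cosets: the four sign matrices, then their products with \<open>cyc3\<close>
  (index 4) and with its square (index 8).\<close>

definition tetra_list :: "zmat list" where
  "tetra_list = [
    (((2,0),(0,0),(0,0)),((0,0),(2,0),(0,0)),((0,0),(0,0),(2,0))),
    (((2,0),(0,0),(0,0)),((0,0),(-2,0),(0,0)),((0,0),(0,0),(-2,0))),
    (((-2,0),(0,0),(0,0)),((0,0),(2,0),(0,0)),((0,0),(0,0),(-2,0))),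
    (((-2,0),(0,0),(0,0)),((0,0),(-2,0),(0,0)),((0,0),(0,0),(2,0))),
    (((0,0),(0,0),(2,0)),((2,0),(0,0),(0,0)),((0,0),(2,0),(0,0))),
    (((0,0),(0,0),(2,0)),((-2,0),(0,0),(0,0)),((0,0),(-2,0),(0,0))),
    (((0,0),(0,0),(-2,0)),((2,0),(0,0),(0,0)),((0,0),(-2,0),(0,0))),
    (((0,0),(0,0),(-2,0)),((-2,0),(0,0),(0,0)),((0,0),(2,0),(0,0))),
    (((0,0),(2,0),(0,0)),((0,0),(0,0),(2,0)),((2,0),(0,0),(0,0))),
    (((0,0),(2,0),(0,0)),((0,0),(0,0),(-2,0)),((-2,0),(0,0),(0,0))),
    (((0,0),(-2,0),(0,0)),((0,0),(0,0),(2,0)),((-2,0),(0,0),(0,0))),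
    (((0,0),(-2,0),(0,0)),((0,0),(0,0),(-2,0)),((2,0),(0,0),(0,0)))]"

text \<open>The second components also record the class sizes 1, 3, 4, 4: the identity, the
  half-turns, and two mutually inverse classes of order 3.\<close>

definition tetra_witness :: "(nat \<times> nat) list" where
  "tetra_witness = [
    (0,0), (0,1), (8,1), (4,1), (0,2), (2,2), (3,2), (1,2), (0,3), (3,3), (1,3), (2,3)]"

text \<open>Listed in the order in which \<open>z_frames\<close> emits the matrices, so that
  \<open>octa_frames\<close> is an equality of lists. The same holds for
  \<open>icosa_list\<close>.\<close>

definition octa_list :: "zmat list" where
  "octa_list = [
    (((2,0),(0,0),(0,0)),((0,0),(2,0),(0,0)),((0,0),(0,0),(2,0))),
    (((0,0),(2,0),(0,0)),((0,0),(0,0),(2,0)),((2,0),(0,0),(0,0))),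
    (((0,0),(0,0),(2,0)),((2,0),(0,0),(0,0)),((0,0),(2,0),(0,0))),
    (((0,0),(2,0),(0,0)),((2,0),(0,0),(0,0)),((0,0),(0,0),(-2,0))),
    (((2,0),(0,0),(0,0)),((0,0),(0,0),(2,0)),((0,0),(-2,0),(0,0))),
    (((0,0),(0,0),(2,0)),((0,0),(2,0),(0,0)),((-2,0),(0,0),(0,0))),
    (((2,0),(0,0),(0,0)),((0,0),(0,0),(-2,0)),((0,0),(2,0),(0,0))),
    (((0,0),(2,0),(0,0)),((-2,0),(0,0),(0,0)),((0,0),(0,0),(2,0))),
    (((0,0),(0,0),(2,0)),((0,0),(-2,0),(0,0)),((2,0),(0,0),(0,0))),
    (((0,0),(2,0),(0,0)),((0,0),(0,0),(-2,0)),((-2,0),(0,0),(0,0))),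
    (((2,0),(0,0),(0,0)),((0,0),(-2,0),(0,0)),((0,0),(0,0),(-2,0))),
    (((0,0),(0,0),(2,0)),((-2,0),(0,0),(0,0)),((0,0),(-2,0),(0,0))),
    (((0,0),(0,0),(-2,0)),((0,0),(2,0),(0,0)),((2,0),(0,0),(0,0))),
    (((0,0),(-2,0),(0,0)),((2,0),(0,0),(0,0)),((0,0),(0,0),(2,0))),
    (((-2,0),(0,0),(0,0)),((0,0),(0,0),(2,0)),((0,0),(2,0),(0,0))),
    (((0,0),(0,0),(-2,0)),((2,0),(0,0),(0,0)),((0,0),(-2,0),(0,0))),
    (((-2,0),(0,0),(0,0)),((0,0),(2,0),(0,0)),((0,0),(0,0),(-2,0))),
    (((0,0),(-2,0),(0,0)),((0,0),(0,0),(2,0)),((-2,0),(0,0),(0,0))),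
    (((0,0),(0,0),(-2,0)),((-2,0),(0,0),(0,0)),((0,0),(2,0),(0,0))),
    (((0,0),(-2,0),(0,0)),((0,0),(0,0),(-2,0)),((2,0),(0,0),(0,0))),
    (((-2,0),(0,0),(0,0)),((0,0),(-2,0),(0,0)),((0,0),(0,0),(2,0))),
    (((0,0),(0,0),(-2,0)),((0,0),(-2,0),(0,0)),((-2,0),(0,0),(0,0))),
    (((-2,0),(0,0),(0,0)),((0,0),(0,0),(-2,0)),((0,0),(-2,0),(0,0))),
    (((0,0),(-2,0),(0,0)),((-2,0),(0,0),(0,0)),((0,0),(0,0),(-2,0)))]"

text \<open>Classes 0 to 4: the identity, rotations of order 3, half-turns about edge axes,
  quarter-turns, and half-turns about face axes.\<close>

definition octa_witness :: "(nat \<times> nat) list" where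
  "octa_witness = [
    (0,0), (0,1), (21,1), (0,2), (0,3), (13,3), (14,3), (2,3), (2,2), (11,1), (0,4), (4,1), (1,3),
    (12,3), (1,2), (3,1), (1,4), (10,1), (5,1), (9,1), (2,4), (6,2), (8,2), (7,2)]"

definition icosa_list :: "zmat list" where
  "icosa_list = [
    (((2,0),(0,0),(0,0)),((0,0),(2,0),(0,0)),((0,0),(0,0),(2,0))),
    (((0,-1),(-1,0),(-1,1)),((1,0),(1,-1),(0,1)),((1,-1),(0,1),(1,0))),
    (((0,-1),(1,0),(1,-1)),((-1,0),(1,-1),(0,1)),((-1,1),(0,1),(1,0))),
    (((-1,1),(0,-1),(1,0)),((0,1),(1,0),(-1,1)),((-1,0),(-1,1),(0,1))),
    (((-1,1),(0,1),(-1,0)),((0,-1),(1,0),(-1,1)),((1,0),(-1,1),(0,1))),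
    (((-2,0),(0,0),(0,0)),((0,0),(2,0),(0,0)),((0,0),(0,0),(-2,0))),
    (((0,1),(-1,0),(-1,1)),((-1,0),(1,-1),(0,1)),((1,-1),(0,-1),(-1,0))),
    (((0,1),(1,0),(1,-1)),((1,0),(1,-1),(0,1)),((-1,1),(0,-1),(-1,0))),
    (((1,-1),(0,-1),(1,0)),((0,-1),(1,0),(-1,1)),((-1,0),(1,-1),(0,-1))),
    (((1,-1),(0,1),(-1,0)),((0,1),(1,0),(-1,1)),((1,0),(1,-1),(0,-1))),
    (((-2,0),(0,0),(0,0)),((0,0),(-2,0),(0,0)),((0,0),(0,0),(2,0))),
    (((0,1),(-1,0),(-1,1)),((1,0),(-1,1),(0,-1)),((-1,1),(0,1),(1,0))),
    (((0,1),(1,0),(1,-1)),((-1,0),(-1,1),(0,-1)),((1,-1),(0,1),(1,0))),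
    (((1,-1),(0,-1),(1,0)),((0,1),(-1,0),(1,-1)),((1,0),(-1,1),(0,1))),
    (((1,-1),(0,1),(-1,0)),((0,-1),(-1,0),(1,-1)),((-1,0),(-1,1),(0,1))),
    (((2,0),(0,0),(0,0)),((0,0),(-2,0),(0,0)),((0,0),(0,0),(-2,0))),
    (((0,-1),(-1,0),(-1,1)),((-1,0),(-1,1),(0,-1)),((-1,1),(0,-1),(-1,0))),
    (((0,-1),(1,0),(1,-1)),((1,0),(-1,1),(0,-1)),((1,-1),(0,-1),(-1,0))),
    (((-1,1),(0,-1),(1,0)),((0,-1),(-1,0),(1,-1)),((1,0),(1,-1),(0,-1))),
    (((-1,1),(0,1),(-1,0)),((0,1),(-1,0),(1,-1)),((-1,0),(1,-1),(0,-1))),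
    (((0,1),(1,0),(-1,1)),((-1,0),(-1,1),(0,1)),((-1,1),(0,-1),(1,0))),
    (((0,-1),(1,0),(-1,1)),((1,0),(-1,1),(0,1)),((-1,1),(0,1),(-1,0))),
    (((0,0),(2,0),(0,0)),((0,0),(0,0),(2,0)),((2,0),(0,0),(0,0))),
    (((1,0),(1,-1),(0,1)),((1,-1),(0,1),(1,0)),((0,-1),(-1,0),(-1,1))),
    (((-1,0),(1,-1),(0,1)),((-1,1),(0,1),(1,0)),((0,-1),(1,0),(1,-1))),
    (((0,-1),(1,0),(-1,1)),((-1,0),(1,-1),(0,-1)),((1,-1),(0,-1),(1,0))),
    (((0,1),(1,0),(-1,1)),((1,0),(1,-1),(0,-1)),((1,-1),(0,1),(-1,0))),
    (((0,0),(2,0),(0,0)),((0,0),(0,0),(-2,0)),((-2,0),(0,0),(0,0))),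
    (((-1,0),(1,-1),(0,1)),((1,-1),(0,-1),(-1,0)),((0,1),(-1,0),(-1,1))),
    (((1,0),(1,-1),(0,1)),((-1,1),(0,-1),(-1,0)),((0,1),(1,0),(1,-1))),
    (((0,1),(-1,0),(1,-1)),((1,0),(-1,1),(0,1)),((1,-1),(0,-1),(1,0))),
    (((0,-1),(-1,0),(1,-1)),((-1,0),(-1,1),(0,1)),((1,-1),(0,1),(-1,0))),
    (((0,0),(-2,0),(0,0)),((0,0),(0,0),(2,0)),((-2,0),(0,0),(0,0))),
    (((1,0),(-1,1),(0,-1)),((-1,1),(0,1),(1,0)),((0,1),(-1,0),(-1,1))),
    (((-1,0),(-1,1),(0,-1)),((1,-1),(0,1),(1,0)),((0,1),(1,0),(1,-1))),
    (((0,-1),(-1,0),(1,-1)),((1,0),(1,-1),(0,-1)),((-1,1),(0,-1),(1,0))),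
    (((0,1),(-1,0),(1,-1)),((-1,0),(1,-1),(0,-1)),((-1,1),(0,1),(-1,0))),
    (((0,0),(-2,0),(0,0)),((0,0),(0,0),(-2,0)),((2,0),(0,0),(0,0))),
    (((-1,0),(-1,1),(0,-1)),((-1,1),(0,-1),(-1,0)),((0,-1),(-1,0),(-1,1))),
    (((1,0),(-1,1),(0,-1)),((1,-1),(0,-1),(-1,0)),((0,-1),(1,0),(1,-1))),
    (((1,-1),(0,1),(1,0)),((0,-1),(-1,0),(-1,1)),((1,0),(1,-1),(0,1))),
    (((-1,1),(0,1),(1,0)),((0,-1),(1,0),(1,-1)),((-1,0),(1,-1),(0,1))),
    (((-1,0),(-1,1),(0,1)),((-1,1),(0,-1),(1,0)),((0,1),(1,0),(-1,1))),
    (((1,0),(-1,1),(0,1)),((-1,1),(0,1),(-1,0)),((0,-1),(1,0),(-1,1))),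
    (((0,0),(0,0),(2,0)),((2,0),(0,0),(0,0)),((0,0),(2,0),(0,0))),
    (((1,-1),(0,-1),(-1,0)),((0,1),(-1,0),(-1,1)),((-1,0),(1,-1),(0,1))),
    (((-1,1),(0,-1),(-1,0)),((0,1),(1,0),(1,-1)),((1,0),(1,-1),(0,1))),
    (((-1,0),(1,-1),(0,-1)),((1,-1),(0,-1),(1,0)),((0,-1),(1,0),(-1,1))),
    (((1,0),(1,-1),(0,-1)),((1,-1),(0,1),(-1,0)),((0,1),(1,0),(-1,1))),
    (((0,0),(0,0),(-2,0)),((-2,0),(0,0),(0,0)),((0,0),(2,0),(0,0))),
    (((-1,1),(0,1),(1,0)),((0,1),(-1,0),(-1,1)),((1,0),(-1,1),(0,-1))),
    (((1,-1),(0,1),(1,0)),((0,1),(1,0),(1,-1)),((-1,0),(-1,1),(0,-1))),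
    (((1,0),(-1,1),(0,1)),((1,-1),(0,-1),(1,0)),((0,1),(-1,0),(1,-1))),
    (((-1,0),(-1,1),(0,1)),((1,-1),(0,1),(-1,0)),((0,-1),(-1,0),(1,-1))),
    (((0,0),(0,0),(2,0)),((-2,0),(0,0),(0,0)),((0,0),(-2,0),(0,0))),
    (((-1,1),(0,-1),(-1,0)),((0,-1),(-1,0),(-1,1)),((-1,0),(-1,1),(0,-1))),
    (((1,-1),(0,-1),(-1,0)),((0,-1),(1,0),(1,-1)),((1,0),(-1,1),(0,-1))),
    (((1,0),(1,-1),(0,-1)),((-1,1),(0,-1),(1,0)),((0,-1),(-1,0),(1,-1))),
    (((-1,0),(1,-1),(0,-1)),((-1,1),(0,1),(-1,0)),((0,1),(-1,0),(1,-1))),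
    (((0,0),(0,0),(-2,0)),((2,0),(0,0),(0,0)),((0,0),(-2,0),(0,0)))]"

text \<open>Classes 0 to 4: the identity, rotations by \<open>4 pi / 5\<close>, rotations by
  \<open>2 pi / 5\<close>, half-turns, and rotations of order 3; the angles are taken up to
  sign.\<close>

definition icosa_witness :: "(nat \<times> nat) list" where
  "icosa_witness = [
    (0,0), (0,1), (15,1), (0,2), (15,2), (0,3), (0,4), (12,4), (12,1), (6,1), (22,3), (13,2),
    (9,2), (34,4), (28,4), (44,3), (42,3), (43,3), (41,3), (40,3), (8,2), (24,3), (26,4), (12,2),
    (32,4), (5,1), (1,4), (13,4), (1,3), (13,1), (14,2), (23,3), (30,4), (6,2), (27,4), (10,1),
    (10,4), (2,4), (2,3), (9,1), (29,4), (5,2), (21,3), (11,2), (31,4), (33,4), (10,2), (20,3),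
    (7,2), (25,4), (3,3), (11,1), (8,1), (3,4), (11,4), (4,3), (7,1), (14,1), (14,4), (4,4)]"

lemma octa_frames: "z_frames cube_frame cube_zvertices = octa_list"
  by code_simp

lemma icosa_frames: "z_frames icosa_frame icosa_zvertices = icosa_list"
  by code_simp

lemma octa_preserves: "list_all (z_preserves cube_zvertices) octa_list"
  by code_simp

lemma icosa_preserves: "list_all (z_preserves icosa_zvertices) icosa_list"
  by code_simp

lemma octa_conjugate:
  "list_all2 (z_conjugate_to octa_list [0,1,3,4,10]) octa_list octa_witness"
  by code_simp

lemma icosa_conjugate:
  "list_all2 (z_conjugate_to icosa_list [0,1,3,5,6]) icosa_list icosa_witness"
  by code_simp

lemma icosa_nonconjugate:
  "list_all (\<lambda>a. list_all (\<lambda>b. a = b \<or> z_nonconjugate icosa_list (icosa_list ! ([0,1,3,5,6] ! a)) (icosa_list ! ([0,1,3,5,6] ! b)))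
    [0..<length [0,1,3,5,6::nat]]) [0..<length [0,1,3,5,6::nat]]"
  by code_simp

lemma zmult_eq_iff: "zmult A B = zmult C D \<longleftrightarrow> zmat_val A * zmat_val B = zmat_val C * zmat_val D"
  by (simp add: zmat_val_mult zmat_quarter_inj)

text \<open>Turns the hypotheses on class representatives into executable checks. Each witness puts
  its matrix into one class, disjointness excludes the others, and \<open>L\<close> has no
  repetitions, so class sizes are counts of class indices in \<open>W\<close>.\<close>

lemma (in finite_orthogonal_group) McKay_determinants_list:
  fixes L :: "zmat list" and R :: "nat list"
  defines "r a \<equiv> zmat_val (L ! (R ! a))"
  assumes L: "G = zmat_val ` set L" "distinct L"
    and R: "list_all (\<lambda>i. i < length L) R"
    and W: "list_all (\<lambda>(i,a). i < length L \<and> a < length R) W"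
    and conj: "list_all2 (z_conjugate_to L R) L W"
    and nonconj: "list_all (\<lambda>a. list_all (\<lambda>b. a = b \<or> z_nonconjugate L (L ! (R ! a)) (L ! (R ! b))) [0..<length R])
      [0..<length R]"
    and Rs: "complete_irreps G Rs"
  shows "map_poly of_int (det (Mt G Rs)) = (\<Prod>a<length R. [:1, - mtr (r a), mtr (r a), - 1:])"
    and "of_nat (length L) * map_poly of_int (det (M0t G Rs)) =
      (\<Sum>a<length R. of_nat (count_list (map snd W) a) *
        (\<Prod>b\<in>{..<length R} - {a}. [:1, - mtr (r b), mtr (r b), - 1:]))"
proof -
  let ?c = "length R" and ?n = "length L"
  have len: "length W = ?n" using conj by (simp add: list_all2_lengthD)
  have rG: "r a \<in> G" if "a < ?c" for a
    using that R by (auto simp: r_def L(1) list_all_length)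
  have W': "fst (W ! i) < ?n" "snd (W ! i) < ?c" if "i < ?n" for i
    using W that len by (auto simp: list_all_length case_prod_unfold)
  have mem: "zmat_val (L ! i) \<in> conj_class (r (snd (W ! i)))" if i: "i < ?n" for i
  proof -
    have "zmat_val (L ! fst (W ! i)) * zmat_val (L ! i) = r (snd (W ! i)) * zmat_val (L ! fst (W ! i))"
      using list_all2_nthD[OF conj i] unfolding z_conjugate_to_def case_prod_unfold zmult_eq_iff r_def .
    moreover have "zmat_val (L ! i) \<in> G" "zmat_val (L ! fst (W ! i)) \<in> G"
      using W'[OF i] i by (simp_all add: L(1))
    ultimately show ?thesis unfolding conj_class_def by blast
  qed
  have cover: "\<exists>a<?c. g \<in> conj_class (r a)" if "g \<in> G" for g
  proof -
    obtain i where "i < ?n" "g = zmat_val (L ! i)" using \<open>g \<in> G\<close> by (auto simp: L(1) in_set_conv_nth)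
    then show ?thesis using mem W' by blast
  qed
  have nc: "h * r a \<noteq> r b * h" if "a < ?c" "b < ?c" "a \<noteq> b" "h \<in> G" for a b h
  proof -
    obtain A where A: "A \<in> set L" "h = zmat_val A" using \<open>h \<in> G\<close> by (auto simp: L(1))
    have "a = b \<or> z_nonconjugate L (L ! (R ! a)) (L ! (R ! b))"
      using nonconj that(1,2) unfolding list_all_iff by simp
    then have "zmult A (L ! (R ! a)) \<noteq> zmult (L ! (R ! b)) A"
      using that(3) A(1) by (simp add: z_nonconjugate_def list_all_iff)
    then show ?thesis unfolding A(2) r_def zmult_eq_iff .
  qed
  have size: "card (conj_class (r a)) = count_list (map snd W) a" if a: "a < ?c" for a
  proof -
    have "conj_class (r a) = (\<lambda>i. zmat_val (L ! i)) ` {i. i < ?n \<and> snd (W ! i) = a}"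
    proof (intro equalityI subsetI)
      fix g assume g: "g \<in> conj_class (r a)"
      then have "g \<in> G" by (simp add: conj_class_def)
      then obtain i where i: "i < ?n" "g = zmat_val (L ! i)" by (auto simp: L(1) in_set_conv_nth)
      have "snd (W ! i) = a"
        using conj_class_disjoint[OF Rs rG cover nc _ a, of "snd (W ! i)" g] W'(2)[OF i(1)] mem[OF i(1)] g i(2) by blast
      then show "g \<in> (\<lambda>i. zmat_val (L ! i)) ` {i. i < ?n \<and> snd (W ! i) = a}" using i by blast
    next
      fix g assume "g \<in> (\<lambda>i. zmat_val (L ! i)) ` {i. i < ?n \<and> snd (W ! i) = a}"
      then obtain i where "i < ?n" "snd (W ! i) = a" "g = zmat_val (L ! i)" by blast
      then show "g \<in> conj_class (r a)" using mem by blast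
    qed
    moreover have "inj_on (\<lambda>i. zmat_val (L ! i)) {i. i < ?n \<and> snd (W ! i) = a}"
      using L(2) by (auto simp: inj_on_def zmat_val_inj nth_eq_iff_index_eq)
    ultimately have "card (conj_class (r a)) = card {i. i < ?n \<and> snd (W ! i) = a}"
      by (simp add: card_image)
    also have "\<dots> = card {i. i < length (map snd W) \<and> map snd W ! i = a}"
      using len by (intro arg_cong[where f = card]) auto
    also have "\<dots> = count_list (map snd W) a"
      unfolding count_list_eq_length_filter length_filter_conv_card by (intro arg_cong[where f = card]) auto
    finally show ?thesis .
  qed
  have cardG: "card G = ?n"
    unfolding L(1) using L(2) by (simp add: card_image inj_on_def zmat_val_inj distinct_card)
  note det = McKay_determinants[OF Rs rG cover nc]
  show "map_poly of_int (det (Mt G Rs)) = (\<Prod>a<?c. [:1, - mtr (r a), mtr (r a), - 1:])"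
    by (rule det(1))
  have "of_nat (card G) * map_poly of_int (det (M0t G Rs)) = (\<Sum>a<?c. of_nat (card (conj_class (r a))) *
        (\<Prod>b\<in>{..<?c} - {a}. [:1, - mtr (r b), mtr (r b), - 1:]))"
    by (rule det(2))
  also have "\<dots> = (\<Sum>a<?c. of_nat (count_list (map snd W) a) *
        (\<Prod>b\<in>{..<?c} - {a}. [:1, - mtr (r b), mtr (r b), - 1:]))"
    by (intro sum.cong refl) (simp add: size)
  finally show "of_nat (length L) * map_poly of_int (det (M0t G Rs)) =
      (\<Sum>a<length R. of_nat (count_list (map snd W) a) *
        (\<Prod>b\<in>{..<length R} - {a}. [:1, - mtr (r b), mtr (r b), - 1:]))"
    unfolding cardG .
qed

section \<open>Vertex sets and reconstruction of a rotation from three images\<close>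

lemma cube_vertices_eq: "cube_vertices = zvec_val ` set cube_zvertices"
proof -
  have "cube_vertices = (\<lambda>(a,b,c). vec_of_list [a,b,c]) ` ({1,-1} \<times> {1,-1} \<times> {1,-1})"
    unfolding cube_vertices_def by (auto simp del: vec_of_list_Cons)
  also have "\<dots> = zvec_val ` set cube_zvertices"
    by (auto simp: cube_zvertices_def image_iff)
  finally show ?thesis .
qed

lemma icosa_vertices_eq: "icosa_vertices = zvec_val ` set icosa_zvertices"
proof -
  have S: "{F a b |a b. a \<in> A \<and> b \<in> B} = (\<lambda>(a,b). F a b) ` (A \<times> B)"
    for F :: "complex \<Rightarrow> complex \<Rightarrow> complex vec" and A B by auto
  have "icosa_vertices = (\<lambda>(a,b). vec_of_list [0, a, b * golden]) ` ({1,-1} \<times> {1,-1})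
     \<union> (\<lambda>(a,b). vec_of_list [a, b * golden, 0]) ` ({1,-1} \<times> {1,-1})
     \<union> (\<lambda>(a,b). vec_of_list [b * golden, 0, a]) ` ({1,-1} \<times> {1,-1})"
    unfolding icosa_vertices_def S ..
  also have "\<dots> = zvec_val ` set icosa_zvertices"
    by (auto simp: icosa_zvertices_def image_iff)
  finally show ?thesis .
qed

text \<open>Each basis vector is half a sum or difference of reference vertices:
  \<open>e1 = (v0 + w0) / 2\<close>, \<open>e2 = (u0 - w0) / 2\<close>,
  \<open>e3 = (u0 - v0) / 2\<close>. This is where the columns of \<open>cube_frame\<close> come
  from.\<close>

lemma cube_frame_reconstruct:
  assumes g: "g \<in> carrier_mat 3 3"
    and u: "g *\<^sub>v zvec_val ((1,0),(1,0),(1,0)) = zvec_val u"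
    and v: "g *\<^sub>v zvec_val ((1,0),(1,0),(-1,0)) = zvec_val v"
    and w: "g *\<^sub>v zvec_val ((1,0),(-1,0),(1,0)) = zvec_val w"
  shows "g = zmat_val (cube_frame u v w)"
proof -
  obtain a b c d e f h i j where gm: "g = mat3 a b c d e f h i j" using mat3_exhaust[OF g] by blast
  obtain u1 u2 u3 v1 v2 v3 w1 w2 w3 where uvw: "u = (u1,u2,u3)" "v = (v1,v2,v3)" "w = (w1,w2,w3)"
    by (metis prod.collapse)
  have "a + b + c = zval u1" "d + e + f = zval u2" "h + i + j = zval u3"
    "a + b - c = zval v1" "d + e - f = zval v2" "h + i - j = zval v3"
    "a - b + c = zval w1" "d - e + f = zval w2" "h - i + j = zval w3"
    using u v w unfolding gm uvw
    by (simp_all add: mat3_apply vec3_eq_iff zval_numeral del: zval.simps vec_of_list_Cons)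
  note eqs = this[symmetric]
  show ?thesis
    unfolding gm uvw by (simp add: mat3_eq_iff zval_arith eqs del: zval.simps)
qed

text \<open>Here \<open>e2 = (u0 - v0) / 2\<close>, \<open>e1 = w0 - golden * e2\<close> and
  \<open>e3 = (u0 + v0) / (2 * golden)\<close>; as \<open>1 / golden = golden - 1\<close>, the last
  column carries the factor \<open>(-1,1)\<close>.\<close>

lemma icosa_frame_reconstruct:
  assumes g: "g \<in> carrier_mat 3 3"
    and u: "g *\<^sub>v zvec_val ((0,0),(1,0),(0,1)) = zvec_val u"
    and v: "g *\<^sub>v zvec_val ((0,0),(-1,0),(0,1)) = zvec_val v"
    and w: "g *\<^sub>v zvec_val ((1,0),(0,1),(0,0)) = zvec_val w"
  shows "g = zmat_val (icosa_frame u v w)"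
proof -
  obtain a b c d e f h i j where gm: "g = mat3 a b c d e f h i j" using mat3_exhaust[OF g] by blast
  obtain u1 u2 u3 v1 v2 v3 w1 w2 w3 where uvw: "u = (u1,u2,u3)" "v = (v1,v2,v3)" "w = (w1,w2,w3)"
    by (metis prod.collapse)
  have "b + c * golden = zval u1" "e + f * golden = zval u2" "i + j * golden = zval u3"
    "c * golden - b = zval v1" "f * golden - e = zval v2" "j * golden - i = zval v3"
    "a + b * golden = zval w1" "d + e * golden = zval w2" "h + i * golden = zval w3"
    using u v w unfolding gm uvw
    by (simp_all add: mat3_apply vec3_eq_iff zval_numeral del: zval.simps vec_of_list_Cons)
  note eqs = this[symmetric]
  show ?thesis
    unfolding gm uvw
    by (simp add: mat3_eq_iff zval_arith zval_numeral eqs del: zval.simps)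
      (simp add: algebra_simps golden_mult_left golden_square)
qed

section \<open>Computed checks and identification of the three groups\<close>

lemma tetra_rotations: "list_all z_rotation tetra_list"
  by code_simp

lemma tetra_closed:
  "list_all (\<lambda>A. list_ex (\<lambda>C. ztr A = C) tetra_list \<and>
    list_all (\<lambda>B. list_ex (\<lambda>C. zmult A B = zdouble C) tetra_list) tetra_list) tetra_list"
  by code_simp

text \<open>Normal form: every element is a sign matrix times a power of \<open>cyc3\<close>. The
  square of \<open>cyc3\<close> is not a generator, so it is produced separately.\<close>

lemma tetra_generated:
  "list_all (\<lambda>A. list_ex (\<lambda>i. list_ex (\<lambda>j. zmult (tetra_list ! i) (tetra_list ! j) = zdouble A) [0,4,8]) [0,1,2,3])
    tetra_list"
  "zmult (tetra_list ! 4) (tetra_list ! 4) = zdouble (tetra_list ! 8)"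
  by code_simp+

lemma tetra_conjugate: "list_all2 (z_conjugate_to tetra_list [0,1,4,8]) tetra_list tetra_witness"
  by code_simp

text \<open>The representatives 4 and 8 are inverse to each other and share the trace 0, so traces
  cannot separate them and all conjugators are tried.\<close>

lemma tetra_nonconjugate:
  "list_all (\<lambda>a. list_all (\<lambda>b. a = b \<or> z_nonconjugate tetra_list (tetra_list ! ([0,1,4,8] ! a)) (tetra_list ! ([0,1,4,8] ! b)))
    [0..<length [0,1,4,8::nat]]) [0..<length [0,1,4,8::nat]]"
  by code_simp

text \<open>The two kinds of half-turns, represented by 3 and 10, have the same trace -1; again the
  search over all conjugators separates them.\<close>

lemma octa_nonconjugate:
  "list_all (\<lambda>a. list_all (\<lambda>b. a = b \<or> z_nonconjugate octa_list (octa_list ! ([0,1,3,4,10] ! a)) (octa_list ! ([0,1,3,4,10] ! b)))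
    [0..<length [0,1,3,4,10::nat]]) [0..<length [0,1,3,4,10::nat]]"
  by code_simp

lemma zmult_eq_double_iff: "zmult A B = zdouble C \<longleftrightarrow> zmat_val A * zmat_val B = zmat_val C"
  unfolding zmat_val_mult zmat_quarter_double[of C, symmetric] zmat_quarter_inj ..

lemma tetra_mult_closed:
  assumes gh: "g \<in> zmat_val ` set tetra_list" "h \<in> zmat_val ` set tetra_list"
  shows "g * h \<in> zmat_val ` set tetra_list"
proof -
  obtain A B where AB: "A \<in> set tetra_list" "B \<in> set tetra_list" "g = zmat_val A" "h = zmat_val B"
    using gh by blast
  then obtain C where "C \<in> set tetra_list" "zmult A B = zdouble C"
    using tetra_closed unfolding list_all_iff list_ex_iff by blast
  then show ?thesis using AB(3,4) unfolding zmult_eq_double_iff by blast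
qed

text \<open>The list is one of the sets being intersected, as it is closed under products; any other
  such set contains it by the normal form of \<open>tetra_generated\<close>.
  \<open>mat_gen_group\<close> closes under products only, and the explicit list later shows closure
  under inverses.\<close>

lemma tetra_group_eq: "tetra_group = zmat_val ` set tetra_list"
proof -
  let ?T = "zmat_val ` set tetra_list"
  have d: "diag3 1 (-1) (-1) = zmat_val (tetra_list ! 1)" "diag3 (-1) 1 (-1) = zmat_val (tetra_list ! 2)"
    "diag3 (-1) (-1) 1 = zmat_val (tetra_list ! 3)" "cyc3 = zmat_val (tetra_list ! 4)" "1\<^sub>m 3 = zmat_val (tetra_list ! 0)"
    by (simp_all add: tetra_list_def, (rule eq_mat3I, simp_all add: diag3_def cyc3_def)+)
  have len: "length tetra_list = 12" by (simp add: tetra_list_def)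
  have mem: "zmat_val (tetra_list ! i) \<in> ?T" if "i < 12" for i using that len by simp
  have sub: "H \<supseteq> ?T" if H: "1\<^sub>m 3 \<in> H" "{diag3 1 (-1) (-1), diag3 (-1) 1 (-1), diag3 (-1) (-1) 1, cyc3} \<subseteq> H"
      "\<forall>a\<in>H. \<forall>b\<in>H. a * b \<in> H" for H
  proof (rule image_subsetI)
    fix A assume "A \<in> set tetra_list"
    then obtain i j where ij: "i \<in> {0,1,2,3}" "j \<in> {0,4,8}" and eq: "zmult (tetra_list ! i) (tetra_list ! j) = zdouble A"
      using tetra_generated(1) unfolding list_all_iff list_ex_iff by (metis list.set)
    have "zmat_val (tetra_list ! k) \<in> H" if "k \<in> {0,1,2,3,4}" for k
      using H(1,2) that unfolding d by auto
    moreover have "zmat_val (tetra_list ! 8) \<in> H"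
      using H(3) calculation[of 4] tetra_generated(2) unfolding zmult_eq_double_iff by (metis insert_iff)
    ultimately have "zmat_val (tetra_list ! i) \<in> H" "zmat_val (tetra_list ! j) \<in> H" using ij by auto
    then show "zmat_val A \<in> H" using H(3) eq unfolding zmult_eq_double_iff by metis
  qed
  have "?T \<in> {H. 1\<^sub>m 3 \<in> H \<and> {diag3 1 (-1) (-1), diag3 (-1) 1 (-1), diag3 (-1) (-1) 1, cyc3} \<subseteq> H \<and>
      (\<forall>a\<in>H. \<forall>b\<in>H. a * b \<in> H)}"
    using tetra_mult_closed mem unfolding d by simp
  then show ?thesis unfolding tetra_group_def mat_gen_group_def
    by (intro equalityI Inter_lower Inter_greatest) (use sub in auto)
qed

lemma finite_orthogonal_tetra: "finite_orthogonal_group tetra_group"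
  unfolding tetra_group_eq
proof
  let ?T = "zmat_val ` set tetra_list"
  show "finite ?T" by simp
  show "g \<in> carrier_mat 3 3" if "g \<in> ?T" for g using that by (auto simp: zmat_val_carrier)
  show "1\<^sub>m 3 \<in> ?T"
    unfolding zmat_val_one[symmetric] by (rule imageI) (simp add: zone_def tetra_list_def)
  show "g * h \<in> ?T" if "g \<in> ?T" "h \<in> ?T" for g h using that by (rule tetra_mult_closed)
  show "g\<^sup>T \<in> ?T" if g: "g \<in> ?T" for g
  proof -
    obtain A where A: "A \<in> set tetra_list" "g = zmat_val A" using g by blast
    then have "ztr A \<in> set tetra_list" using tetra_closed unfolding list_all_iff list_ex_iff by blast
    then show ?thesis unfolding A(2) zmat_val_transpose by (rule imageI)
  qed
  show "g * g\<^sup>T = 1\<^sub>m 3" if "g \<in> ?T" for g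
    using that tetra_rotations unfolding list_all_iff z_rotation_iff by blast
qed

text \<open>The difference \<open>u - v\<close> is a column of either frame, the third for the cube
  and the second for the icosahedron.\<close>

lemma z_edge_frames:
  "z_rotation (cube_frame u v w) \<Longrightarrow> z_edge (u,v)" "z_rotation (icosa_frame u v w) \<Longrightarrow> z_edge (u,v)"
  unfolding cube_frame.simps icosa_frame.simps z_edge_def using z_rotation_columns by auto

lemma octa_group_eq: "octa_group = zmat_val ` set octa_list"
  unfolding octa_group_def octa_frames[symmetric]
proof (rule rotation_group_eq_frames[OF cube_vertices_eq, where ?u0.0 = "((1,0),(1,0),(1,0))"
      and ?v0.0 = "((1,0),(1,0),(-1,0))" and ?w0.0 = "((1,0),(-1,0),(1,0))"])
  show "g = zmat_val (cube_frame u v w)"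
    if "g \<in> carrier_mat 3 3" "g *\<^sub>v zvec_val ((1,0),(1,0),(1,0)) = zvec_val u"
      "g *\<^sub>v zvec_val ((1,0),(1,0),(-1,0)) = zvec_val v" "g *\<^sub>v zvec_val ((1,0),(-1,0),(1,0)) = zvec_val w" for g u v w
    using that by (rule cube_frame_reconstruct)
  show "list_all (z_preserves cube_zvertices) (z_frames cube_frame cube_zvertices)"
    unfolding octa_frames by (rule octa_preserves)
qed (simp_all add: cube_zvertices_def z_edge_frames)

lemma icosa_group_eq: "icosa_group = zmat_val ` set icosa_list"
  unfolding icosa_group_def icosa_frames[symmetric]
proof (rule rotation_group_eq_frames[OF icosa_vertices_eq, where ?u0.0 = "((0,0),(1,0),(0,1))"
      and ?v0.0 = "((0,0),(-1,0),(0,1))" and ?w0.0 = "((1,0),(0,1),(0,0))"])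
  show "g = zmat_val (icosa_frame u v w)"
    if "g \<in> carrier_mat 3 3" "g *\<^sub>v zvec_val ((0,0),(1,0),(0,1)) = zvec_val u"
      "g *\<^sub>v zvec_val ((0,0),(-1,0),(0,1)) = zvec_val v" "g *\<^sub>v zvec_val ((1,0),(0,1),(0,0)) = zvec_val w" for g u v w
    using that by (rule icosa_frame_reconstruct)
  show "list_all (z_preserves icosa_zvertices) (z_frames icosa_frame icosa_zvertices)"
    unfolding icosa_frames by (rule icosa_preserves)
qed (simp_all add: icosa_zvertices_def z_edge_frames)

lemma finite_orthogonal_octa: "finite_orthogonal_group octa_group"
  unfolding octa_group_def
proof (rule rotation_group_finite_orthogonal)
  show "finite (rotation_group cube_vertices)"
    unfolding octa_group_def[symmetric] octa_group_eq by simp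
qed (simp_all add: cube_vertices_eq image_subset_iff zvec_val_carrier del: zvec_val.simps)

lemma finite_orthogonal_icosa: "finite_orthogonal_group icosa_group"
  unfolding icosa_group_def
proof (rule rotation_group_finite_orthogonal)
  show "finite (rotation_group icosa_vertices)"
    unfolding icosa_group_def[symmetric] icosa_group_eq by simp
qed (simp_all add: icosa_vertices_eq image_subset_iff zvec_val_carrier del: zvec_val.simps)

section \<open>Evaluation of the determinants\<close>

lemmas tetra_determinants = finite_orthogonal_group.McKay_determinants_list[OF finite_orthogonal_tetra tetra_group_eq
    _ _ _ tetra_conjugate tetra_nonconjugate]
lemmas octa_determinants = finite_orthogonal_group.McKay_determinants_list[OF finite_orthogonal_octa octa_group_eq
    _ _ _ octa_conjugate octa_nonconjugate]
lemmas icosa_determinants = finite_orthogonal_group.McKay_determinants_list[OF finite_orthogonal_icosa icosa_group_eq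
    _ _ _ icosa_conjugate icosa_nonconjugate]

text \<open>Both sides of the final identities are brought to coefficient lists, which leaves a
  comparison of numbers.\<close>

lemma tetra_polynomials:
  "[:1, -1:]^3 * Delta_minus [2,3,3] = [:1, -2, 0, 1, 2, -2, -1, 0, 2, -1:]"
  "[:1, -1:]^4 * Delta [2,2,3,3] = [:1, -2, -1, 2, 3, 0, -6, 0, 3, 2, -1, -2, 1:]"
  by code_simp+

lemma octa_polynomials:
  "[:1, -1:]^3 * [:1, 0, -1:] * Delta_minus [2,3,4] = [:1, -2, -1, 3, 1, -1, -2, -1, 1, 3, -1, -2, 1:]"
  "[:1, -1:]^4 * [:1, 0, -1:] * Delta [2,2,3,4] = [:1, -2, -2, 5, 1, -2, -2, -3, 3, 2, 2, -1, -5, 2, 2, -1:]"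
  by code_simp+

lemma icosa_polynomials:
  "[:1, -1:]^4 * Delta_minus [2,3,5] = [:1, -3, 2, 1, 0, -2, 2, -2, 0, 1, 2, -3, 1:]"
  "[:1, -1:]^5 * Delta [2,2,3,5] = [:1, -3, 1, 4, -2, -3, 1, 3, -3, -1, 3, 2, -4, -1, 3, -1:]"
  by code_simp+

lemma of_int_poly_eqI: "map_poly complex_of_int p = map_poly of_int q \<Longrightarrow> p = q"
  by simp

text \<open>Cancels the group order, so the class sum is never divided.\<close>

lemma of_int_poly_eqI_mult:
  "n \<noteq> 0 \<Longrightarrow> of_nat n * map_poly complex_of_int p = of_nat n * map_poly of_int q \<Longrightarrow> p = q"
  by simp

lemma tetra_list_wf: "distinct tetra_list" "list_all (\<lambda>i. i < length tetra_list) [0,1,4,8]"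
  "list_all (\<lambda>(i,a). i < length tetra_list \<and> a < length [0,1,4,8::nat]) tetra_witness"
  by (simp_all add: tetra_list_def tetra_witness_def)

lemma octa_list_wf: "distinct octa_list" "list_all (\<lambda>i. i < length octa_list) [0,1,3,4,10]"
  "list_all (\<lambda>(i,a). i < length octa_list \<and> a < length [0,1,3,4,10::nat]) octa_witness"
  by (simp_all add: octa_list_def octa_witness_def)

lemma icosa_list_wf: "distinct icosa_list" "list_all (\<lambda>i. i < length icosa_list) [0,1,3,5,6]"
  "list_all (\<lambda>(i,a). i < length icosa_list \<and> a < length [0,1,3,5,6::nat]) icosa_witness"
  by (simp_all add: icosa_list_def icosa_witness_def)

lemma tetra_traces:
  "mtr (zmat_val (tetra_list ! 0)) = 3" "mtr (zmat_val (tetra_list ! Suc 0)) = -1"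
  "mtr (zmat_val (tetra_list ! 4)) = 0" "mtr (zmat_val (tetra_list ! 8)) = 0"
  by (simp_all add: tetra_list_def mtr_zmat_val del: zmat_val.simps)

lemma octa_traces:
  "mtr (zmat_val (octa_list ! 0)) = 3" "mtr (zmat_val (octa_list ! Suc 0)) = 0"
  "mtr (zmat_val (octa_list ! 3)) = -1" "mtr (zmat_val (octa_list ! 4)) = 1"
  "mtr (zmat_val (octa_list ! 10)) = -1"
  by (simp_all add: octa_list_def mtr_zmat_val del: zmat_val.simps)

text \<open>The two classes of order 5 have traces \<open>golden\<close> and
  \<open>1 - golden\<close>, which are Galois conjugates.\<close>

lemma icosa_traces:
  "mtr (zmat_val (icosa_list ! 0)) = 3" "mtr (zmat_val (icosa_list ! Suc 0)) = 1 - golden"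
  "mtr (zmat_val (icosa_list ! 3)) = golden" "mtr (zmat_val (icosa_list ! 5)) = -1"
  "mtr (zmat_val (icosa_list ! 6)) = 0"
  by (simp_all add: icosa_list_def mtr_zmat_val del: zmat_val.simps)

text \<open>Class indices are iterated successors because unfolding the sums with
  \<open>lessThan_Suc\<close> produces them in this form.\<close>

lemma tetra_sizes:
  "length tetra_list = 12" "count_list (map snd tetra_witness) 0 = 1" "count_list (map snd tetra_witness) (Suc 0) = 3" "count_list (map snd tetra_witness) (Suc (Suc 0)) = 4" "count_list (map snd tetra_witness) (Suc (Suc (Suc 0))) = 4"
  by (simp_all add: tetra_list_def tetra_witness_def)

lemma octa_sizes:
  "length octa_list = 24" "count_list (map snd octa_witness) 0 = 1" "count_list (map snd octa_witness) (Suc 0) = 8" "count_list (map snd octa_witness) (Suc (Suc 0)) = 6" "count_list (map snd octa_witness) (Suc (Suc (Suc 0))) = 6" "count_list (map snd octa_witness) (Suc (Suc (Suc (Suc 0)))) = 3"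
  by (simp_all add: octa_list_def octa_witness_def)

lemma icosa_sizes:
  "length icosa_list = 60" "count_list (map snd icosa_witness) 0 = 1" "count_list (map snd icosa_witness) (Suc 0) = 12" "count_list (map snd icosa_witness) (Suc (Suc 0)) = 12" "count_list (map snd icosa_witness) (Suc (Suc (Suc 0))) = 15" "count_list (map snd icosa_witness) (Suc (Suc (Suc (Suc 0)))) = 20"
  by (simp_all add: icosa_list_def icosa_witness_def)

lemma det_tetra:
  assumes "complete_irreps tetra_group Rs"
  shows "det (M0t tetra_group Rs) = [:1, -1:]^3 * Delta_minus [2,3,3]"
    and "det (Mt tetra_group Rs) = [:1, -1:]^4 * Delta [2,2,3,3]"
proof -
  note D = tetra_determinants[OF tetra_list_wf assms]
  have "map_poly complex_of_int (det (Mt tetra_group Rs)) = map_poly of_int ([:1, -1:]^4 * Delta [2,2,3,3])"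
    unfolding D(1) tetra_polynomials
    by (simp add: lessThan_Suc tetra_traces)
  then show "det (Mt tetra_group Rs) = [:1, -1:]^4 * Delta [2,2,3,3]" by (rule of_int_poly_eqI)
  show "det (M0t tetra_group Rs) = [:1, -1:]^3 * Delta_minus [2,3,3]"
  proof (rule of_int_poly_eqI_mult)
    show "length tetra_list \<noteq> 0" by (simp add: tetra_sizes)
    show "of_nat (length tetra_list) * map_poly complex_of_int (det (M0t tetra_group Rs)) =
      of_nat (length tetra_list) * map_poly complex_of_int ([:1, -1:]^3 * Delta_minus [2,3,3])"
      unfolding D(2) tetra_polynomials
      by (simp add: lessThan_Suc tetra_traces tetra_sizes insert_Diff_if numeral_poly)
  qed
qed

lemma det_octa:
  assumes "complete_irreps octa_group Rs"
  shows "det (M0t octa_group Rs) = [:1, -1:]^3 * [:1, 0, -1:] * Delta_minus [2,3,4]"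
    and "det (Mt octa_group Rs) = [:1, -1:]^4 * [:1, 0, -1:] * Delta [2,2,3,4]"
proof -
  note D = octa_determinants[OF octa_list_wf assms]
  have "map_poly complex_of_int (det (Mt octa_group Rs)) = map_poly of_int ([:1, -1:]^4 * [:1, 0, -1:] * Delta [2,2,3,4])"
    unfolding D(1) octa_polynomials
    by (simp add: lessThan_Suc octa_traces)
  then show "det (Mt octa_group Rs) = [:1, -1:]^4 * [:1, 0, -1:] * Delta [2,2,3,4]" by (rule of_int_poly_eqI)
  show "det (M0t octa_group Rs) = [:1, -1:]^3 * [:1, 0, -1:] * Delta_minus [2,3,4]"
  proof (rule of_int_poly_eqI_mult)
    show "length octa_list \<noteq> 0" by (simp add: octa_sizes)
    show "of_nat (length octa_list) * map_poly complex_of_int (det (M0t octa_group Rs)) =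
      of_nat (length octa_list) * map_poly complex_of_int ([:1, -1:]^3 * [:1, 0, -1:] * Delta_minus [2,3,4])"
      unfolding D(2) octa_polynomials
      by (simp add: lessThan_Suc octa_traces octa_sizes insert_Diff_if numeral_poly)
  qed
qed

lemma det_icosa:
  assumes "complete_irreps icosa_group Rs"
  shows "det (M0t icosa_group Rs) = [:1, -1:]^4 * Delta_minus [2,3,5]"
    and "det (Mt icosa_group Rs) = [:1, -1:]^5 * Delta [2,2,3,5]"
proof -
  note D = icosa_determinants[OF icosa_list_wf assms]
  have "map_poly complex_of_int (det (Mt icosa_group Rs)) = map_poly of_int ([:1, -1:]^5 * Delta [2,2,3,5])"
    unfolding D(1) icosa_polynomials
    \<comment> \<open>The factors of the two classes of order 5 are Galois conjugate, so
      \<open>golden\<close> disappears from their product once its square is reduced.\<close>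
    by (simp add: lessThan_Suc icosa_traces) (simp add: algebra_simps golden_mult_left golden_square)
  then show "det (Mt icosa_group Rs) = [:1, -1:]^5 * Delta [2,2,3,5]" by (rule of_int_poly_eqI)
  show "det (M0t icosa_group Rs) = [:1, -1:]^4 * Delta_minus [2,3,5]"
  proof (rule of_int_poly_eqI_mult)
    show "length icosa_list \<noteq> 0" by (simp add: icosa_sizes)
    show "of_nat (length icosa_list) * map_poly complex_of_int (det (M0t icosa_group Rs)) =
      of_nat (length icosa_list) * map_poly complex_of_int ([:1, -1:]^4 * Delta_minus [2,3,5])"
      unfolding D(2) icosa_polynomials
      by (simp add: lessThan_Suc icosa_traces icosa_sizes insert_Diff_if numeral_poly) (simp add: algebra_simps golden_mult_left golden_square)
  qed
qed

theorem theorem2: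
  shows
   "(\<forall>Rs. complete_irreps tetra_group Rs \<longrightarrow>
       det (M0t tetra_group Rs) = [:1, -1:]^3 * Delta_minus [2,3,3] \<and>
       det (Mt tetra_group Rs) = [:1, -1:]^4 * Delta [2,2,3,3]) \<and>
    (\<forall>Rs. complete_irreps octa_group Rs \<longrightarrow>
       det (M0t octa_group Rs) = [:1, -1:]^3 * [:1, 0, -1:] * Delta_minus [2,3,4] \<and>
       det (Mt octa_group Rs) = [:1, -1:]^4 * [:1, 0, -1:] * Delta [2,2,3,4]) \<and>
    (\<forall>Rs. complete_irreps icosa_group Rs \<longrightarrow>
       det (M0t icosa_group Rs) = [:1, -1:]^4 * Delta_minus [2,3,5] \<and>
       det (Mt icosa_group Rs) = [:1, -1:]^5 * Delta [2,2,3,5])"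
  using det_tetra det_octa det_icosa by blast

end
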